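(* Let $A$ be a $k$-algebra, let $\mathfrak{C}$ be an $A$-coring and let $M$ be a right $\mathfrak{C}$-comodule that is finitely generated and projective as a right $A$-module. Let $B=\mathrm{End}^{-\mathfrak{C}}(M)$ be the endomorphism ring of the right $\mathfrak{C}$-comodule $M$. Suppose that: (a) $\mathfrak{C}$ is a flat left $A$-module; (b) the map $$B\otimes M\to \mathrm{Hom}^{\mathfrak{C}-}(M^*,M^*\otimes M),\qquad b\otimes m\mapsto[\xi\mapsto \xi\circ b\otimes m]$$ is an isomorphism of left $B$-modules; (c) the map $$\widetilde{\mathrm{can}}_M:M^*\otimes M\to \mathfrak{C},\qquad \xi\otimes m\mapsto \sum \xi(m_{[0]})m_{[1]}$$ is a split epimorphism of left $\mathfrak{C}$-comodules. Then $M$ is a Galois comodule and $M$ is a $k$-relatively projective left $B$-module (meaning that any $B$-module epimorphism $N\to M$ that splits as a $k$-module map splits as a $B$-module map).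
   Context: $k$ is a commutative ring with unit; algebras are associative unital $k$-algebras; an unadorned $\otimes$ is $\otimes_k$. An $A$-coring $\mathfrak{C}$ is a coalgebra object in $(A,A)$-bimodules, with coproduct $\Delta_{\mathfrak{C}}:\mathfrak{C}\to\mathfrak{C}\otimes_A\mathfrak{C}$ and counit $\varepsilon_{\mathfrak{C}}:\mathfrak{C}\to A$. A right $\mathfrak{C}$-comodule is a right $A$-module $M$ with a coassociative counital right $A$-linear coaction $\varrho^M:M\to M\otimes_A\mathfrak{C}$, written $\varrho^M(m)=\sum m_{[0]}\otimes m_{[1]}$; symmetrically for left comodules. $\mathrm{Hom}^{-\mathfrak{C}}(M,N)$ and $\mathrm{Hom}^{\mathfrak{C}-}(M,N)$ are the $k$-modules of right, respectively left, $\mathfrak{C}$-comodule maps. The product in $B=\mathrm{End}^{-\mathfrak{C}}(M)$ is composition, so $M$ is a left $B$-module by evaluation. $M^*=\mathrm{Hom}_A(M,A)$ is the dual of the right $A$-module $M$; it is a right $B$-module by $\xi b=\xi\circ b$. For $M_A$ finitely generated projective with dual basis $\{e^i\in M,\xi^i\in M^*\}$, $M^*$ is a left $\mathfrak{C}$-comodule with coaction $\xi\mapsto\sum_i \xi(e^i{}_{[0]})e^i{}_{[1]}\otimes_A\xi^i$; $M^*\otimes M$ is a left $\mathfrak{C}$-comodule via the coaction of $M^*$. $\mathrm{Hom}^{\mathfrak{C}-}(M^*,M^*\otimes M)$ is a left $B$-module via $(b\cdot f)(\xi)=f(\xi\circ b)$. A right $\mathfrak{C}$-comodule $M$, with $B=\mathrm{End}^{-\mathfrak{C}}(M)$,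 is a Galois (right) comodule if $M$ is finitely generated and projective as a right $A$-module and the evaluation map $\varphi_{\mathfrak{C}}:\mathrm{Hom}^{-\mathfrak{C}}(M,\mathfrak{C})\otimes_BM\to\mathfrak{C}$, $f\otimes m\mapsto f(m)$ is an isomorphism of right $\mathfrak{C}$-comodules. Equivalently, $\mathrm{can}_M:M^*\otimes_BM\to\mathfrak{C}$, $\xi\otimes m\mapsto\sum\xi(m_{[0]})m_{[1]}$ is an isomorphism of $A$-corings, where $M^*\otimes_BM$ has coproduct $\xi\otimes m\mapsto\sum_i\xi\otimes e^i\otimes\xi^i\otimes m$ and counit $\xi\otimes m\mapsto\xi(m)$. *)

theory Defs
  imports "HOL-Algebra.Free_Abelian_Groups" "HOL-Algebra.Module"
begin

section \<open>Algebras, modules and bimodules\<close>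

text \<open>
  The ring multiplication and unit inherited from the record type \<open>ring\<close> play no role for a
  (bi)module, exactly as for the library's \<open>module\<close> record. In particular the type does not force
  both actions to be meaningful: a right \<open>A\<close>-module is a \<open>bimodule\<close> record on whose left action
  only \<open>right_module_over\<close> imposes something.
\<close>

record ('r, 's, 'x) bimodule = "('r, 'x) module" +
  rsmult :: "'x \<Rightarrow> 's \<Rightarrow> 'x" (infixl \<open>\<triangleleft>\<index>\<close> 70)

locale k_algebra = module K A + A?: ring A for K and A (structure) +
  assumes smult_mult_left: "\<lbrakk>c \<in> carrier K; a \<in> carrier A; b \<in> carrier A\<rbrakk> \<Longrightarrow>
      (c \<odot> a) \<otimes> b = c \<odot> (a \<otimes> b)"
    and smult_mult_right: "\<lbrakk>c \<in> carrier K; a \<in> carrier A; b \<in> carrier A\<rbrakk> \<Longrightarrow>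
      a \<otimes> (c \<odot> b) = c \<odot> (a \<otimes> b)"

locale left_module = R?: ring R + X?: abelian_group X for R (structure) and X (structure) +
  assumes lact_closed: "\<lbrakk>r \<in> carrier R; x \<in> carrier X\<rbrakk> \<Longrightarrow> r \<odot>\<^bsub>X\<^esub> x \<in> carrier X"
    and lact_add_left: "\<lbrakk>r \<in> carrier R; s \<in> carrier R; x \<in> carrier X\<rbrakk> \<Longrightarrow>
      (r \<oplus> s) \<odot>\<^bsub>X\<^esub> x = r \<odot>\<^bsub>X\<^esub> x \<oplus>\<^bsub>X\<^esub> s \<odot>\<^bsub>X\<^esub> x"
    and lact_add_right: "\<lbrakk>r \<in> carrier R; x \<in> carrier X; y \<in> carrier X\<rbrakk> \<Longrightarrow>
      r \<odot>\<^bsub>X\<^esub> (x \<oplus>\<^bsub>X\<^esub> y) = r \<odot>\<^bsub>X\<^esub> x \<oplus>\<^bsub>X\<^esub> r \<odot>\<^bsub>X\<^esub> y"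
    and lact_mult: "\<lbrakk>r \<in> carrier R; s \<in> carrier R; x \<in> carrier X\<rbrakk> \<Longrightarrow>
      (r \<otimes> s) \<odot>\<^bsub>X\<^esub> x = r \<odot>\<^bsub>X\<^esub> (s \<odot>\<^bsub>X\<^esub> x)"
    and lact_one: "x \<in> carrier X \<Longrightarrow> \<one> \<odot>\<^bsub>X\<^esub> x = x"

locale right_module = S?: ring S + X?: abelian_group X for S (structure) and X (structure) +
  assumes ract_closed: "\<lbrakk>x \<in> carrier X; s \<in> carrier S\<rbrakk> \<Longrightarrow> x \<triangleleft>\<^bsub>X\<^esub> s \<in> carrier X"
    and ract_add_left: "\<lbrakk>x \<in> carrier X; y \<in> carrier X; s \<in> carrier S\<rbrakk> \<Longrightarrow>
      (x \<oplus>\<^bsub>X\<^esub> y) \<triangleleft>\<^bsub>X\<^esub> s = x \<triangleleft>\<^bsub>X\<^esub> s \<oplus>\<^bsub>X\<^esub> y \<triangleleft>\<^bsub>X\<^esub> s"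
    and ract_add_right: "\<lbrakk>x \<in> carrier X; s \<in> carrier S; t \<in> carrier S\<rbrakk> \<Longrightarrow>
      x \<triangleleft>\<^bsub>X\<^esub> (s \<oplus> t) = x \<triangleleft>\<^bsub>X\<^esub> s \<oplus>\<^bsub>X\<^esub> x \<triangleleft>\<^bsub>X\<^esub> t"
    and ract_mult: "\<lbrakk>x \<in> carrier X; s \<in> carrier S; t \<in> carrier S\<rbrakk> \<Longrightarrow>
      x \<triangleleft>\<^bsub>X\<^esub> (s \<otimes> t) = x \<triangleleft>\<^bsub>X\<^esub> s \<triangleleft>\<^bsub>X\<^esub> t"
    and ract_one: "x \<in> carrier X \<Longrightarrow> x \<triangleleft>\<^bsub>X\<^esub> \<one> = x"

text \<open>
  All modules and bimodules over \<open>K\<close>-algebras carry the \<open>K\<close>-module structure induced by the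
  algebra; on an \<open>(A, A)\<close>-bimodule the two induced structures agree. A right \<open>A\<close>-module is
  turned into a \<open>(K, A)\<close>-bimodule in this way.
\<close>

locale right_module_over = k_algebra K A + right_module A M for K and A and M (structure) +
  assumes k_action: "\<lbrakk>c \<in> carrier K; m \<in> carrier M\<rbrakk> \<Longrightarrow>
      c \<odot> m = m \<triangleleft> (c \<odot>\<^bsub>A\<^esub> \<one>\<^bsub>A\<^esub>)"

locale bimodule_over = k_algebra K A + left_module A C + right_module A C
  for K and A and C (structure) +
  assumes lact_ract: "\<lbrakk>a \<in> carrier A; x \<in> carrier C; b \<in> carrier A\<rbrakk> \<Longrightarrow>
      (a \<odot> x) \<triangleleft> b = a \<odot> (x \<triangleleft> b)"
    and k_central: "\<lbrakk>c \<in> carrier K; x \<in> carrier C\<rbrakk> \<Longrightarrow>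
      (c \<odot>\<^bsub>A\<^esub> \<one>\<^bsub>A\<^esub>) \<odot> x = x \<triangleleft> (c \<odot>\<^bsub>A\<^esub> \<one>\<^bsub>A\<^esub>)"

text \<open>Homomorphisms are extensional functions, so that equality of maps is equality on the carrier.\<close>

definition additive_maps :: "('x, 'p) ring_scheme \<Rightarrow> ('y, 'q) ring_scheme \<Rightarrow> ('x \<Rightarrow> 'y) set" where
  "additive_maps X Y = {f \<in> carrier X \<rightarrow>\<^sub>E carrier Y.
     \<forall>x\<in>carrier X. \<forall>y\<in>carrier X. f (x \<oplus>\<^bsub>X\<^esub> y) = f x \<oplus>\<^bsub>Y\<^esub> f y}"

definition left_hom ::
  "('r, 'w) ring_scheme \<Rightarrow> ('r, 'x, 'p) module_scheme \<Rightarrow> ('r, 'y, 'q) module_scheme \<Rightarrow> ('x \<Rightarrow> 'y) set"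
  where "left_hom R X Y = {f \<in> additive_maps X Y.
     \<forall>r\<in>carrier R. \<forall>x\<in>carrier X. f (r \<odot>\<^bsub>X\<^esub> x) = r \<odot>\<^bsub>Y\<^esub> f x}"

definition right_hom ::
  "('s, 'w) ring_scheme \<Rightarrow> ('r, 's, 'x) bimodule \<Rightarrow> ('t, 's, 'y) bimodule \<Rightarrow> ('x \<Rightarrow> 'y) set"
  where "right_hom S X Y = {f \<in> additive_maps X Y.
     \<forall>x\<in>carrier X. \<forall>s\<in>carrier S. f (x \<triangleleft>\<^bsub>X\<^esub> s) = f x \<triangleleft>\<^bsub>Y\<^esub> s}"

definition left_module_iso ::
  "('r, 'w) ring_scheme \<Rightarrow> ('r, 'x, 'p) module_scheme \<Rightarrow> ('r, 'y, 'q) module_scheme \<Rightarrow> ('x \<Rightarrow> 'y) \<Rightarrow> bool"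
  where "left_module_iso R X Y f \<longleftrightarrow> f \<in> left_hom R X Y \<and> bij_betw f (carrier X) (carrier Y)"

text \<open>An algebra as a bimodule over itself, and as an \<open>(A, K)\<close>-bimodule.\<close>

definition regular :: "('a, 'w) ring_scheme \<Rightarrow> ('a, 'a, 'a) bimodule" where
  "regular A = \<lparr>carrier = carrier A, mult = mult A, one = one A, zero = zero A, add = add A,
     smult = mult A, rsmult = mult A\<rparr>"

definition algebra_bimodule :: "('k, 'a) module \<Rightarrow> ('a, 'k, 'a) bimodule" where
  "algebra_bimodule A = \<lparr>carrier = carrier A, mult = mult A, one = one A, zero = zero A, add = add A,
     smult = mult A, rsmult = (\<lambda>a c. c \<odot>\<^bsub>A\<^esub> a)\<rparr>"

text \<open>
  Groups of homomorphisms with pointwise addition. For an \<open>(S, A)\<close>-bimodule \<open>X\<close> and an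
  \<open>(R, A)\<close>-bimodule \<open>Y\<close>, a set \<open>H\<close> of right \<open>A\<close>-linear maps \<open>X \<rightarrow> Y\<close> is an \<open>(R, S)\<close>-bimodule;
  for an \<open>(A, S)\<close>-bimodule \<open>X\<close> and an \<open>(A, T)\<close>-bimodule \<open>Y\<close>, a set \<open>H\<close> of left \<open>A\<close>-linear maps
  \<open>X \<rightarrow> Y\<close> is an \<open>(S, T)\<close>-bimodule (provided \<open>H\<close> is closed under the operations).
\<close>

definition right_hom_bimodule ::
  "('x \<Rightarrow> 'y) set \<Rightarrow> ('s, 'a, 'x) bimodule \<Rightarrow> ('r, 'a, 'y) bimodule \<Rightarrow> ('r, 's, 'x \<Rightarrow> 'y) bimodule"
  where "right_hom_bimodule H X Y = \<lparr>carrier = H, mult = undefined, one = undefined,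
     zero = (\<lambda>x\<in>carrier X. \<zero>\<^bsub>Y\<^esub>),
     add = (\<lambda>f g. \<lambda>x\<in>carrier X. f x \<oplus>\<^bsub>Y\<^esub> g x),
     smult = (\<lambda>r f. \<lambda>x\<in>carrier X. r \<odot>\<^bsub>Y\<^esub> f x),
     rsmult = (\<lambda>f s. \<lambda>x\<in>carrier X. f (s \<odot>\<^bsub>X\<^esub> x))\<rparr>"

definition left_hom_bimodule ::
  "('x \<Rightarrow> 'y) set \<Rightarrow> ('a, 's, 'x) bimodule \<Rightarrow> ('a, 't, 'y) bimodule \<Rightarrow> ('s, 't, 'x \<Rightarrow> 'y) bimodule"
  where "left_hom_bimodule H X Y = \<lparr>carrier = H, mult = undefined, one = undefined,
     zero = (\<lambda>x\<in>carrier X. \<zero>\<^bsub>Y\<^esub>),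
     add = (\<lambda>f g. \<lambda>x\<in>carrier X. f x \<oplus>\<^bsub>Y\<^esub> g x),
     smult = (\<lambda>s f. \<lambda>x\<in>carrier X. f (x \<triangleleft>\<^bsub>X\<^esub> s)),
     rsmult = (\<lambda>f t. \<lambda>x\<in>carrier X. f x \<triangleleft>\<^bsub>Y\<^esub> t)\<rparr>"

text \<open>For an \<open>(S, A)\<close>-bimodule \<open>M\<close> this is the \<open>(A, S)\<close>-bimodule \<open>M\<^sup>* = Hom\<^sub>A(M, A)\<close>.\<close>

definition dual :: "('a, 'w) ring_scheme \<Rightarrow> ('s, 'a, 'm) bimodule \<Rightarrow> ('a, 's, 'm \<Rightarrow> 'a) bimodule" where
  "dual A M = right_hom_bimodule (right_hom A M (regular A)) M (regular A)"


section \<open>Tensor products\<close>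

text \<open>
  The tensor product over \<open>S\<close> of a right \<open>S\<close>-module \<open>X\<close> and a left \<open>S\<close>-module \<open>Y\<close> is the free
  abelian group on the pairs modulo the subgroup generated by the usual relators.
\<close>

type_synonym ('x, 'y) tensor = "('x \<times> 'y \<Rightarrow>\<^sub>0 int) set"

definition tensor_relators ::
  "('s, 'w) ring_scheme \<Rightarrow> ('r, 's, 'x) bimodule \<Rightarrow> ('s, 't, 'y) bimodule \<Rightarrow> ('x \<times> 'y \<Rightarrow>\<^sub>0 int) set"
  where "tensor_relators S X Y =
     {frag_of (x \<oplus>\<^bsub>X\<^esub> x', y) - frag_of (x, y) - frag_of (x', y) | x x' y.
        x \<in> carrier X \<and> x' \<in> carrier X \<and> y \<in> carrier Y}
   \<union> {frag_of (x, y \<oplus>\<^bsub>Y\<^esub> y') - frag_of (x, y) - frag_of (x, y') | x y y'.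
        x \<in> carrier X \<and> y \<in> carrier Y \<and> y' \<in> carrier Y}
   \<union> {frag_of (x \<triangleleft>\<^bsub>X\<^esub> s, y) - frag_of (x, s \<odot>\<^bsub>Y\<^esub> y) | x s y.
        x \<in> carrier X \<and> s \<in> carrier S \<and> y \<in> carrier Y}"

definition tensor_pairs :: "('r, 's, 'x) bimodule \<Rightarrow> ('s, 't, 'y) bimodule \<Rightarrow> ('x \<times> 'y \<Rightarrow>\<^sub>0 int) monoid"
  where "tensor_pairs X Y = free_Abelian_group (carrier X \<times> carrier Y)"

definition tensor_kernel ::
  "('s, 'w) ring_scheme \<Rightarrow> ('r, 's, 'x) bimodule \<Rightarrow> ('s, 't, 'y) bimodule \<Rightarrow> ('x \<times> 'y \<Rightarrow>\<^sub>0 int) set"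
  where "tensor_kernel S X Y = generate (tensor_pairs X Y) (tensor_relators S X Y)"

definition tensor_group ::
  "('s, 'w) ring_scheme \<Rightarrow> ('r, 's, 'x) bimodule \<Rightarrow> ('s, 't, 'y) bimodule \<Rightarrow> ('x, 'y) tensor ring"
  where "tensor_group S X Y = (let Q = tensor_pairs X Y Mod tensor_kernel S X Y in
     \<lparr>carrier = carrier Q, mult = undefined, one = undefined, zero = one Q, add = mult Q\<rparr>)"

definition tensor_class ::
  "('s, 'w) ring_scheme \<Rightarrow> ('r, 's, 'x) bimodule \<Rightarrow> ('s, 't, 'y) bimodule
     \<Rightarrow> ('x \<times> 'y \<Rightarrow>\<^sub>0 int) \<Rightarrow> ('x, 'y) tensor"
  where "tensor_class S X Y p = tensor_kernel S X Y #>\<^bsub>tensor_pairs X Y\<^esub> p"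

text \<open>The elementary tensor \<open>x \<otimes> y\<close>.\<close>

definition tens ::
  "('s, 'w) ring_scheme \<Rightarrow> ('r, 's, 'x) bimodule \<Rightarrow> ('s, 't, 'y) bimodule \<Rightarrow> 'x \<Rightarrow> 'y \<Rightarrow> ('x, 'y) tensor"
  where "tens S X Y x y = tensor_class S X Y (frag_of (x, y))"

text \<open>
  The additive map determined by \<open>x \<otimes> y \<mapsto> f x y\<close>; it exists uniquely when \<open>f\<close> is biadditive and
  \<open>S\<close>-balanced, see \<open>tensor_universal\<close> below.
\<close>

definition tensor_lift ::
  "('s, 'w) ring_scheme \<Rightarrow> ('r, 's, 'x) bimodule \<Rightarrow> ('s, 't, 'y) bimodule \<Rightarrow> ('z, 'q) ring_scheme
     \<Rightarrow> ('x \<Rightarrow> 'y \<Rightarrow> 'z) \<Rightarrow> ('x, 'y) tensor \<Rightarrow> 'z"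
  where "tensor_lift S X Y Z f = (THE h. h \<in> additive_maps (tensor_group S X Y) Z \<and>
     (\<forall>x\<in>carrier X. \<forall>y\<in>carrier Y. h (tens S X Y x y) = f x y))"

text \<open>For an \<open>(R, S)\<close>-bimodule \<open>X\<close> and an \<open>(S, T)\<close>-bimodule \<open>Y\<close>, the \<open>(R, T)\<close>-bimodule \<open>X \<otimes>\<^sub>S Y\<close>.\<close>

definition tensor ::
  "('s, 'w) ring_scheme \<Rightarrow> ('r, 's, 'x) bimodule \<Rightarrow> ('s, 't, 'y) bimodule
     \<Rightarrow> ('r, 't, ('x, 'y) tensor) bimodule"
  where "tensor S X Y = (let G = tensor_group S X Y in
     \<lparr>carrier = carrier G, mult = undefined, one = undefined, zero = zero G, add = add G,
      smult = (\<lambda>r. tensor_lift S X Y G (\<lambda>x y. tens S X Y (r \<odot>\<^bsub>X\<^esub> x) y)),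
      rsmult = (\<lambda>u t. tensor_lift S X Y G (\<lambda>x y. tens S X Y x (y \<triangleleft>\<^bsub>Y\<^esub> t)) u)\<rparr>)"

text \<open>The map \<open>f \<otimes> g : X \<otimes>\<^sub>S Y \<rightarrow> X' \<otimes>\<^sub>S Y'\<close>.\<close>

definition tensor_map ::
  "('s, 'w) ring_scheme \<Rightarrow> ('r, 's, 'x) bimodule \<Rightarrow> ('s, 't, 'y) bimodule
     \<Rightarrow> ('r1, 's, 'x1) bimodule \<Rightarrow> ('s, 't1, 'y1) bimodule
     \<Rightarrow> ('x \<Rightarrow> 'x1) \<Rightarrow> ('y \<Rightarrow> 'y1) \<Rightarrow> ('x, 'y) tensor \<Rightarrow> ('x1, 'y1) tensor"
  where "tensor_map S X Y X' Y' f g =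
     tensor_lift S X Y (tensor S X' Y') (\<lambda>x y. tens S X' Y' (f x) (g y))"

text \<open>The canonical isomorphism \<open>(X \<otimes>\<^sub>R Y) \<otimes>\<^sub>S Z \<rightarrow> X \<otimes>\<^sub>R (Y \<otimes>\<^sub>S Z)\<close>.\<close>

definition tensor_assoc ::
  "('r, 'v) ring_scheme \<Rightarrow> ('s, 'w) ring_scheme \<Rightarrow> ('q, 'r, 'x) bimodule \<Rightarrow> ('r, 's, 'y) bimodule
     \<Rightarrow> ('s, 't, 'z) bimodule \<Rightarrow> (('x, 'y) tensor, 'z) tensor \<Rightarrow> ('x, ('y, 'z) tensor) tensor"
  where "tensor_assoc R S X Y Z =
     tensor_lift S (tensor R X Y) Z (tensor R X (tensor S Y Z))
       (\<lambda>u z. tensor_lift R X Y (tensor R X (tensor S Y Z))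
                (\<lambda>x y. tens R X (tensor S Y Z) x (tens S Y Z y z)) u)"


section \<open>Flat and finitely generated projective modules\<close>

text \<open>
  A definition cannot quantify over all types, so the modules occurring in the definitions of
  flatness and projectivity range over all modules with carrier in a given type, passed as an
  argument; the \<open>unit\<close> in their types is the unused left action. The type \<open>(nat \<Rightarrow> 'a) set\<close> contains
  a copy of every finitely generated module, so flatness for it is flatness for all types:
  \<open>flat_left_module_any_type\<close> below.
\<close>

definition flat_left_module ::
  "'u itself \<Rightarrow> ('a, 'w) ring_scheme \<Rightarrow> ('a, 't, 'c) bimodule \<Rightarrow> bool"
  where "flat_left_module _ A C \<longleftrightarrow> left_module A C \<and>
     (\<forall>(N' :: (unit, 'a, 'u) bimodule) (N :: (unit, 'a, 'u) bimodule) j.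
        right_module A N' \<and> right_module A N \<and> j \<in> right_hom A N' N \<and> inj_on j (carrier N') \<longrightarrow>
        inj_on (tensor_map A N' C N C j (\<lambda>c. c)) (carrier (tensor A N' C)))"

definition projective_right_module ::
  "'u itself \<Rightarrow> 'v itself \<Rightarrow> ('a, 'w) ring_scheme \<Rightarrow> ('t, 'a, 'm) bimodule \<Rightarrow> bool"
  where "projective_right_module _ _ A M \<longleftrightarrow> right_module A M \<and>
     (\<forall>(X :: (unit, 'a, 'u) bimodule) (Y :: (unit, 'a, 'v) bimodule) p f.
        right_module A X \<and> right_module A Y \<and> p \<in> right_hom A X Y \<and> p ` carrier X = carrier Y \<and>
        f \<in> right_hom A M Y \<longrightarrow>
        (\<exists>g\<in>right_hom A M X. \<forall>m\<in>carrier M. p (g m) = f m))"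

definition finitely_generated_right_module ::
  "('a, 'w) ring_scheme \<Rightarrow> ('t, 'a, 'm) bimodule \<Rightarrow> bool"
  where "finitely_generated_right_module A M \<longleftrightarrow> right_module A M \<and>
     (\<exists>E. finite E \<and> E \<subseteq> carrier M \<and>
        (\<forall>m\<in>carrier M. \<exists>a\<in>E \<rightarrow> carrier A. m = (\<Oplus>\<^bsub>M\<^esub>e\<in>E. e \<triangleleft>\<^bsub>M\<^esub> a e)))"

text \<open>
  The types \<open>nat \<Rightarrow> 'a\<close> and \<open>'m\<close> suffice for finitely generated modules: the first contains the
  free modules of finite rank, the second \<open>M\<close> itself. See \<open>fgp_imp_dual_basis\<close> and
  \<open>dual_basis_imp_projective\<close> below.
\<close>

definition fgp_right_module :: "('a, 'w) ring_scheme \<Rightarrow> ('t, 'a, 'm) bimodule \<Rightarrow> bool" where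
  "fgp_right_module A M \<longleftrightarrow> finitely_generated_right_module A M \<and>
     projective_right_module TYPE(nat \<Rightarrow> 'a) TYPE('m) A M"

definition dual_basis ::
  "('a, 'w) ring_scheme \<Rightarrow> ('t, 'a, 'm) bimodule \<Rightarrow> nat \<Rightarrow> (nat \<Rightarrow> 'm) \<Rightarrow> (nat \<Rightarrow> 'm \<Rightarrow> 'a) \<Rightarrow> bool"
  where "dual_basis A M n e x \<longleftrightarrow>
     (\<forall>i<n. e i \<in> carrier M \<and> x i \<in> carrier (dual A M)) \<and>
     (\<forall>m\<in>carrier M. m = (\<Oplus>\<^bsub>M\<^esub>i\<in>{..<n}. e i \<triangleleft>\<^bsub>M\<^esub> x i m))"


section \<open>Corings and comodules\<close>

locale coring = bimodule_over K A C
  for K :: "('k, 'w) ring_scheme" and A :: "('k, 'a) module" and C :: "('a, 'a, 'c) bimodule"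
    and \<Delta> :: "'c \<Rightarrow> ('c, 'c) tensor" and \<epsilon> :: "'c \<Rightarrow> 'a" +
  assumes comult_left: "\<Delta> \<in> left_hom A C (tensor A C C)"
    and comult_right: "\<Delta> \<in> right_hom A C (tensor A C C)"
    and counit_left: "\<epsilon> \<in> left_hom A C (regular A)"
    and counit_right: "\<epsilon> \<in> right_hom A C (regular A)"
    and comult_coassoc: "c \<in> carrier C \<Longrightarrow>
      tensor_assoc A A C C C (tensor_map A C C (tensor A C C) C \<Delta> (\<lambda>d. d) (\<Delta> c))
        = tensor_map A C C C (tensor A C C) (\<lambda>d. d) \<Delta> (\<Delta> c)"
    and counital_left: "c \<in> carrier C \<Longrightarrow>
      tensor_lift A C C C (\<lambda>d d'. \<epsilon> d \<odot>\<^bsub>C\<^esub> d') (\<Delta> c) = c"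
    and counital_right: "c \<in> carrier C \<Longrightarrow>
      tensor_lift A C C C (\<lambda>d d'. d \<triangleleft>\<^bsub>C\<^esub> \<epsilon> d') (\<Delta> c) = c"

locale right_comodule = coring K A C \<Delta> \<epsilon> + right_module_over K A M
  for K :: "('k, 'w) ring_scheme" and A :: "('k, 'a) module" and C :: "('a, 'a, 'c) bimodule"
    and \<Delta> and \<epsilon> and M :: "('k, 'a, 'm) bimodule" and \<rho> :: "'m \<Rightarrow> ('m, 'c) tensor" +
  assumes coact_right: "\<rho> \<in> right_hom A M (tensor A M C)"
    and coact_coassoc: "m \<in> carrier M \<Longrightarrow>
      tensor_assoc A A M C C (tensor_map A M C (tensor A M C) C \<rho> (\<lambda>d. d) (\<rho> m))
        = tensor_map A M C M (tensor A C C) (\<lambda>n. n) \<Delta> (\<rho> m)"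
    and coact_counital: "m \<in> carrier M \<Longrightarrow>
      tensor_lift A M C M (\<lambda>n d. n \<triangleleft>\<^bsub>M\<^esub> \<epsilon> d) (\<rho> m) = m"

definition right_comodule_hom ::
  "('a, 'w) ring_scheme \<Rightarrow> ('a, 'a, 'c) bimodule
     \<Rightarrow> ('r, 'a, 'x) bimodule \<Rightarrow> ('x \<Rightarrow> ('x, 'c) tensor)
     \<Rightarrow> ('t, 'a, 'y) bimodule \<Rightarrow> ('y \<Rightarrow> ('y, 'c) tensor) \<Rightarrow> ('x \<Rightarrow> 'y) set"
  where "right_comodule_hom A C X rX Y rY = {f \<in> right_hom A X Y.
     \<forall>x\<in>carrier X. rY (f x) = tensor_map A X C Y C f (\<lambda>c. c) (rX x)}"

definition left_comodule_hom ::
  "('a, 'w) ring_scheme \<Rightarrow> ('a, 'a, 'c) bimodule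
     \<Rightarrow> ('a, 'r, 'x) bimodule \<Rightarrow> ('x \<Rightarrow> ('c, 'x) tensor)
     \<Rightarrow> ('a, 't, 'y) bimodule \<Rightarrow> ('y \<Rightarrow> ('c, 'y) tensor) \<Rightarrow> ('x \<Rightarrow> 'y) set"
  where "left_comodule_hom A C X lX Y lY = {f \<in> left_hom A X Y.
     \<forall>x\<in>carrier X. lY (f x) = tensor_map A C X C Y (\<lambda>c. c) f (lX x)}"

definition right_comodule_iso ::
  "('a, 'w) ring_scheme \<Rightarrow> ('a, 'a, 'c) bimodule
     \<Rightarrow> ('r, 'a, 'x) bimodule \<Rightarrow> ('x \<Rightarrow> ('x, 'c) tensor)
     \<Rightarrow> ('t, 'a, 'y) bimodule \<Rightarrow> ('y \<Rightarrow> ('y, 'c) tensor) \<Rightarrow> ('x \<Rightarrow> 'y) \<Rightarrow> bool"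
  where "right_comodule_iso A C X rX Y rY f \<longleftrightarrow>
     f \<in> right_comodule_hom A C X rX Y rY \<and> bij_betw f (carrier X) (carrier Y)"

definition left_comodule_split_epi ::
  "('a, 'w) ring_scheme \<Rightarrow> ('a, 'a, 'c) bimodule
     \<Rightarrow> ('a, 'r, 'x) bimodule \<Rightarrow> ('x \<Rightarrow> ('c, 'x) tensor)
     \<Rightarrow> ('a, 't, 'y) bimodule \<Rightarrow> ('y \<Rightarrow> ('c, 'y) tensor) \<Rightarrow> ('x \<Rightarrow> 'y) \<Rightarrow> bool"
  where "left_comodule_split_epi A C X lX Y lY f \<longleftrightarrow>
     f \<in> left_comodule_hom A C X lX Y lY \<and>
     (\<exists>g\<in>left_comodule_hom A C Y lY X lX. \<forall>y\<in>carrier Y. f (g y) = y)"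

text \<open>
  The coactions of \<open>X \<otimes>\<^sub>S Y\<close> induced by a left coaction \<open>lX\<close> of \<open>X\<close>, resp. by a right coaction
  \<open>rY\<close> of \<open>Y\<close>.
\<close>

definition tensor_left_coaction ::
  "('a, 'v) ring_scheme \<Rightarrow> ('s, 'w) ring_scheme \<Rightarrow> ('a, 'a, 'c) bimodule
     \<Rightarrow> ('a, 's, 'x) bimodule \<Rightarrow> ('x \<Rightarrow> ('c, 'x) tensor) \<Rightarrow> ('s, 't, 'y) bimodule
     \<Rightarrow> ('x, 'y) tensor \<Rightarrow> ('c, ('x, 'y) tensor) tensor"
  where "tensor_left_coaction A S C X lX Y =
     tensor_lift S X Y (tensor A C (tensor S X Y))
       (\<lambda>x y. tensor_lift A C X (tensor A C (tensor S X Y))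
                (\<lambda>c x'. tens A C (tensor S X Y) c (tens S X Y x' y)) (lX x))"

definition tensor_right_coaction ::
  "('a, 'v) ring_scheme \<Rightarrow> ('s, 'w) ring_scheme \<Rightarrow> ('a, 'a, 'c) bimodule
     \<Rightarrow> ('r, 's, 'x) bimodule \<Rightarrow> ('s, 'a, 'y) bimodule \<Rightarrow> ('y \<Rightarrow> ('y, 'c) tensor)
     \<Rightarrow> ('x, 'y) tensor \<Rightarrow> (('x, 'y) tensor, 'c) tensor"
  where "tensor_right_coaction A S C X Y rY =
     tensor_lift S X Y (tensor A (tensor S X Y) C)
       (\<lambda>x y. tensor_lift A Y C (tensor A (tensor S X Y) C)
                (\<lambda>y' c. tens A (tensor S X Y) C (tens S X Y x y') c) (rY y))"

text \<open>The element \<open>\<Sum> \<xi>(m\<^sub>[\<^sub>0\<^sub>]) m\<^sub>[\<^sub>1\<^sub>]\<close> of \<open>C\<close>.\<close>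

definition coefficient ::
  "('a, 'w) ring_scheme \<Rightarrow> ('a, 'a, 'c) bimodule \<Rightarrow> ('r, 'a, 'm) bimodule \<Rightarrow> ('m \<Rightarrow> ('m, 'c) tensor)
     \<Rightarrow> ('m \<Rightarrow> 'a) \<Rightarrow> 'm \<Rightarrow> 'c"
  where "coefficient A C M \<rho> \<xi> m = tensor_lift A M C C (\<lambda>n c. \<xi> n \<odot>\<^bsub>C\<^esub> c) (\<rho> m)"

text \<open>
  The left coaction of \<open>M\<^sup>*\<close>; it does not depend on the chosen dual basis, which exists by
  \<open>fgp_imp_dual_basis\<close>.
\<close>

definition dual_coaction ::
  "('a, 'w) ring_scheme \<Rightarrow> ('a, 'a, 'c) bimodule \<Rightarrow> ('s, 'a, 'm) bimodule \<Rightarrow> ('m \<Rightarrow> ('m, 'c) tensor)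
     \<Rightarrow> ('m \<Rightarrow> 'a) \<Rightarrow> ('c, 'm \<Rightarrow> 'a) tensor"
  where "dual_coaction A C M \<rho> =
     (let (n, e, x) = (SOME (n, e, x). dual_basis A M n e x) in
      (\<lambda>\<xi>\<in>carrier (dual A M).
         \<Oplus>\<^bsub>tensor A C (dual A M)\<^esub>i\<in>{..<n}. tens A C (dual A M) (coefficient A C M \<rho> \<xi> (e i)) (x i)))"


section \<open>The endomorphism ring and Galois comodules\<close>

definition comodule_End ::
  "('k, 'a) module \<Rightarrow> ('a, 'a, 'c) bimodule \<Rightarrow> ('k, 'a, 'm) bimodule \<Rightarrow> ('m \<Rightarrow> ('m, 'c) tensor)
     \<Rightarrow> ('k, 'm \<Rightarrow> 'm) module"
  where "comodule_End A C M \<rho> = \<lparr>carrier = right_comodule_hom A C M \<rho> M \<rho>,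
     mult = compose (carrier M),
     one = (\<lambda>m\<in>carrier M. m),
     zero = (\<lambda>m\<in>carrier M. \<zero>\<^bsub>M\<^esub>),
     add = (\<lambda>f g. \<lambda>m\<in>carrier M. f m \<oplus>\<^bsub>M\<^esub> g m),
     smult = (\<lambda>c f. \<lambda>m\<in>carrier M. c \<odot>\<^bsub>M\<^esub> f m)\<rparr>"

text \<open>\<open>M\<close> as a \<open>(B, A)\<close>-bimodule, with \<open>B\<close> acting by evaluation.\<close>

definition eval_bimodule :: "('k, 'a, 'm) bimodule \<Rightarrow> ('m \<Rightarrow> 'm, 'a, 'm) bimodule" where
  "eval_bimodule M = \<lparr>carrier = carrier M, mult = mult M, one = one M, zero = zero M, add = add M,
     smult = (\<lambda>b m. b m), rsmult = rsmult M\<rparr>"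

text \<open>\<open>Hom\<^sup>-\<^sup>C(M, C)\<close> as an \<open>(A, B)\<close>-bimodule.\<close>

definition comodule_Hom_coring ::
  "('k, 'a) module \<Rightarrow> ('a, 'a, 'c) bimodule \<Rightarrow> ('c \<Rightarrow> ('c, 'c) tensor)
     \<Rightarrow> ('k, 'a, 'm) bimodule \<Rightarrow> ('m \<Rightarrow> ('m, 'c) tensor) \<Rightarrow> ('a, 'm \<Rightarrow> 'm, 'm \<Rightarrow> 'c) bimodule"
  where "comodule_Hom_coring A C \<Delta> M \<rho> =
     right_hom_bimodule (right_comodule_hom A C M \<rho> C \<Delta>) (eval_bimodule M) C"

definition galois_comodule ::
  "('k, 'w) ring_scheme \<Rightarrow> ('k, 'a) module \<Rightarrow> ('a, 'a, 'c) bimodule \<Rightarrow> ('c \<Rightarrow> ('c, 'c) tensor) \<Rightarrow> ('c \<Rightarrow> 'a)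
     \<Rightarrow> ('k, 'a, 'm) bimodule \<Rightarrow> ('m \<Rightarrow> ('m, 'c) tensor) \<Rightarrow> bool"
  where "galois_comodule K A C \<Delta> \<epsilon> M \<rho> \<longleftrightarrow>
     right_comodule K A C \<Delta> \<epsilon> M \<rho> \<and> fgp_right_module A M \<and>
     (let B = comodule_End A C M \<rho>; H = comodule_Hom_coring A C \<Delta> M \<rho>; N = eval_bimodule M in
      right_comodule_iso A C (tensor B H N) (tensor_right_coaction A B C H N \<rho>) C \<Delta>
        (tensor_lift B H N C (\<lambda>f m. f m)))"

text \<open>The map \<open>M\<^sup>* \<otimes> M \<rightarrow> C\<close>, \<open>\<xi> \<otimes> m \<mapsto> \<Sum> \<xi>(m\<^sub>[\<^sub>0\<^sub>]) m\<^sub>[\<^sub>1\<^sub>]\<close>, with the tensor product over \<open>K\<close>.\<close>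

definition lifted_can ::
  "('k, 'w) ring_scheme \<Rightarrow> ('k, 'a) module \<Rightarrow> ('a, 'a, 'c) bimodule
     \<Rightarrow> ('k, 'a, 'm) bimodule \<Rightarrow> ('m \<Rightarrow> ('m, 'c) tensor) \<Rightarrow> ('m \<Rightarrow> 'a, 'm) tensor \<Rightarrow> 'c"
  where "lifted_can K A C M \<rho> = tensor_lift K (dual A M) M C (coefficient A C M \<rho>)"

text \<open>\<open>Hom\<^sup>C\<^sup>-(M\<^sup>*, M\<^sup>* \<otimes> M)\<close> with \<open>(b \<cdot> f)(\<xi>) = f(\<xi> \<circ> b)\<close>.\<close>

definition comodule_Hom_dual ::
  "('k, 'w) ring_scheme \<Rightarrow> ('k, 'a) module \<Rightarrow> ('a, 'a, 'c) bimodule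
     \<Rightarrow> ('k, 'a, 'm) bimodule \<Rightarrow> ('m \<Rightarrow> ('m, 'c) tensor)
     \<Rightarrow> ('m \<Rightarrow> 'm, 'a, ('m \<Rightarrow> 'a) \<Rightarrow> ('m \<Rightarrow> 'a, 'm) tensor) bimodule"
  where "comodule_Hom_dual K A C M \<rho> = (let D = dual A M; L = dual_coaction A C M \<rho> in
     left_hom_bimodule
       (left_comodule_hom A C D L (tensor K D M) (tensor_left_coaction A K C D L M))
       (dual A (eval_bimodule M)) (tensor K D M))"

text \<open>The map \<open>B \<otimes> M \<rightarrow> Hom\<^sup>C\<^sup>-(M\<^sup>*, M\<^sup>* \<otimes> M)\<close>, \<open>b \<otimes> m \<mapsto> [\<xi> \<mapsto> \<xi> \<circ> b \<otimes> m]\<close>.\<close>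

definition End_tensor_map ::
  "('k, 'w) ring_scheme \<Rightarrow> ('k, 'a) module \<Rightarrow> ('a, 'a, 'c) bimodule
     \<Rightarrow> ('k, 'a, 'm) bimodule \<Rightarrow> ('m \<Rightarrow> ('m, 'c) tensor)
     \<Rightarrow> ('m \<Rightarrow> 'm, 'm) tensor \<Rightarrow> ('m \<Rightarrow> 'a) \<Rightarrow> ('m \<Rightarrow> 'a, 'm) tensor"
  where "End_tensor_map K A C M \<rho> =
     tensor_lift K (algebra_bimodule (comodule_End A C M \<rho>)) M (comodule_Hom_dual K A C M \<rho>)
       (\<lambda>b m. \<lambda>\<xi>\<in>carrier (dual A M). tens K (dual A M) M (compose (carrier M) \<xi> b) m)"

text \<open>
  \<open>B\<close>-modules are \<open>K\<close>-modules via \<open>c \<mapsto> c \<odot> \<one>\<close>. Stated for all modules \<open>N\<close> with carrier in a given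
  type; a theorem asserting it for \<open>TYPE('n)\<close> with \<open>'n\<close> a type variable asserts it for all of them.
\<close>

definition relatively_projective_left_module ::
  "'n itself \<Rightarrow> ('k, 'w) ring_scheme \<Rightarrow> ('k, 'b) module \<Rightarrow> ('b, 't, 'm) bimodule \<Rightarrow> bool"
  where "relatively_projective_left_module _ K B M \<longleftrightarrow> left_module B M \<and>
     (\<forall>(N :: ('b, 'n) module) p s.
        left_module B N \<and> p \<in> left_hom B N M \<and> p ` carrier N = carrier M \<and>
        s \<in> additive_maps M N \<and>
        (\<forall>c\<in>carrier K. \<forall>m\<in>carrier M.
           s ((c \<odot>\<^bsub>B\<^esub> \<one>\<^bsub>B\<^esub>) \<odot>\<^bsub>M\<^esub> m) = (c \<odot>\<^bsub>B\<^esub> \<one>\<^bsub>B\<^esub>) \<odot>\<^bsub>N\<^esub> s m) \<and>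
        (\<forall>m\<in>carrier M. p (s m) = m) \<longrightarrow>
        (\<exists>t\<in>left_hom B M N. \<forall>m\<in>carrier M. p (t m) = m))"


section \<open>Consistency of the definitions\<close>

lemma abelian_group_minus_eq_zero_iff:
  assumes "abelian_group G" "a \<in> carrier G" "b \<in> carrier G"
  shows "a \<ominus>\<^bsub>G\<^esub> b = \<zero>\<^bsub>G\<^esub> \<longleftrightarrow> a = b"
proof -
  interpret G: abelian_group G by (rule assms)
  have "(a \<ominus>\<^bsub>G\<^esub> b) \<oplus>\<^bsub>G\<^esub> b = a" using assms by (simp add: G.minus_eq G.a_assoc G.l_neg)
  then show ?thesis using assms by (metis G.minus_eq G.r_neg G.l_zero)
qed

lemma additive_mapsD:
  assumes "f \<in> additive_maps X Y"
  shows "f \<in> extensional (carrier X)" "\<And>x. x \<in> carrier X \<Longrightarrow> f x \<in> carrier Y"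
    "\<And>x y. \<lbrakk>x \<in> carrier X; y \<in> carrier X\<rbrakk> \<Longrightarrow> f (x \<oplus>\<^bsub>X\<^esub> y) = f x \<oplus>\<^bsub>Y\<^esub> f y"
  using assms by (auto simp: additive_maps_def PiE_def)

lemma additive_maps_group_hom:
  assumes "abelian_group X" "abelian_group Y" "f \<in> additive_maps X Y"
  shows "group_hom (add_monoid X) (add_monoid Y) f"
  using assms by (auto simp: group_hom_def group_hom_axioms_def hom_def additive_maps_def
      abelian_group.a_group)

lemma additive_maps_zero:
  assumes "abelian_group X" "abelian_group Y" "f \<in> additive_maps X Y"
  shows "f \<zero>\<^bsub>X\<^esub> = \<zero>\<^bsub>Y\<^esub>"
  using group_hom.hom_one[OF additive_maps_group_hom[OF assms]] by simp

lemma additive_maps_diff: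
  assumes "abelian_group X" "abelian_group Y" "f \<in> additive_maps X Y"
    and "x \<in> carrier X" "y \<in> carrier X"
  shows "f (x \<ominus>\<^bsub>X\<^esub> y) = f x \<ominus>\<^bsub>Y\<^esub> f y"
  using assms group_hom.hom_inv[OF additive_maps_group_hom[OF assms(1-3)], of y]
  by (simp add: a_minus_def a_inv_def additive_mapsD(3)[OF assms(3)]
      abelian_group.a_inv_closed[unfolded a_inv_def])

context
  fixes S :: "('s, 'w) ring_scheme" and X :: "('r, 's, 'x) bimodule" and Y :: "('s, 't, 'y) bimodule"
  assumes X: "right_module S X" and Y: "left_module S Y"
begin

interpretation X: right_module S X by (rule X)
interpretation Y: left_module S Y by (rule Y)
interpretation F: comm_group "tensor_pairs X Y"
  by (simp add: tensor_pairs_def abelian_free_Abelian_group)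

lemma tensor_pairs_closed:
  "\<lbrakk>p \<in> carrier (tensor_pairs X Y); q \<in> carrier (tensor_pairs X Y)\<rbrakk> \<Longrightarrow> p + q \<in> carrier (tensor_pairs X Y)"
  "\<lbrakk>p \<in> carrier (tensor_pairs X Y); q \<in> carrier (tensor_pairs X Y)\<rbrakk> \<Longrightarrow> p - q \<in> carrier (tensor_pairs X Y)"
  "frag_of (x, y) \<in> carrier (tensor_pairs X Y) \<longleftrightarrow> x \<in> carrier X \<and> y \<in> carrier Y"
  using keys_diff[of p q] keys_add[of p q]
  unfolding tensor_pairs_def carrier_free_Abelian_group_iff by (blast, blast, simp)

lemma tensor_relators_carrier: "tensor_relators S X Y \<subseteq> carrier (tensor_pairs X Y)"
  unfolding tensor_relators_def
  by (intro subsetI, elim UnE CollectE exE conjE)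
    (simp_all only: tensor_pairs_closed X.ract_closed Y.lact_closed X.a_closed Y.a_closed)

lemma tensor_kernel_subgroup: "subgroup (tensor_kernel S X Y) (tensor_pairs X Y)"
  unfolding tensor_kernel_def by (rule F.generate_is_subgroup[OF tensor_relators_carrier])

interpretation N: normal "tensor_kernel S X Y" "tensor_pairs X Y"
  using F.subgroup_imp_normal[OF tensor_kernel_subgroup] .

lemma tensor_group_abelian: "abelian_group (tensor_group S X Y)"
proof -
  have "comm_group (tensor_pairs X Y Mod tensor_kernel S X Y)"
    by (rule F.abelian_FactGroup[OF tensor_kernel_subgroup])
  then interpret Q: comm_group "tensor_pairs X Y Mod tensor_kernel S X Y" .
  have "add_monoid (tensor_group S X Y) = tensor_pairs X Y Mod tensor_kernel S X Y"
    by (simp add: tensor_group_def Let_def)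
  then show ?thesis
    by (metis Q.comm_group_axioms abelian_group_def abelian_group_axioms_def abelian_monoid_def
        comm_group_def)
qed

interpretation T: abelian_group "tensor_group S X Y" by (rule tensor_group_abelian)

lemma carrier_tensor_group:
  "carrier (tensor_group S X Y) = tensor_class S X Y ` carrier (tensor_pairs X Y)"
  by (auto simp: tensor_group_def Let_def FactGroup_def RCOSETS_def tensor_class_def)

lemma tensor_class_add:
  "\<lbrakk>p \<in> carrier (tensor_pairs X Y); q \<in> carrier (tensor_pairs X Y)\<rbrakk> \<Longrightarrow>
    tensor_class S X Y (p + q) = tensor_class S X Y p \<oplus>\<^bsub>tensor_group S X Y\<^esub> tensor_class S X Y q"
  using N.rcos_sum by (simp add: tensor_group_def Let_def FactGroup_def tensor_class_def)
   (simp add: tensor_pairs_def)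

lemma tensor_class_hom:
  "group_hom (tensor_pairs X Y) (add_monoid (tensor_group S X Y)) (tensor_class S X Y)"
proof -
  have "tensor_class S X Y \<in> hom (tensor_pairs X Y) (add_monoid (tensor_group S X Y))"
    by (rule homI) (auto simp: carrier_tensor_group tensor_class_add[symmetric] tensor_pairs_def)
  then show ?thesis
    using T.a_group F.is_group by (simp only: group_hom_def group_hom_axioms_def)
qed

interpretation cls: group_hom "tensor_pairs X Y" "add_monoid (tensor_group S X Y)" "tensor_class S X Y"
  by (rule tensor_class_hom)

lemma tensor_class_diff:
  assumes "p \<in> carrier (tensor_pairs X Y)" "q \<in> carrier (tensor_pairs X Y)"
  shows "tensor_class S X Y (p - q)
     = tensor_class S X Y p \<ominus>\<^bsub>tensor_group S X Y\<^esub> tensor_class S X Y q"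
proof -
  have inv: "inv\<^bsub>tensor_pairs X Y\<^esub> q = - q" and "- q \<in> carrier (tensor_pairs X Y)"
    using assms by (auto simp: tensor_pairs_def)
  moreover have "tensor_class S X Y (p - q) = tensor_class S X Y (p + (- q))" by simp
  ultimately show ?thesis
    using tensor_class_add[of p "-q"] cls.hom_inv[of q] assms
    by (simp add: a_minus_def a_inv_def)
qed

lemma tensor_class_eq_zero_iff:
  assumes "p \<in> carrier (tensor_pairs X Y)"
  shows "tensor_class S X Y p = \<zero>\<^bsub>tensor_group S X Y\<^esub> \<longleftrightarrow> p \<in> tensor_kernel S X Y"
proof -
  have "\<zero>\<^bsub>tensor_group S X Y\<^esub> = tensor_kernel S X Y"
    by (simp add: tensor_group_def Let_def FactGroup_def)
  moreover have "tensor_kernel S X Y #>\<^bsub>tensor_pairs X Y\<^esub> p = tensor_kernel S X Y \<longleftrightarrow> p \<in> tensor_kernel S X Y"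
    using F.rcos_self[OF assms tensor_kernel_subgroup] F.coset_join2[OF assms tensor_kernel_subgroup]
    by metis
  ultimately show ?thesis by (simp only: tensor_class_def)
qed

lemma tensor_class_closed:
  "p \<in> carrier (tensor_pairs X Y) \<Longrightarrow> tensor_class S X Y p \<in> carrier (tensor_group S X Y)"
  by (simp add: carrier_tensor_group)

lemma tens_closed:
  "\<lbrakk>x \<in> carrier X; y \<in> carrier Y\<rbrakk> \<Longrightarrow> tens S X Y x y \<in> carrier (tensor_group S X Y)"
  by (simp add: tens_def tensor_class_closed tensor_pairs_closed)

lemma tensor_class_eqI:
  assumes "p - q \<in> tensor_kernel S X Y" "p \<in> carrier (tensor_pairs X Y)" "q \<in> carrier (tensor_pairs X Y)"
  shows "tensor_class S X Y p = tensor_class S X Y q"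
  using assms tensor_class_eq_zero_iff[of "p - q"]
  by (simp add: tensor_pairs_closed tensor_class_diff tensor_class_closed
      abelian_group_minus_eq_zero_iff[OF T.abelian_group_axioms])

lemma tens_add_left:
  assumes "x \<in> carrier X" "x' \<in> carrier X" "y \<in> carrier Y"
  shows "tens S X Y (x \<oplus>\<^bsub>X\<^esub> x') y = tens S X Y x y \<oplus>\<^bsub>tensor_group S X Y\<^esub> tens S X Y x' y"
proof -
  have "frag_of (x \<oplus>\<^bsub>X\<^esub> x', y) - frag_of (x, y) - frag_of (x', y) \<in> tensor_relators S X Y"
    using assms unfolding tensor_relators_def by blast
  then have "tensor_class S X Y (frag_of (x \<oplus>\<^bsub>X\<^esub> x', y))
      = tensor_class S X Y (frag_of (x, y) + frag_of (x', y))"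
    using assms by (intro tensor_class_eqI)
      (simp_all add: tensor_pairs_closed tensor_kernel_def generate.incl diff_diff_eq)
  then show ?thesis
    using assms by (simp add: tens_def tensor_pairs_closed tensor_class_add)
qed

lemma tens_add_right:
  assumes "x \<in> carrier X" "y \<in> carrier Y" "y' \<in> carrier Y"
  shows "tens S X Y x (y \<oplus>\<^bsub>Y\<^esub> y') = tens S X Y x y \<oplus>\<^bsub>tensor_group S X Y\<^esub> tens S X Y x y'"
proof -
  have "frag_of (x, y \<oplus>\<^bsub>Y\<^esub> y') - frag_of (x, y) - frag_of (x, y') \<in> tensor_relators S X Y"
    using assms unfolding tensor_relators_def by blast
  then have "tensor_class S X Y (frag_of (x, y \<oplus>\<^bsub>Y\<^esub> y'))
      = tensor_class S X Y (frag_of (x, y) + frag_of (x, y'))"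
    using assms by (intro tensor_class_eqI)
      (simp_all add: tensor_pairs_closed tensor_kernel_def generate.incl diff_diff_eq)
  then show ?thesis
    using assms by (simp add: tens_def tensor_pairs_closed tensor_class_add)
qed

lemma tens_balanced:
  assumes "x \<in> carrier X" "s \<in> carrier S" "y \<in> carrier Y"
  shows "tens S X Y (x \<triangleleft>\<^bsub>X\<^esub> s) y = tens S X Y x (s \<odot>\<^bsub>Y\<^esub> y)"
proof -
  have "frag_of (x \<triangleleft>\<^bsub>X\<^esub> s, y) - frag_of (x, s \<odot>\<^bsub>Y\<^esub> y) \<in> tensor_relators S X Y"
    using assms unfolding tensor_relators_def by blast
  then show ?thesis
    using assms unfolding tens_def by (intro tensor_class_eqI)
      (simp_all add: tensor_pairs_closed tensor_kernel_def generate.incl X.ract_closed Y.lact_closed)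
qed

lemma tensor_induct [consumes 1, case_names zero tens diff]:
  assumes "u \<in> carrier (tensor_group S X Y)"
    and "P \<zero>\<^bsub>tensor_group S X Y\<^esub>"
    and "\<And>x y. \<lbrakk>x \<in> carrier X; y \<in> carrier Y\<rbrakk> \<Longrightarrow> P (tens S X Y x y)"
    and "\<And>u v. \<lbrakk>u \<in> carrier (tensor_group S X Y); v \<in> carrier (tensor_group S X Y); P u; P v\<rbrakk> \<Longrightarrow>
           P (u \<ominus>\<^bsub>tensor_group S X Y\<^esub> v)"
  shows "P u"
proof -
  obtain p where p: "Poly_Mapping.keys p \<subseteq> carrier X \<times> carrier Y" "u = tensor_class S X Y p"
    using assms(1) by (auto simp: carrier_tensor_group tensor_pairs_def)
  have "Poly_Mapping.keys p \<subseteq> carrier X \<times> carrier Y \<and> P (tensor_class S X Y p)"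
    using p(1)
  proof (induction p rule: frag_induction)
    case zero
    then show ?case using assms(2) cls.hom_one by (simp add: tensor_pairs_def)
  next
    case (one z)
    then show ?case using assms(3) by (cases z) (auto simp: tens_def)
  next
    case (diff a b)
    then have "a \<in> carrier (tensor_pairs X Y)" "b \<in> carrier (tensor_pairs X Y)"
      by (auto simp: tensor_pairs_def)
    then show ?case
      using diff assms(4)[of "tensor_class S X Y a" "tensor_class S X Y b"] keys_diff[of a b]
      by (auto simp: tensor_class_diff carrier_tensor_group)
  qed
  then show ?thesis using p by simp
qed

theorem tensor_universal:
  fixes Z :: "('z, 'q) ring_scheme"
  assumes Z: "abelian_group Z"
    and closed: "\<And>x y. \<lbrakk>x \<in> carrier X; y \<in> carrier Y\<rbrakk> \<Longrightarrow> f x y \<in> carrier Z"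
    and add_left: "\<And>x x' y. \<lbrakk>x \<in> carrier X; x' \<in> carrier X; y \<in> carrier Y\<rbrakk> \<Longrightarrow>
      f (x \<oplus>\<^bsub>X\<^esub> x') y = f x y \<oplus>\<^bsub>Z\<^esub> f x' y"
    and add_right: "\<And>x y y'. \<lbrakk>x \<in> carrier X; y \<in> carrier Y; y' \<in> carrier Y\<rbrakk> \<Longrightarrow>
      f x (y \<oplus>\<^bsub>Y\<^esub> y') = f x y \<oplus>\<^bsub>Z\<^esub> f x y'"
    and balanced: "\<And>x s y. \<lbrakk>x \<in> carrier X; s \<in> carrier S; y \<in> carrier Y\<rbrakk> \<Longrightarrow>
      f (x \<triangleleft>\<^bsub>X\<^esub> s) y = f x (s \<odot>\<^bsub>Y\<^esub> y)"
  shows "\<exists>!h. h \<in> additive_maps (tensor_group S X Y) Z \<and>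
     (\<forall>x\<in>carrier X. \<forall>y\<in>carrier Y. h (tens S X Y x y) = f x y)"
proof -
  interpret Z: abelian_group Z by (rule Z)
  obtain h0 where h0: "h0 \<in> hom (tensor_pairs X Y) (add_monoid Z)"
    and h0_of: "\<And>z. z \<in> carrier X \<times> carrier Y \<Longrightarrow> h0 (frag_of z) = case_prod f z"
    using Z.a_comm_group comm_group.free_Abelian_group_universal[of "add_monoid Z" "case_prod f" "carrier X \<times> carrier Y"]
      closed by (auto simp: tensor_pairs_def image_subset_iff)
  interpret h0: group_hom "tensor_pairs X Y" "add_monoid Z" h0
    using h0 Z.a_group F.is_group by (simp only: group_hom_def group_hom_axioms_def)
  have h0_add: "h0 (p + q) = h0 p \<oplus>\<^bsub>Z\<^esub> h0 q"
    if "p \<in> carrier (tensor_pairs X Y)" "q \<in> carrier (tensor_pairs X Y)" for p q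
    using h0.hom_mult[OF that] by (simp add: tensor_pairs_def)
  have h0_diff: "h0 (p - q) = h0 p \<ominus>\<^bsub>Z\<^esub> h0 q"
    if "p \<in> carrier (tensor_pairs X Y)" "q \<in> carrier (tensor_pairs X Y)" for p q
  proof -
    have "inv\<^bsub>tensor_pairs X Y\<^esub> q = - q" "- q \<in> carrier (tensor_pairs X Y)"
      using that by (auto simp: tensor_pairs_def)
    moreover have "h0 (p - q) = h0 (p + (- q))" by simp
    ultimately show ?thesis
      using h0_add[of p "-q"] h0.hom_inv[of q] that by (simp add: a_minus_def a_inv_def)
  qed
  have cancel: "(a \<oplus>\<^bsub>Z\<^esub> b) \<ominus>\<^bsub>Z\<^esub> a \<ominus>\<^bsub>Z\<^esub> b = \<zero>\<^bsub>Z\<^esub>" if "a \<in> carrier Z" "b \<in> carrier Z" for a b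
  proof -
    have "(a \<oplus>\<^bsub>Z\<^esub> b) \<ominus>\<^bsub>Z\<^esub> a = b"
      using that by (metis Z.minus_eq Z.a_comm Z.a_assoc Z.a_inv_closed Z.r_neg Z.r_zero)
    then show ?thesis using that by (simp add: abelian_group_minus_eq_zero_iff[OF Z])
  qed
  have "tensor_relators S X Y \<subseteq> kernel (tensor_pairs X Y) (add_monoid Z) h0"
  proof
    fix p assume p: "p \<in> tensor_relators S X Y"
    then have "h0 p = \<zero>\<^bsub>Z\<^esub>"
      unfolding tensor_relators_def
      by (elim UnE CollectE exE conjE)
        (simp_all add: h0_diff tensor_pairs_closed(2) tensor_pairs_closed(3) h0_of add_left add_right balanced closed
          cancel abelian_group_minus_eq_zero_iff[OF Z] X.ract_closed Y.lact_closed)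
    then show "p \<in> kernel (tensor_pairs X Y) (add_monoid Z) h0"
      using p tensor_relators_carrier by (auto simp: kernel_def)
  qed
  then have ker: "tensor_kernel S X Y \<subseteq> kernel (tensor_pairs X Y) (add_monoid Z) h0"
    unfolding tensor_kernel_def by (rule F.generate_subgroup_incl) (rule h0.subgroup_kernel)
  define h where "h = (\<lambda>u\<in>carrier (tensor_group S X Y). h0 (SOME p. p \<in> carrier (tensor_pairs X Y) \<and> u = tensor_class S X Y p))"
  have h_cls: "h (tensor_class S X Y p) = h0 p" if p: "p \<in> carrier (tensor_pairs X Y)" for p
  proof -
    define q where "q = (SOME q. q \<in> carrier (tensor_pairs X Y) \<and> tensor_class S X Y p = tensor_class S X Y q)"
    have q: "q \<in> carrier (tensor_pairs X Y) \<and> tensor_class S X Y p = tensor_class S X Y q"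
      unfolding q_def by (rule someI[where x = p]) (simp add: p)
    then have "tensor_class S X Y (q - p) = \<zero>\<^bsub>tensor_group S X Y\<^esub>"
      using p by (simp add: tensor_class_diff tensor_class_closed
          abelian_group_minus_eq_zero_iff[OF T.abelian_group_axioms])
    then have "q - p \<in> tensor_kernel S X Y"
      using tensor_class_eq_zero_iff[of "q - p"] tensor_pairs_closed(2)[of q p] p q by simp
    then have "h0 (q - p) = \<zero>\<^bsub>Z\<^esub>" using ker unfolding kernel_def by auto
    then have "h0 q = h0 p" using p q h0.hom_closed[of p] h0.hom_closed[of q] by (simp add: h0_diff abelian_group_minus_eq_zero_iff[OF Z])
    moreover have "h (tensor_class S X Y p) = h0 q"
      using p by (simp add: h_def carrier_tensor_group q_def)
    ultimately show ?thesis by simp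
  qed
  have h: "h \<in> additive_maps (tensor_group S X Y) Z"
    unfolding additive_maps_def
  proof (intro CollectI conjI ballI)
    show "h \<in> carrier (tensor_group S X Y) \<rightarrow>\<^sub>E carrier Z"
    proof (intro PiE_I)
      fix u assume "u \<in> carrier (tensor_group S X Y)"
      then show "h u \<in> carrier Z" using h0.hom_closed h_cls by (auto simp: carrier_tensor_group)
    qed (simp add: h_def)
    fix u v assume "u \<in> carrier (tensor_group S X Y)" "v \<in> carrier (tensor_group S X Y)"
    then obtain p q where "p \<in> carrier (tensor_pairs X Y)" "u = tensor_class S X Y p"
      "q \<in> carrier (tensor_pairs X Y)" "v = tensor_class S X Y q"
      unfolding carrier_tensor_group by blast
    then show "h (u \<oplus>\<^bsub>tensor_group S X Y\<^esub> v) = h u \<oplus>\<^bsub>Z\<^esub> h v"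
      by (simp add: tensor_class_add[symmetric] h_cls tensor_pairs_closed(1) h0_add)
  qed
  have h_tens: "h (tens S X Y x y) = f x y" if "x \<in> carrier X" "y \<in> carrier Y" for x y
    using that by (simp add: tens_def h_cls tensor_pairs_closed(3) h0_of)
  show ?thesis
  proof (intro ex1I conjI ballI)
    fix g assume g: "g \<in> additive_maps (tensor_group S X Y) Z \<and>
       (\<forall>x\<in>carrier X. \<forall>y\<in>carrier Y. g (tens S X Y x y) = f x y)"
    show "g = h"
    proof (rule extensionalityI)
      show "g \<in> extensional (carrier (tensor_group S X Y))" "h \<in> extensional (carrier (tensor_group S X Y))"
        using g h additive_mapsD by blast+
      fix u assume "u \<in> carrier (tensor_group S X Y)"
      then show "g u = h u"
      proof (induction u rule: tensor_induct)
        case zero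
        then show ?case using g h additive_maps_zero[OF T.abelian_group_axioms Z] by metis
      next
        case (tens x y)
        then show ?case using g h_tens by simp
      next
        case (diff u v)
        then show ?case using g h additive_maps_diff[OF T.abelian_group_axioms Z] by metis
      qed
    qed
  qed (use h h_tens in auto)
qed

end

lemma tensor_lift:
  fixes X :: "('r, 's, 'x) bimodule" and Y :: "('s, 't, 'y) bimodule" and Z :: "('z, 'q) ring_scheme"
  assumes "right_module S X" "left_module S Y" "abelian_group Z"
    and "\<And>x y. \<lbrakk>x \<in> carrier X; y \<in> carrier Y\<rbrakk> \<Longrightarrow> f x y \<in> carrier Z"
    and "\<And>x x' y. \<lbrakk>x \<in> carrier X; x' \<in> carrier X; y \<in> carrier Y\<rbrakk> \<Longrightarrow>
      f (x \<oplus>\<^bsub>X\<^esub> x') y = f x y \<oplus>\<^bsub>Z\<^esub> f x' y"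
    and "\<And>x y y'. \<lbrakk>x \<in> carrier X; y \<in> carrier Y; y' \<in> carrier Y\<rbrakk> \<Longrightarrow>
      f x (y \<oplus>\<^bsub>Y\<^esub> y') = f x y \<oplus>\<^bsub>Z\<^esub> f x y'"
    and "\<And>x s y. \<lbrakk>x \<in> carrier X; s \<in> carrier S; y \<in> carrier Y\<rbrakk> \<Longrightarrow>
      f (x \<triangleleft>\<^bsub>X\<^esub> s) y = f x (s \<odot>\<^bsub>Y\<^esub> y)"
  shows "tensor_lift S X Y Z f \<in> additive_maps (tensor_group S X Y) Z"
    and "\<lbrakk>x \<in> carrier X; y \<in> carrier Y\<rbrakk> \<Longrightarrow> tensor_lift S X Y Z f (tens S X Y x y) = f x y"
  using theI'[OF tensor_universal[of S X Y Z f, OF assms]] unfolding tensor_lift_def by blast+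

lemma right_homD:
  assumes "f \<in> right_hom S X Y"
  shows "f \<in> additive_maps X Y" "\<And>x. x \<in> carrier X \<Longrightarrow> f x \<in> carrier Y"
    "\<And>x y. \<lbrakk>x \<in> carrier X; y \<in> carrier X\<rbrakk> \<Longrightarrow> f (x \<oplus>\<^bsub>X\<^esub> y) = f x \<oplus>\<^bsub>Y\<^esub> f y"
    "\<And>x s. \<lbrakk>x \<in> carrier X; s \<in> carrier S\<rbrakk> \<Longrightarrow> f (x \<triangleleft>\<^bsub>X\<^esub> s) = f x \<triangleleft>\<^bsub>Y\<^esub> s"
  using assms additive_mapsD[of f X Y] by (auto simp: right_hom_def)

lemma right_homI:
  assumes "\<And>x. x \<in> carrier X \<Longrightarrow> f x \<in> carrier Y"
    "\<And>x y. \<lbrakk>x \<in> carrier X; y \<in> carrier X\<rbrakk> \<Longrightarrow> x \<oplus>\<^bsub>X\<^esub> y \<in> carrier X \<and> f (x \<oplus>\<^bsub>X\<^esub> y) = f x \<oplus>\<^bsub>Y\<^esub> f y"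
    "\<And>x s. \<lbrakk>x \<in> carrier X; s \<in> carrier S\<rbrakk> \<Longrightarrow> x \<triangleleft>\<^bsub>X\<^esub> s \<in> carrier X \<and> f (x \<triangleleft>\<^bsub>X\<^esub> s) = f x \<triangleleft>\<^bsub>Y\<^esub> s"
  shows "(\<lambda>x\<in>carrier X. f x) \<in> right_hom S X Y"
  using assms by (auto simp: right_hom_def additive_maps_def)

lemma right_hom_comp:
  assumes "right_module S X" "f \<in> right_hom S X Y" "g \<in> right_hom S Y Z"
  shows "(\<lambda>x\<in>carrier X. g (f x)) \<in> right_hom S X Z"
proof -
  interpret X: right_module S X by (rule assms)
  show ?thesis
    by (rule right_homI) (simp_all add: right_homD[OF assms(2)] right_homD[OF assms(3)] X.ract_closed)
qed

lemma additive_maps_finsum: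
  assumes "abelian_group X" "abelian_group Y" "f \<in> additive_maps X Y"
    and "finite I" "x \<in> I \<rightarrow> carrier X"
  shows "f (\<Oplus>\<^bsub>X\<^esub>i\<in>I. x i) = (\<Oplus>\<^bsub>Y\<^esub>i\<in>I. f (x i))"
proof -
  interpret X: abelian_group X by (rule assms)
  interpret Y: abelian_group Y by (rule assms)
  show ?thesis using assms(4,5)
  proof (induction I rule: finite_induct)
    case empty
    then show ?case using additive_maps_zero[OF assms(1-3)] by simp
  next
    case (insert i I)
    then have "f (\<Oplus>\<^bsub>X\<^esub>i\<in>insert i I. x i) = f (x i) \<oplus>\<^bsub>Y\<^esub> f (\<Oplus>\<^bsub>X\<^esub>i\<in>I. x i)"
      using additive_mapsD[OF assms(3)] X.finsum_closed by (simp add: Pi_iff)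
    then show ?case using insert additive_mapsD(2)[OF assms(3)] by (simp add: Pi_iff)
  qed
qed

lemma (in right_module) ract_additive:
  "s \<in> carrier S \<Longrightarrow> (\<lambda>x\<in>carrier X. x \<triangleleft>\<^bsub>X\<^esub> s) \<in> additive_maps X X"
  by (auto simp: additive_maps_def ract_closed ract_add_left)

lemma (in right_module) finsum_ract:
  assumes "finite I" "x \<in> I \<rightarrow> carrier X" "s \<in> carrier S"
  shows "(\<Oplus>\<^bsub>X\<^esub>i\<in>I. x i) \<triangleleft>\<^bsub>X\<^esub> s = (\<Oplus>\<^bsub>X\<^esub>i\<in>I. x i \<triangleleft>\<^bsub>X\<^esub> s)"
proof -
  have ag: "abelian_group X" by unfold_locales
  have "(\<Oplus>\<^bsub>X\<^esub>i\<in>I. (\<lambda>x\<in>carrier X. x \<triangleleft>\<^bsub>X\<^esub> s) (x i)) = (\<Oplus>\<^bsub>X\<^esub>i\<in>I. x i \<triangleleft>\<^bsub>X\<^esub> s)"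
    using assms by (intro X.finsum_cong') (auto simp: ract_closed Pi_iff)
  then show ?thesis
    using additive_maps_finsum[OF ag ag ract_additive[OF assms(3)] assms(1,2)] assms
    by (simp add: X.finsum_closed)
qed

lemma (in right_module) ract_zero: "x \<in> carrier X \<Longrightarrow> x \<triangleleft>\<^bsub>X\<^esub> \<zero> = \<zero>\<^bsub>X\<^esub>"
  using ract_add_right[of x \<zero> \<zero>] ract_closed[of x \<zero>]
  by (metis S.zero_closed S.r_zero X.add.r_cancel_one')

definition free_right_module :: "('a, 'w) ring_scheme \<Rightarrow> nat \<Rightarrow> (unit, 'a, nat \<Rightarrow> 'a) bimodule" where
  "free_right_module A n = \<lparr>carrier = {..<n} \<rightarrow>\<^sub>E carrier A, mult = undefined, one = undefined,
     zero = (\<lambda>i\<in>{..<n}. \<zero>\<^bsub>A\<^esub>), add = (\<lambda>a b. \<lambda>i\<in>{..<n}. a i \<oplus>\<^bsub>A\<^esub> b i),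
     smult = (\<lambda>_ a. a), rsmult = (\<lambda>a s. \<lambda>i\<in>{..<n}. a i \<otimes>\<^bsub>A\<^esub> s)\<rparr>"

lemma right_module_free:
  assumes "ring A"
  shows "right_module A (free_right_module A n)"
proof -
  interpret A: ring A by (rule assms)
  have "abelian_group (free_right_module A n)"
  proof (rule abelian_groupI)
    fix a assume a: "a \<in> carrier (free_right_module A n)"
    show "\<exists>b\<in>carrier (free_right_module A n). b \<oplus>\<^bsub>free_right_module A n\<^esub> a = \<zero>\<^bsub>free_right_module A n\<^esub>"
      using a by (intro bexI[where x = "\<lambda>i\<in>{..<n}. \<ominus>\<^bsub>A\<^esub> a i"])
        (auto simp: free_right_module_def PiE_iff A.l_neg)
  qed (auto simp: free_right_module_def PiE_iff A.a_assoc intro!: ext A.a_comm split: if_splits,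
       auto simp: restrict_def extensional_def A.a_comm)
  then interpret F: abelian_group "free_right_module A n" .
  show ?thesis
    by unfold_locales
      (auto simp: free_right_module_def PiE_iff A.l_distr A.r_distr A.m_assoc extensional_def intro!: ext)
qed

lemma lincomb_hom:
  assumes "right_module A M" "\<And>i. i < n \<Longrightarrow> e i \<in> carrier M"
  shows "(\<lambda>a\<in>carrier (free_right_module A n). \<Oplus>\<^bsub>M\<^esub>i\<in>{..<n}. e i \<triangleleft>\<^bsub>M\<^esub> a i)
     \<in> right_hom A (free_right_module A n) M"
proof -
  interpret M: right_module A M by (rule assms)
  interpret F: right_module A "free_right_module A n"
    by (rule right_module_free) unfold_locales
  have cl: "e i \<triangleleft>\<^bsub>M\<^esub> a i \<in> carrier M" if "a \<in> carrier (free_right_module A n)" "i < n" for a i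
    using that assms(2) by (auto simp: free_right_module_def intro!: M.ract_closed)
  show ?thesis
  proof (rule right_homI)
    fix a assume a: "a \<in> carrier (free_right_module A n)"
    then show "(\<Oplus>\<^bsub>M\<^esub>i\<in>{..<n}. e i \<triangleleft>\<^bsub>M\<^esub> a i) \<in> carrier M"
      by (intro M.X.finsum_closed) (auto simp: cl)
    show "a \<triangleleft>\<^bsub>free_right_module A n\<^esub> s \<in> carrier (free_right_module A n) \<and>
       (\<Oplus>\<^bsub>M\<^esub>i\<in>{..<n}. e i \<triangleleft>\<^bsub>M\<^esub> (a \<triangleleft>\<^bsub>free_right_module A n\<^esub> s) i) = (\<Oplus>\<^bsub>M\<^esub>i\<in>{..<n}. e i \<triangleleft>\<^bsub>M\<^esub> a i) \<triangleleft>\<^bsub>M\<^esub> s"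
      if s: "s \<in> carrier A" for s
    proof
      show "a \<triangleleft>\<^bsub>free_right_module A n\<^esub> s \<in> carrier (free_right_module A n)"
        using a s by (rule F.ract_closed)
      have "(\<Oplus>\<^bsub>M\<^esub>i\<in>{..<n}. e i \<triangleleft>\<^bsub>M\<^esub> a i) \<triangleleft>\<^bsub>M\<^esub> s = (\<Oplus>\<^bsub>M\<^esub>i\<in>{..<n}. e i \<triangleleft>\<^bsub>M\<^esub> a i \<triangleleft>\<^bsub>M\<^esub> s)"
        using a s by (intro M.finsum_ract) (auto simp: cl)
      also have "\<dots> = (\<Oplus>\<^bsub>M\<^esub>i\<in>{..<n}. e i \<triangleleft>\<^bsub>M\<^esub> (a \<triangleleft>\<^bsub>free_right_module A n\<^esub> s) i)"
        using a s assms(2) by (intro M.X.finsum_cong')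
          (auto simp: free_right_module_def M.ract_closed M.ract_mult PiE_iff)
      finally show "(\<Oplus>\<^bsub>M\<^esub>i\<in>{..<n}. e i \<triangleleft>\<^bsub>M\<^esub> (a \<triangleleft>\<^bsub>free_right_module A n\<^esub> s) i)
        = (\<Oplus>\<^bsub>M\<^esub>i\<in>{..<n}. e i \<triangleleft>\<^bsub>M\<^esub> a i) \<triangleleft>\<^bsub>M\<^esub> s" by simp
    qed
    fix b assume b: "b \<in> carrier (free_right_module A n)"
    have "(\<Oplus>\<^bsub>M\<^esub>i\<in>{..<n}. e i \<triangleleft>\<^bsub>M\<^esub> (a \<oplus>\<^bsub>free_right_module A n\<^esub> b) i)
      = (\<Oplus>\<^bsub>M\<^esub>i\<in>{..<n}. e i \<triangleleft>\<^bsub>M\<^esub> a i \<oplus>\<^bsub>M\<^esub> e i \<triangleleft>\<^bsub>M\<^esub> b i)"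
      using a b assms(2) by (intro M.X.finsum_cong')
        (auto simp: free_right_module_def M.ract_closed M.ract_add_right PiE_iff)
    also have "\<dots> = (\<Oplus>\<^bsub>M\<^esub>i\<in>{..<n}. e i \<triangleleft>\<^bsub>M\<^esub> a i) \<oplus>\<^bsub>M\<^esub> (\<Oplus>\<^bsub>M\<^esub>i\<in>{..<n}. e i \<triangleleft>\<^bsub>M\<^esub> b i)"
      using a b by (intro M.X.finsum_addf) (auto simp: cl)
    finally show "a \<oplus>\<^bsub>free_right_module A n\<^esub> b \<in> carrier (free_right_module A n) \<and>
      (\<Oplus>\<^bsub>M\<^esub>i\<in>{..<n}. e i \<triangleleft>\<^bsub>M\<^esub> (a \<oplus>\<^bsub>free_right_module A n\<^esub> b) i)
       = (\<Oplus>\<^bsub>M\<^esub>i\<in>{..<n}. e i \<triangleleft>\<^bsub>M\<^esub> a i) \<oplus>\<^bsub>M\<^esub> (\<Oplus>\<^bsub>M\<^esub>i\<in>{..<n}. e i \<triangleleft>\<^bsub>M\<^esub> b i)"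
      using F.X.a_closed[OF a b] by simp
  qed
qed

definition forget_left :: "('t, 's, 'x) bimodule \<Rightarrow> (unit, 's, 'x) bimodule" where
  "forget_left X = \<lparr>carrier = carrier X, mult = mult X, one = one X, zero = zero X, add = add X,
     smult = (\<lambda>_ x. x), rsmult = rsmult X\<rparr>"

lemma forget_left_simps [simp]:
  "carrier (forget_left X) = carrier X" "zero (forget_left X) = zero X" "add (forget_left X) = add X"
  "rsmult (forget_left X) = rsmult X"
  by (simp_all add: forget_left_def)

lemma right_module_forget_left:
  assumes "right_module S X"
  shows "right_module S (forget_left X)"
proof -
  interpret right_module S X by (rule assms)
  interpret F: abelian_group "forget_left X"
    by (rule abelian_groupI)
      (auto simp: X.a_ac intro: X.l_neg bexI[where x = "\<ominus>\<^bsub>X\<^esub> x" for x])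
  show ?thesis
    by unfold_locales (simp_all add: ract_closed ract_add_left ract_add_right ract_mult ract_one)
qed

lemma right_hom_forget_left:
  "right_hom S (forget_left X) Y = right_hom S X Y" "right_hom S X (forget_left Y) = right_hom S X Y"
  by (simp_all add: right_hom_def additive_maps_def)

lemma fgp_imp_dual_basis:
  fixes M :: "('t, 'a, 'm) bimodule"
  assumes "fgp_right_module A M"
  shows "\<exists>n e x. dual_basis A M n e x"
proof -
  have fg: "finitely_generated_right_module A M"
    and proj: "projective_right_module TYPE(nat \<Rightarrow> 'a) TYPE('m) A M"
    using assms by (simp_all add: fgp_right_module_def)
  have M: "right_module A M" using proj by (simp add: projective_right_module_def)
  interpret M: right_module A M by (rule M)
  obtain E where E: "finite E" "E \<subseteq> carrier M"
    "\<And>m. m \<in> carrier M \<Longrightarrow> \<exists>a\<in>E \<rightarrow> carrier A. m = (\<Oplus>\<^bsub>M\<^esub>e\<in>E. e \<triangleleft>\<^bsub>M\<^esub> a e)"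
    using fg by (auto simp: finitely_generated_right_module_def)
  obtain n and e :: "nat \<Rightarrow> 'm" where e: "bij_betw e {..<n} E"
    using ex_bij_betw_nat_finite[OF E(1)] by (auto simp: atLeast0LessThan)
  have eM: "e i \<in> carrier M" if "i < n" for i using e E that by (auto simp: bij_betw_def)
  define F where "F = free_right_module A n"
  define L where "L = (\<lambda>a\<in>carrier F. \<Oplus>\<^bsub>M\<^esub>i\<in>{..<n}. e i \<triangleleft>\<^bsub>M\<^esub> a i)"
  have L: "L \<in> right_hom A F M" unfolding L_def F_def by (rule lincomb_hom[OF M eM])
  have onto: "L ` carrier F = carrier M"
  proof (intro equalityI subsetI)
    fix m assume "m \<in> carrier M"
    then obtain a where a: "a \<in> E \<rightarrow> carrier A" "m = (\<Oplus>\<^bsub>M\<^esub>e\<in>E. e \<triangleleft>\<^bsub>M\<^esub> a e)" using E(3) by blast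
    have aF: "(\<lambda>i\<in>{..<n}. a (e i)) \<in> carrier F"
      using a e by (auto simp: F_def free_right_module_def bij_betw_def)
    have "m = (\<Oplus>\<^bsub>M\<^esub>e\<in>e ` {..<n}. e \<triangleleft>\<^bsub>M\<^esub> a e)" using a(2) e by (simp add: bij_betw_def)
    also have "\<dots> = (\<Oplus>\<^bsub>M\<^esub>i\<in>{..<n}. e i \<triangleleft>\<^bsub>M\<^esub> a (e i))"
      using e a E by (intro M.X.add.finprod_reindex) (auto simp: bij_betw_def intro!: M.ract_closed)
    also have "\<dots> = (\<Oplus>\<^bsub>M\<^esub>i\<in>{..<n}. e i \<triangleleft>\<^bsub>M\<^esub> (\<lambda>i\<in>{..<n}. a (e i)) i)"
      using e a E eM by (intro M.X.finsum_cong') (auto simp: bij_betw_def intro!: M.ract_closed)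
    also have "\<dots> = L (\<lambda>i\<in>{..<n}. a (e i))" using aF by (simp add: L_def)
    finally show "m \<in> L ` carrier F" using aF by blast
  qed (use right_homD[OF L] in auto)
  have "\<exists>g\<in>right_hom A M F. \<forall>m\<in>carrier M. L (g m) = (\<lambda>m\<in>carrier M. m) m"
  proof -
    have "right_module A F" unfolding F_def by (rule right_module_free) unfold_locales
    moreover have "(\<lambda>m\<in>carrier M. m) \<in> right_hom A M M" by (rule right_homI) (auto simp: M.ract_closed)
    ultimately show ?thesis
      using proj right_module_forget_left[OF M] L onto unfolding projective_right_module_def
      by (metis forget_left_simps(1) right_hom_forget_left(2))
  qed
  then obtain g where g: "g \<in> right_hom A M F" "\<And>m. m \<in> carrier M \<Longrightarrow> L (g m) = m" by auto
  define x where "x i = (\<lambda>m\<in>carrier M. g m i)" for i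
  have "dual_basis A M n e x"
    unfolding dual_basis_def
  proof (intro conjI allI impI ballI)
    fix i assume i: "i < n"
    show "e i \<in> carrier M" by (rule eM[OF i])
    have "x i \<in> right_hom A M (regular A)"
      unfolding x_def using i right_homD[OF g(1)]
      by (intro right_homI) (auto simp: regular_def F_def free_right_module_def M.ract_closed PiE_iff)
    then show "x i \<in> carrier (dual A M)" by (simp add: dual_def right_hom_bimodule_def)
  next
    fix m assume m: "m \<in> carrier M"
    have "m = L (g m)" using g(2)[OF m] by simp
    also have "\<dots> = (\<Oplus>\<^bsub>M\<^esub>i\<in>{..<n}. e i \<triangleleft>\<^bsub>M\<^esub> g m i)" using right_homD[OF g(1)] m by (simp add: L_def)
    also have "\<dots> = (\<Oplus>\<^bsub>M\<^esub>i\<in>{..<n}. e i \<triangleleft>\<^bsub>M\<^esub> x i m)" using m by (simp add: x_def)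
    finally show "m = (\<Oplus>\<^bsub>M\<^esub>i\<in>{..<n}. e i \<triangleleft>\<^bsub>M\<^esub> x i m)" .
  qed
  then show ?thesis by blast
qed

theorem dual_basis_imp_projective:
  fixes M :: "('t, 'a, 'm) bimodule"
  assumes M: "right_module A M" and db: "dual_basis A M n e x"
  shows "projective_right_module TYPE('u) TYPE('v) A M"
  unfolding projective_right_module_def
proof (intro conjI allI impI)
  show "right_module A M" by (rule M)
  fix X :: "(unit, 'a, 'u) bimodule" and Y :: "(unit, 'a, 'v) bimodule" and p f
  assume "right_module A X \<and> right_module A Y \<and> p \<in> right_hom A X Y \<and>
    p ` carrier X = carrier Y \<and> f \<in> right_hom A M Y"
  then have X: "right_module A X" and Y: "right_module A Y" and p: "p \<in> right_hom A X Y"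
    and onto: "p ` carrier X = carrier Y" and f: "f \<in> right_hom A M Y" by blast+
  interpret M: right_module A M by (rule M)
  interpret X: right_module A X by (rule X)
  interpret Y: right_module A Y by (rule Y)
  have e: "e i \<in> carrier M" and x: "x i \<in> right_hom A M (regular A)" if "i < n" for i
    using db that by (auto simp: dual_basis_def dual_def right_hom_bimodule_def)
  have xA: "x i m \<in> carrier A" if "i < n" "m \<in> carrier M" for i m
    using right_homD(2)[OF x[OF that(1)] that(2)] by (simp add: regular_def)
  have "\<exists>z. z \<in> carrier X \<and> p z = f (e i)" if "i < n" for i
    using onto right_homD(2)[OF f e[OF that]] by (metis image_iff)
  then obtain z where z: "\<And>i. i < n \<Longrightarrow> z i \<in> carrier X \<and> p (z i) = f (e i)" by metis
  define F where "F = free_right_module A n"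
  define L where "L = (\<lambda>a\<in>carrier F. \<Oplus>\<^bsub>X\<^esub>i\<in>{..<n}. z i \<triangleleft>\<^bsub>X\<^esub> a i)"
  have L: "L \<in> right_hom A F X" unfolding L_def F_def using z by (intro lincomb_hom[OF X]) auto
  define h where "h = (\<lambda>m\<in>carrier M. \<lambda>i\<in>{..<n}. x i m)"
  have h: "h \<in> right_hom A M F"
    unfolding h_def by (rule right_homI)
      (auto simp: F_def free_right_module_def xA M.ract_closed intro!: ext,
       (auto simp: right_homD(3)[OF x] right_homD(4)[OF x] regular_def))
  have "p (L (h m)) = f m" if m: "m \<in> carrier M" for m
  proof -
    have ab: "abelian_group X" "abelian_group Y" "abelian_group M" by unfold_locales
    have "L (h m) = (\<Oplus>\<^bsub>X\<^esub>i\<in>{..<n}. z i \<triangleleft>\<^bsub>X\<^esub> h m i)"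
      using right_homD(2)[OF h m] by (simp add: L_def)
    also have "\<dots> = (\<Oplus>\<^bsub>X\<^esub>i\<in>{..<n}. z i \<triangleleft>\<^bsub>X\<^esub> x i m)"
      using m z xA by (intro X.X.finsum_cong') (auto simp: h_def intro!: X.ract_closed)
    finally have "p (L (h m)) = (\<Oplus>\<^bsub>Y\<^esub>i\<in>{..<n}. p (z i \<triangleleft>\<^bsub>X\<^esub> x i m))"
      using additive_maps_finsum[OF ab(1,2) right_homD(1)[OF p], of "{..<n}" "\<lambda>i. z i \<triangleleft>\<^bsub>X\<^esub> x i m"]
        z m xA by (auto simp: Pi_iff X.ract_closed)
    also have "\<dots> = (\<Oplus>\<^bsub>Y\<^esub>i\<in>{..<n}. f (e i \<triangleleft>\<^bsub>M\<^esub> x i m))"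
      using m z xA e by (intro Y.X.finsum_cong')
        (auto simp: right_homD(4)[OF p] right_homD(4)[OF f] right_homD(2)[OF f] intro!: Y.ract_closed)
    also have "\<dots> = f (\<Oplus>\<^bsub>M\<^esub>i\<in>{..<n}. e i \<triangleleft>\<^bsub>M\<^esub> x i m)"
      using additive_maps_finsum[OF ab(3,2) right_homD(1)[OF f], of "{..<n}" "\<lambda>i. e i \<triangleleft>\<^bsub>M\<^esub> x i m"]
        e m xA by (auto simp: Pi_iff M.ract_closed)
    also have "\<dots> = f m" using db m by (simp add: dual_basis_def)
    finally show ?thesis .
  qed
  then show "\<exists>g\<in>right_hom A M X. \<forall>m\<in>carrier M. p (g m) = f m"
    by (intro bexI[OF _ right_hom_comp[OF M h L]]) auto
qed

lemma tensor_simps [simp]: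
  "carrier (tensor S X Y) = carrier (tensor_group S X Y)" "zero (tensor S X Y) = zero (tensor_group S X Y)"
  "add (tensor S X Y) = add (tensor_group S X Y)"
  by (simp_all add: tensor_def Let_def)

lemma abelian_group_tensor:
  assumes "right_module S X" "left_module S Y"
  shows "abelian_group (tensor S X Y)"
proof -
  interpret T: abelian_group "tensor_group S X Y" by (rule tensor_group_abelian[OF assms])
  show ?thesis by (rule abelian_groupI) (auto simp: T.a_ac intro: T.l_neg bexI[where x = "\<ominus>\<^bsub>tensor_group S X Y\<^esub> x" for x])
qed

lemma tensor_map_id_right:
  fixes N :: "('r, 'a, 'x) bimodule" and N' :: "('t, 'a, 'y) bimodule" and C :: "('a, 'c1, 'c) bimodule"
  assumes "right_module A N" "right_module A N'" "left_module A C" "f \<in> right_hom A N N'"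
  shows "tensor_map A N C N' C f (\<lambda>c. c) \<in> additive_maps (tensor_group A N C) (tensor_group A N' C)"
    and "\<lbrakk>x \<in> carrier N; c \<in> carrier C\<rbrakk> \<Longrightarrow>
      tensor_map A N C N' C f (\<lambda>c. c) (tens A N C x c) = tens A N' C (f x) c"
proof -
  have "tensor_lift A N C (tensor A N' C) (\<lambda>x c. tens A N' C (f x) c)
      \<in> additive_maps (tensor_group A N C) (tensor A N' C)
    \<and> (\<forall>x\<in>carrier N. \<forall>c\<in>carrier C.
        tensor_lift A N C (tensor A N' C) (\<lambda>x c. tens A N' C (f x) c) (tens A N C x c) = tens A N' C (f x) c)"
    by (intro conjI ballI tensor_lift[OF assms(1,3) abelian_group_tensor[OF assms(2,3)]])
      (simp_all add: right_homD[OF assms(4)] tens_closed[OF assms(2,3)] tens_add_left[OF assms(2,3)]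
        tens_add_right[OF assms(2,3)] tens_balanced[OF assms(2,3)])
  then show "tensor_map A N C N' C f (\<lambda>c. c) \<in> additive_maps (tensor_group A N C) (tensor_group A N' C)"
    "\<lbrakk>x \<in> carrier N; c \<in> carrier C\<rbrakk> \<Longrightarrow>
      tensor_map A N C N' C f (\<lambda>c. c) (tens A N C x c) = tens A N' C (f x) c"
    by (simp_all add: tensor_map_def additive_maps_def)
qed

lemma tensor_additive_eq:
  assumes "right_module S X" "left_module S Y" "abelian_group Z"
    and "f \<in> additive_maps (tensor_group S X Y) Z" "g \<in> additive_maps (tensor_group S X Y) Z"
    and "\<And>x y. \<lbrakk>x \<in> carrier X; y \<in> carrier Y\<rbrakk> \<Longrightarrow> f (tens S X Y x y) = g (tens S X Y x y)"
    and "u \<in> carrier (tensor_group S X Y)"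
  shows "f u = g u"
proof (rule tensor_induct[OF assms(1,2,7)])
  show "f \<zero>\<^bsub>tensor_group S X Y\<^esub> = g \<zero>\<^bsub>tensor_group S X Y\<^esub>"
    using assms(4,5) additive_maps_zero[OF tensor_group_abelian[OF assms(1,2)] assms(3)] by metis
  show "f (u \<ominus>\<^bsub>tensor_group S X Y\<^esub> v) = g (u \<ominus>\<^bsub>tensor_group S X Y\<^esub> v)"
    if "u \<in> carrier (tensor_group S X Y)" "v \<in> carrier (tensor_group S X Y)" "f u = g u" "f v = g v" for u v
    using that assms(4,5) additive_maps_diff[OF tensor_group_abelian[OF assms(1,2)] assms(3)] by metis
qed (rule assms(6))

lemma tensor_map_comp:
  assumes "right_module A N" "right_module A N'" "right_module A N''" "left_module A C"
    and f: "f \<in> right_hom A N N'" and g: "g \<in> right_hom A N' N''"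
    and u: "u \<in> carrier (tensor_group A N C)"
  shows "tensor_map A N' C N'' C g (\<lambda>c. c) (tensor_map A N C N' C f (\<lambda>c. c) u)
    = tensor_map A N C N'' C (\<lambda>x\<in>carrier N. g (f x)) (\<lambda>c. c) u"
proof -
  interpret T: abelian_group "tensor_group A N C" by (rule tensor_group_abelian) fact+
  note F = tensor_map_id_right[OF assms(1,2,4) f] and G = tensor_map_id_right[OF assms(2,3,4) g]
    and H = tensor_map_id_right[OF assms(1,3,4) right_hom_comp[OF assms(1) f g]]
  have "(\<lambda>u\<in>carrier (tensor_group A N C).
      tensor_map A N' C N'' C g (\<lambda>c. c) (tensor_map A N C N' C f (\<lambda>c. c) u)) u
    = tensor_map A N C N'' C (\<lambda>x\<in>carrier N. g (f x)) (\<lambda>c. c) u"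
  proof (rule tensor_additive_eq[OF assms(1,4) tensor_group_abelian[OF assms(3,4)] _ H(1) _ u])
    show "(\<lambda>u\<in>carrier (tensor_group A N C). tensor_map A N' C N'' C g (\<lambda>c. c) (tensor_map A N C N' C f (\<lambda>c. c) u))
      \<in> additive_maps (tensor_group A N C) (tensor_group A N'' C)"
      unfolding additive_maps_def
      by (auto simp: additive_mapsD(3)[OF F(1)] additive_mapsD(2)[OF F(1)]
          additive_mapsD(2,3)[OF G(1)] intro!: additive_mapsD(2)[OF G(1)])
    fix x c assume "x \<in> carrier N" "c \<in> carrier C"
    then show "(\<lambda>u\<in>carrier (tensor_group A N C).
        tensor_map A N' C N'' C g (\<lambda>c. c) (tensor_map A N C N' C f (\<lambda>c. c) u)) (tens A N C x c)
      = tensor_map A N C N'' C (\<lambda>x\<in>carrier N. g (f x)) (\<lambda>c. c) (tens A N C x c)"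
      by (simp add: F G H right_homD[OF f] tens_closed[OF assms(1,4)])
  qed
  then show ?thesis using u by simp
qed

lemma inclusion_hom:
  "right_module S (N\<lparr>carrier := U\<rparr>) \<Longrightarrow> U \<subseteq> carrier N \<Longrightarrow> (\<lambda>x\<in>U. x) \<in> right_hom S (N\<lparr>carrier := U\<rparr>) N"
  using right_homI[of "N\<lparr>carrier := U\<rparr>" "\<lambda>x. x" N S] right_module.ract_closed[of S "N\<lparr>carrier := U\<rparr>"]
    abelian_monoid.a_closed[of "N\<lparr>carrier := U\<rparr>"]
  by (auto simp: right_module_def abelian_group_def)

lemma tensor_map_class:
  fixes N :: "('r, 'a, 'x) bimodule" and N' :: "('t, 'a, 'y) bimodule" and C :: "('a, 'c1, 'c) bimodule"
  assumes N: "right_module A N" and N': "right_module A N'" and C: "left_module A C"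
    and f: "f \<in> right_hom A N N'" and p: "Poly_Mapping.keys p \<subseteq> carrier N \<times> carrier C"
  shows "tensor_map A N C N' C f (\<lambda>c. c) (tensor_class A N C p)
      = tensor_class A N' C (frag_extend (\<lambda>(x, c). frag_of (f x, c)) p)"
    and "Poly_Mapping.keys (frag_extend (\<lambda>(x, c). frag_of (f x, c)) p) \<subseteq> carrier N' \<times> carrier C"
proof -
  let ?e = "frag_extend (\<lambda>(x, c). frag_of (f x, c))"
  note F = tensor_map_id_right[OF N N' C f]
  note TN = tensor_group_abelian[OF N C] and TN' = tensor_group_abelian[OF N' C]
  have z: "tensor_class A N C 0 = \<zero>\<^bsub>tensor_group A N C\<^esub>" "tensor_class A N' C 0 = \<zero>\<^bsub>tensor_group A N' C\<^esub>"
    using group_hom.hom_one[OF tensor_class_hom[OF N C]] group_hom.hom_one[OF tensor_class_hom[OF N' C]]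
    by (simp_all add: tensor_pairs_def)
  have "Poly_Mapping.keys p \<subseteq> carrier N \<times> carrier C \<and> Poly_Mapping.keys (?e p) \<subseteq> carrier N' \<times> carrier C \<and>
     tensor_map A N C N' C f (\<lambda>c. c) (tensor_class A N C p) = tensor_class A N' C (?e p)"
    using p
  proof (induction p rule: frag_induction)
    case zero
    show ?case using additive_maps_zero[OF TN TN' F(1)] by (simp add: z)
  next
    case (one q)
    then obtain x c where "q = (x, c)" "x \<in> carrier N" "c \<in> carrier C" by auto
    then show ?case using F(2)[of x c] right_homD(2)[OF f] by (simp add: tens_def)
  next
    case (diff a b)
    then have a: "a \<in> carrier (tensor_pairs N C)" "?e a \<in> carrier (tensor_pairs N' C)"
      and b: "b \<in> carrier (tensor_pairs N C)" "?e b \<in> carrier (tensor_pairs N' C)"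
      by (simp_all add: tensor_pairs_def)
    have "tensor_map A N C N' C f (\<lambda>c. c) (tensor_class A N C (a - b)) = tensor_class A N' C (?e (a - b))"
      using diff a b
      by (simp add: tensor_class_diff[OF N C] tensor_class_diff[OF N' C] additive_maps_diff[OF TN TN' F(1)]
          tensor_class_closed[OF N C] frag_extend_diff)
    moreover have "a - b \<in> carrier (tensor_pairs N C)" "?e (a - b) \<in> carrier (tensor_pairs N' C)"
      using a b tensor_pairs_closed(2)[OF N C] tensor_pairs_closed(2)[OF N' C] by (simp_all add: frag_extend_diff)
    ultimately show ?case by (simp add: tensor_pairs_def)
  qed
  then show "tensor_map A N C N' C f (\<lambda>c. c) (tensor_class A N C p)
      = tensor_class A N' C (frag_extend (\<lambda>(x, c). frag_of (f x, c)) p)"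
    "Poly_Mapping.keys (frag_extend (\<lambda>(x, c). frag_of (f x, c)) p) \<subseteq> carrier N' \<times> carrier C" by simp_all
qed

lemma tensor_kernel_finite_support:
  fixes N :: "('r, 'a, 'x) bimodule" and C :: "('a, 'c1, 'c) bimodule"
  assumes N: "right_module A N" and C: "left_module A C" and "p \<in> tensor_kernel A N C"
  shows "\<exists>E. finite E \<and> E \<subseteq> carrier N \<and> (\<forall>U. E \<subseteq> U \<and> U \<subseteq> carrier N \<and> right_module A (N\<lparr>carrier := U\<rparr>) \<longrightarrow>
     p \<in> tensor_kernel A (N\<lparr>carrier := U\<rparr>) C)"
proof -
  let ?P = "\<lambda>E p. finite E \<and> E \<subseteq> carrier N \<and> (\<forall>U. E \<subseteq> U \<and> U \<subseteq> carrier N \<and> right_module A (N\<lparr>carrier := U\<rparr>) \<longrightarrow>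
     p \<in> tensor_kernel A (N\<lparr>carrier := U\<rparr>) C)"
  have rel: "\<exists>E. finite E \<and> E \<subseteq> carrier N \<and> (\<forall>U. E \<subseteq> U \<longrightarrow> p \<in> tensor_relators A (N\<lparr>carrier := U\<rparr>) C)"
    if "p \<in> tensor_relators A N C" for p
  proof -
    from that consider
      (1) x x' y where "p = frag_of (x \<oplus>\<^bsub>N\<^esub> x', y) - frag_of (x, y) - frag_of (x', y)"
        "x \<in> carrier N" "x' \<in> carrier N" "y \<in> carrier C"
    | (2) x y y' where "p = frag_of (x, y \<oplus>\<^bsub>C\<^esub> y') - frag_of (x, y) - frag_of (x, y')"
        "x \<in> carrier N" "y \<in> carrier C" "y' \<in> carrier C"
    | (3) x s y where "p = frag_of (x \<triangleleft>\<^bsub>N\<^esub> s, y) - frag_of (x, s \<odot>\<^bsub>C\<^esub> y)"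
        "x \<in> carrier N" "s \<in> carrier A" "y \<in> carrier C"
      unfolding tensor_relators_def by blast
    then show ?thesis
    proof cases
      case 1
      then show ?thesis by (intro exI[of _ "{x, x'}"]) (simp add: tensor_relators_def, blast)
    next
      case 2
      then show ?thesis by (intro exI[of _ "{x}"]) (simp add: tensor_relators_def, blast)
    next
      case 3
      then show ?thesis by (intro exI[of _ "{x}"]) (simp add: tensor_relators_def, blast)
    qed
  qed
  from assms(3) have "\<exists>E. ?P E p"
    unfolding tensor_kernel_def[of A N C]
  proof (induction p rule: generate.induct)
    case one
    show ?case
      by (intro exI[of _ "{}"]) (auto simp: tensor_pairs_def tensor_kernel_def intro: generate.one[of "free_Abelian_group _", simplified])
  next
    case (incl p)
    then obtain E where "finite E" "E \<subseteq> carrier N"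
      "\<And>U. E \<subseteq> U \<Longrightarrow> p \<in> tensor_relators A (N\<lparr>carrier := U\<rparr>) C" using rel[of p] by metis
    then show ?case by (intro exI[of _ E]) (simp add: tensor_kernel_def generate.incl)
  next
    case (inv p)
    then obtain E where E: "finite E" "E \<subseteq> carrier N"
      "\<And>U. E \<subseteq> U \<Longrightarrow> p \<in> tensor_relators A (N\<lparr>carrier := U\<rparr>) C" using rel[of p] by metis
    have "inv\<^bsub>tensor_pairs N C\<^esub> p \<in> tensor_kernel A (N\<lparr>carrier := U\<rparr>) C"
      if U: "E \<subseteq> U" "right_module A (N\<lparr>carrier := U\<rparr>)" for U
    proof -
      have "p \<in> carrier (tensor_pairs (N\<lparr>carrier := U\<rparr>) C)" "p \<in> carrier (tensor_pairs N C)"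
        using E(3)[OF U(1)] tensor_relators_carrier[OF U(2) C] tensor_relators_carrier[OF N C] inv by blast+
      then have "inv\<^bsub>tensor_pairs N C\<^esub> p = inv\<^bsub>tensor_pairs (N\<lparr>carrier := U\<rparr>) C\<^esub> p"
        by (simp add: tensor_pairs_def)
      then show ?thesis using generate.inv[OF E(3)[OF U(1)]] by (simp add: tensor_kernel_def)
    qed
    then show ?case using E by blast
  next
    case (eng p q)
    then obtain E E' where "?P E p" "?P E' q" by blast
    moreover have "p \<otimes>\<^bsub>tensor_pairs N C\<^esub> q \<in> tensor_kernel A (N\<lparr>carrier := U\<rparr>) C"
      if "p \<in> tensor_kernel A (N\<lparr>carrier := U\<rparr>) C" "q \<in> tensor_kernel A (N\<lparr>carrier := U\<rparr>) C" for U
      using generate.eng[OF that[unfolded tensor_kernel_def]] by (simp add: tensor_kernel_def tensor_pairs_def)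
    ultimately show ?case by (intro exI[of _ "E \<union> E'"]) auto
  qed
  then show ?thesis .
qed

lemma right_module_image:
  assumes F: "right_module A F" and X: "right_module A X" and f: "f \<in> right_hom A F X"
  shows "right_module A (X\<lparr>carrier := f ` carrier F\<rparr>)"
proof -
  interpret F: right_module A F by (rule F)
  interpret X: right_module A X by (rule X)
  have ab: "abelian_group F" "abelian_group X" by unfold_locales
  note fD = right_homD[OF f]
  have sub: "f ` carrier F \<subseteq> carrier X" using fD by auto
  have cl: "x \<oplus>\<^bsub>X\<^esub> y \<in> f ` carrier F" if "x \<in> f ` carrier F" "y \<in> f ` carrier F" for x y
    using that fD(3)[symmetric] by (auto intro!: imageI)
  have ab': "abelian_group (X\<lparr>carrier := f ` carrier F\<rparr>)"
  proof (rule abelian_groupI; simp)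
    show "\<zero>\<^bsub>X\<^esub> \<in> f ` carrier F"
      using additive_maps_zero[OF ab fD(1)] by (metis F.X.zero_closed imageI)
    fix x assume "x \<in> f ` carrier F"
    then obtain a where a: "a \<in> carrier F" "x = f a" by blast
    have "f (\<ominus>\<^bsub>F\<^esub> a) \<oplus>\<^bsub>X\<^esub> f a = \<zero>\<^bsub>X\<^esub>"
      using a fD(3)[of "\<ominus>\<^bsub>F\<^esub> a" a] additive_maps_zero[OF ab fD(1)] by (simp add: F.X.l_neg)
    then show "\<exists>y\<in>carrier F. f y \<oplus>\<^bsub>X\<^esub> x = \<zero>\<^bsub>X\<^esub>" using a by auto
  qed (use sub cl in \<open>auto simp: X.X.a_ac fD\<close>)
  then interpret S: abelian_group "X\<lparr>carrier := f ` carrier F\<rparr>" .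
  show ?thesis
    by unfold_locales
      (use sub in \<open>auto simp: fD X.ract_add_left X.ract_add_right X.ract_mult X.ract_one
        fD(4)[symmetric] F.ract_closed simp del: fD(4)\<close>)
qed

lemma right_module_preimage:
  assumes X: "right_module A X" and Y: "right_module A Y" and f: "f \<in> right_hom A X Y"
    and V: "right_module A (Y\<lparr>carrier := V\<rparr>)" "V \<subseteq> carrier Y"
  shows "right_module A (X\<lparr>carrier := {x \<in> carrier X. f x \<in> V}\<rparr>)"
proof -
  interpret X: right_module A X by (rule X)
  interpret Y: right_module A Y by (rule Y)
  interpret V: right_module A "Y\<lparr>carrier := V\<rparr>" by (rule V)
  have ab: "abelian_group X" "abelian_group Y" by unfold_locales
  note fD = right_homD[OF f]
  have neg: "f (\<ominus>\<^bsub>X\<^esub> x) \<in> V" if xV: "x \<in> carrier X" "f x \<in> V" for x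
  proof -
    obtain v where v: "v \<in> V" "v \<oplus>\<^bsub>Y\<^esub> f x = \<zero>\<^bsub>Y\<^esub>"
      using V.X.l_neg[of "f x"] V.X.a_inv_closed[of "f x"] xV by auto
    moreover have "f (\<ominus>\<^bsub>X\<^esub> x) \<oplus>\<^bsub>Y\<^esub> f x = \<zero>\<^bsub>Y\<^esub>"
      using xV fD(3)[of "\<ominus>\<^bsub>X\<^esub> x" x] additive_maps_zero[OF ab fD(1)] by (simp add: X.X.l_neg)
    moreover have "v \<in> carrier Y" "f (\<ominus>\<^bsub>X\<^esub> x) \<in> carrier Y" "f x \<in> carrier Y"
      using V(2) v(1) xV fD(2) by (auto intro!: fD(2) X.X.a_inv_closed)
    ultimately have "v = f (\<ominus>\<^bsub>X\<^esub> x)"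
      using Y.X.add.right_cancel[of "f x" v "f (\<ominus>\<^bsub>X\<^esub> x)"] by simp
    then show ?thesis using v by simp
  qed
  have ab': "abelian_group (X\<lparr>carrier := {x \<in> carrier X. f x \<in> V}\<rparr>)"
  proof (rule abelian_groupI; simp)
    show "f \<zero>\<^bsub>X\<^esub> \<in> V" using additive_maps_zero[OF ab fD(1)] V.X.zero_closed by simp
    fix x assume "x \<in> carrier X \<and> f x \<in> V"
    then show "\<exists>y. y \<in> carrier X \<and> f y \<in> V \<and> y \<oplus>\<^bsub>X\<^esub> x = \<zero>\<^bsub>X\<^esub>"
      by (intro exI[of _ "\<ominus>\<^bsub>X\<^esub> x"]) (simp add: neg X.X.l_neg)
  qed (use V.X.a_closed in \<open>auto simp: X.X.a_ac fD\<close>)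
  then interpret S: abelian_group "X\<lparr>carrier := {x \<in> carrier X. f x \<in> V}\<rparr>" .
  show ?thesis
    by unfold_locales
      (use V.ract_closed in \<open>auto simp: fD X.ract_closed X.ract_add_left X.ract_add_right X.ract_mult X.ract_one\<close>)
qed

lemma finite_span:
  fixes X :: "(unit, 'a, 'v) bimodule"
  assumes X: "right_module A X" and E: "finite E" "E \<subseteq> carrier X"
  obtains U and i :: "'v \<Rightarrow> (nat \<Rightarrow> 'a) set"
  where "E \<subseteq> U" "U \<subseteq> carrier X" "right_module A (X\<lparr>carrier := U\<rparr>)" "inj_on i U"
proof -
  interpret X: right_module A X by (rule X)
  obtain n and e :: "nat \<Rightarrow> 'v" where e: "bij_betw e {..<n} E"
    using ex_bij_betw_nat_finite[OF E(1)] by (auto simp: atLeast0LessThan)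
  have eX: "e i \<in> carrier X" if "i < n" for i using e E that by (auto simp: bij_betw_def)
  define F where "F = free_right_module A n"
  define L where "L = (\<lambda>a\<in>carrier F. \<Oplus>\<^bsub>X\<^esub>i\<in>{..<n}. e i \<triangleleft>\<^bsub>X\<^esub> a i)"
  have F: "right_module A F" unfolding F_def by (rule right_module_free) unfold_locales
  have L: "L \<in> right_hom A F X" unfolding L_def F_def by (rule lincomb_hom[OF X eX])
  show thesis
  proof (rule that)
    show "right_module A (X\<lparr>carrier := L ` carrier F\<rparr>)" by (rule right_module_image[OF F X L])
    show "L ` carrier F \<subseteq> carrier X" using right_homD(2)[OF L] by auto
    show "inj_on (\<lambda>x. {a \<in> carrier F. L a = x}) (L ` carrier F)" by (auto simp: inj_on_def)
    show "E \<subseteq> L ` carrier F"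
    proof
      fix x assume "x \<in> E"
      then obtain j where j: "j < n" "x = e j" using e by (auto simp: bij_betw_def)
      define a where "a = (\<lambda>i\<in>{..<n}. if i = j then \<one>\<^bsub>A\<^esub> else \<zero>\<^bsub>A\<^esub>)"
      have a: "a \<in> carrier F" by (auto simp: a_def F_def free_right_module_def)
      have "L a = (\<Oplus>\<^bsub>X\<^esub>i\<in>{..<n}. e i \<triangleleft>\<^bsub>X\<^esub> a i)" using a by (simp add: L_def)
      also have "\<dots> = (\<Oplus>\<^bsub>X\<^esub>i\<in>{..<n}. if j = i then e i else \<zero>\<^bsub>X\<^esub>)"
        by (intro X.X.finsum_cong') (auto simp: a_def eX X.ract_one X.ract_zero)
      also have "\<dots> = e j" using j eX by (intro X.X.finsum_singleton) auto
      finally show "x \<in> L ` carrier F" using imageI[OF a, of L] j by simp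
    qed
  qed
qed

definition transport :: "('x \<Rightarrow> 'u) \<Rightarrow> ('t, 'a, 'x) bimodule \<Rightarrow> (unit, 'a, 'u) bimodule" where
  "transport i N = \<lparr>carrier = i ` carrier N, mult = undefined, one = undefined, zero = i (zero N),
     add = (\<lambda>u v. i (inv_into (carrier N) i u \<oplus>\<^bsub>N\<^esub> inv_into (carrier N) i v)),
     smult = (\<lambda>_ u. u), rsmult = (\<lambda>u s. i (inv_into (carrier N) i u \<triangleleft>\<^bsub>N\<^esub> s))\<rparr>"

lemma transport:
  assumes N: "right_module A N" and i: "inj_on i (carrier N)"
  shows "right_module A (transport i N)"
    and "(\<lambda>x\<in>carrier N. i x) \<in> right_hom A N (transport i N)"
    and "(\<lambda>u\<in>carrier (transport i N). inv_into (carrier N) i u) \<in> right_hom A (transport i N) N"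
proof -
  interpret N: right_module A N by (rule N)
  note inv [simp] = inv_into_f_f[OF i]
  have ab: "abelian_group (transport i N)"
  proof (rule abelian_groupI)
    fix u assume "u \<in> carrier (transport i N)"
    then obtain x where x: "x \<in> carrier N" "u = i x" by (auto simp: transport_def)
    then show "\<exists>v\<in>carrier (transport i N). v \<oplus>\<^bsub>transport i N\<^esub> u = \<zero>\<^bsub>transport i N\<^esub>"
      by (intro bexI[of _ "i (\<ominus>\<^bsub>N\<^esub> x)"]) (auto simp: transport_def N.X.l_neg)
  qed (auto simp: transport_def N.X.a_ac)
  then interpret T: abelian_group "transport i N" .
  show T: "right_module A (transport i N)"
    by unfold_locales
      (auto simp: transport_def N.ract_closed N.ract_add_left N.ract_add_right N.ract_mult N.ract_one)
  show "(\<lambda>x\<in>carrier N. i x) \<in> right_hom A N (transport i N)"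
    by (rule right_homI) (auto simp: transport_def N.ract_closed)
  show "(\<lambda>u\<in>carrier (transport i N). inv_into (carrier N) i u) \<in> right_hom A (transport i N) N"
    by (rule right_homI) (auto simp: transport_def N.ract_closed)
qed

theorem flat_left_module_any_type:
  fixes C :: "('a, 't, 'c) bimodule"
  assumes flat: "flat_left_module TYPE((nat \<Rightarrow> 'a) set) A C"
  shows "flat_left_module TYPE('v) A C"
  unfolding flat_left_module_def
proof (intro conjI allI impI)
  show C: "left_module A C" using flat by (simp add: flat_left_module_def)
  fix N' N :: "(unit, 'a, 'v) bimodule" and j
  assume "right_module A N' \<and> right_module A N \<and> j \<in> right_hom A N' N \<and> inj_on j (carrier N')"
  then have N': "right_module A N'" and N: "right_module A N" and j: "j \<in> right_hom A N' N"
    and inj: "inj_on j (carrier N')" by blast+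
  note jD = right_homD[OF j]
  note TN' = tensor_group_abelian[OF N' C] and TN = tensor_group_abelian[OF N C]
  note J = tensor_map_id_right[OF N' N C j]
  interpret J: group_hom "add_monoid (tensor_group A N' C)" "add_monoid (tensor_group A N C)"
    "tensor_map A N' C N C j (\<lambda>c. c)"
    by (rule additive_maps_group_hom[OF TN' TN J(1)])
  have "u = \<zero>\<^bsub>tensor_group A N' C\<^esub>"
    if u: "u \<in> carrier (tensor_group A N' C)"
      and Ju: "tensor_map A N' C N C j (\<lambda>c. c) u = \<zero>\<^bsub>tensor_group A N C\<^esub>" for u
  proof -
    obtain p where p: "Poly_Mapping.keys p \<subseteq> carrier N' \<times> carrier C" "u = tensor_class A N' C p"
      using u by (auto simp: carrier_tensor_group[OF N' C] tensor_pairs_def)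
    define q where "q = frag_extend (\<lambda>(x, c). frag_of (j x, c)) p"
    have q: "q \<in> carrier (tensor_pairs N C)" "tensor_class A N C q = \<zero>\<^bsub>tensor_group A N C\<^esub>"
      using tensor_map_class[OF N' N C j p(1)] Ju p(2) by (simp_all add: q_def tensor_pairs_def)
    then have "q \<in> tensor_kernel A N C" using tensor_class_eq_zero_iff[OF N C] by blast
    from tensor_kernel_finite_support[OF N C this] obtain E where E: "finite E" "E \<subseteq> carrier N"
      and ker: "\<forall>V. E \<subseteq> V \<and> V \<subseteq> carrier N \<and> right_module A (N\<lparr>carrier := V\<rparr>) \<longrightarrow>
        q \<in> tensor_kernel A (N\<lparr>carrier := V\<rparr>) C"
      by (elim exE conjE)
    define E' where "E' = E \<union> j ` fst ` Poly_Mapping.keys p"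
    have E': "finite E'" "E' \<subseteq> carrier N" using E p(1) jD(2) by (auto simp: E'_def)
    obtain V and i :: "'v \<Rightarrow> (nat \<Rightarrow> 'a) set" where V: "E' \<subseteq> V" "V \<subseteq> carrier N"
      "right_module A (N\<lparr>carrier := V\<rparr>)" "inj_on i V" by (rule finite_span[OF N E'])
    define M where "M = N\<lparr>carrier := V\<rparr>"
    define U where "U = {x \<in> carrier N'. j x \<in> V}"
    define M' where "M' = N'\<lparr>carrier := U\<rparr>"
    have M: "right_module A M" "carrier M = V" using V by (simp_all add: M_def)
    have UN': "U \<subseteq> carrier N'" by (auto simp: U_def)
    have M': "right_module A M'" "carrier M' = U"
      using right_module_preimage[OF N' N j V(3,2)] by (simp_all add: M'_def U_def)
    define j' where "j' = (\<lambda>x\<in>carrier M'. j x)"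
    have j': "j' \<in> right_hom A M' M"
      unfolding j'_def
    proof (rule right_homI)
      interpret M': right_module A M' by (rule M'(1))
      fix x assume x: "x \<in> carrier M'"
      show "j x \<in> carrier M" using x by (simp add: M' M U_def)
      show "x \<oplus>\<^bsub>M'\<^esub> y \<in> carrier M' \<and> j (x \<oplus>\<^bsub>M'\<^esub> y) = j x \<oplus>\<^bsub>M\<^esub> j y" if "y \<in> carrier M'" for y
        using M'.X.a_closed[OF x that] x that jD(3) by (auto simp: M'_def M_def U_def)
      show "x \<triangleleft>\<^bsub>M'\<^esub> s \<in> carrier M' \<and> j (x \<triangleleft>\<^bsub>M'\<^esub> s) = j x \<triangleleft>\<^bsub>M\<^esub> s" if "s \<in> carrier A" for s
        using M'.ract_closed[OF x that] x that jD(4) by (auto simp: M'_def M_def U_def)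
    qed
    have pU: "Poly_Mapping.keys p \<subseteq> carrier M' \<times> carrier C"
      using p(1) V(1) by (force simp: M'(2) U_def E'_def)
    define u0 where "u0 = tensor_class A M' C p"
    have u0: "u0 \<in> carrier (tensor_group A M' C)"
      using pU by (simp add: u0_def tensor_class_closed[OF M'(1) C] tensor_pairs_def)
    have "frag_extend (\<lambda>(x, c). frag_of (j' x, c)) p = q"
      unfolding q_def by (rule frag_extend_eq) (use pU in \<open>auto simp: j'_def\<close>)
    then have j'q: "tensor_map A M' C M C j' (\<lambda>c. c) u0 = tensor_class A M C q" and "q \<in> carrier (tensor_pairs M C)"
      using tensor_map_class[OF M'(1) M(1) C j' pU] by (simp_all add: u0_def tensor_pairs_def)
    moreover have "q \<in> tensor_kernel A M C" using ker[rule_format, of V] V by (simp add: M_def E'_def)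
    ultimately have j'u0: "tensor_map A M' C M C j' (\<lambda>c. c) u0 = \<zero>\<^bsub>tensor_group A M C\<^esub>"
      using tensor_class_eq_zero_iff[OF M(1) C] by simp

    define i' where "i' = (\<lambda>x. i (j x))"
    have i': "inj_on i' (carrier M')" and i: "inj_on i (carrier M)"
      using V(4) inj unfolding i'_def M'(2) M(2) U_def inj_on_def by blast+
    define T' where "T' = transport i' M'"
    define T where "T = transport i M"
    note tr' = transport[OF M'(1) i', folded T'_def] and tr = transport[OF M(1) i, folded T_def]
    define k' where "k' = (\<lambda>x\<in>carrier M'. i' x)"
    define k where "k = (\<lambda>x\<in>carrier M. i x)"
    define l' where "l' = (\<lambda>u\<in>carrier T'. inv_into (carrier M') i' u)"
    define t where "t = (\<lambda>u\<in>carrier T'. k ((\<lambda>u\<in>carrier T'. j' (l' u)) u))"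
    have k': "k' \<in> right_hom A M' T'" and k: "k \<in> right_hom A M T" and l': "l' \<in> right_hom A T' M'"
      using tr' tr by (simp_all add: k'_def k_def l'_def)
    note jl = right_hom_comp[OF tr'(1) l' j']
    have t: "t \<in> right_hom A T' T" unfolding t_def by (rule right_hom_comp[OF tr'(1) jl k])
    have l'k': "l' (k' x) = x" if "x \<in> carrier M'" for x
      using that right_homD(2)[OF k' that] by (simp add: l'_def k'_def inv_into_f_f[OF i'])
    have tk': "t (k' x) = k (j' x)" if "x \<in> carrier M'" for x
      using right_homD(2)[OF k' that] by (simp add: t_def l'k'[OF that])
    have "inj_on t (carrier T')"
    proof (rule inj_onI)
      fix u v assume uv: "u \<in> carrier T'" "v \<in> carrier T'" "t u = t v"
      then obtain x y where xy: "x \<in> carrier M'" "u = k' x" "y \<in> carrier M'" "v = k' y"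
        by (auto simp: T'_def transport_def k'_def)
      then have "k (j' x) = k (j' y)" using uv tk' by simp
      then have "i (j x) = i (j y)" using xy right_homD(2)[OF j'] by (simp add: k_def j'_def)
      then show "u = v" using xy by (simp add: k'_def i'_def)
    qed
    then have inj_t: "inj_on (tensor_map A T' C T C t (\<lambda>c. c)) (carrier (tensor_group A T' C))"
      using flat tr'(1) tr(1) t by (simp add: flat_left_module_def)
    have "tensor_map A T' C T C t (\<lambda>c. c) (tensor_map A M' C T' C k' (\<lambda>c. c) u0)
        = tensor_map A M C T C k (\<lambda>c. c) (tensor_map A M' C M C j' (\<lambda>c. c) u0)"
    proof -
      have "(\<lambda>x\<in>carrier M'. t (k' x)) = (\<lambda>x\<in>carrier M'. k (j' x))" by (rule restrict_ext) (rule tk')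
      then show ?thesis
        by (simp add: tensor_map_comp[OF M'(1) tr'(1) tr(1) C k' t u0] tensor_map_comp[OF M'(1) M(1) tr(1) C j' k u0])
    qed
    also have "\<dots> = \<zero>\<^bsub>tensor_group A T C\<^esub>"
      unfolding j'u0 using additive_maps_zero[OF _ _ tensor_map_id_right(1)[OF M(1) tr(1) C k]]
        tensor_group_abelian[OF M(1) C] tensor_group_abelian[OF tr(1) C] by blast
    finally have "tensor_map A T' C T C t (\<lambda>c. c) (tensor_map A M' C T' C k' (\<lambda>c. c) u0)
      = tensor_map A T' C T C t (\<lambda>c. c) \<zero>\<^bsub>tensor_group A T' C\<^esub>"
      using additive_maps_zero[OF _ _ tensor_map_id_right(1)[OF tr'(1) tr(1) C t]]
        tensor_group_abelian[OF tr'(1) C] tensor_group_abelian[OF tr(1) C] by simp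
    then have k'u0: "tensor_map A M' C T' C k' (\<lambda>c. c) u0 = \<zero>\<^bsub>tensor_group A T' C\<^esub>"
      using inj_onD[OF inj_t] additive_mapsD(2)[OF tensor_map_id_right(1)[OF M'(1) tr'(1) C k'] u0]
        abelian_monoid.zero_closed[OF abelian_group.axioms(1)[OF tensor_group_abelian[OF tr'(1) C]]] by blast
    \<comment> \<open>\<open>l'\<close> and the inclusion of \<open>M'\<close> carry this back to \<open>u\<close>\<close>
    note inc = inclusion_hom[OF M'(1)[unfolded M'_def] UN', folded M'_def]
    note li = right_hom_comp[OF tr'(1) l' inc]
    have "tensor_map A T' C N' C (\<lambda>x\<in>carrier T'. (\<lambda>x\<in>U. x) (l' x)) (\<lambda>c. c) (tensor_map A M' C T' C k' (\<lambda>c. c) u0)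
        = tensor_map A M' C N' C (\<lambda>x\<in>U. x) (\<lambda>c. c) u0"
    proof -
      have "(\<lambda>x\<in>carrier M'. (\<lambda>x\<in>carrier T'. (\<lambda>x\<in>U. x) (l' x)) (k' x)) = (\<lambda>x\<in>U. x)"
        using l'k' right_homD(2)[OF k'] by (auto simp: M'(2) fun_eq_iff)
      then show ?thesis by (simp only: tensor_map_comp[OF M'(1) tr'(1) N' C k' li u0])
    qed
    also have "\<dots> = tensor_class A N' C (frag_extend (\<lambda>(x, c). frag_of ((\<lambda>x\<in>U. x) x, c)) p)"
      unfolding u0_def by (rule tensor_map_class(1)[OF M'(1) N' C inc pU])
    also have "frag_extend (\<lambda>(x, c). frag_of ((\<lambda>x\<in>U. x) x, c)) p = frag_extend frag_of p"
      by (rule frag_extend_eq) (use pU in \<open>auto simp: M'(2)\<close>)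
    also have "\<dots> = p" by (rule frag_expansion[symmetric])
    finally show ?thesis
      using k'u0 p(2) additive_maps_zero[OF _ _ tensor_map_id_right(1)[OF tr'(1) N' C li]]
        tensor_group_abelian[OF tr'(1) C] TN' by metis
  qed
  then show "inj_on (tensor_map A N' C N C j (\<lambda>c. c)) (carrier (tensor A N' C))"
    using J.inj_on_one_iff by (simp add: J.inj_iff_trivial_ker)
qed

end

theory Submission
  imports Defs
begin

text \<open>
  Write \<open>c(\<xi>, m) = \<Sum> \<xi>(m\<^sub>[\<^sub>0\<^sub>]) m\<^sub>[\<^sub>1\<^sub>]\<close> and let \<open>\<sigma>\<close> be a colinear section of
  \<open>\<xi> \<otimes> m \<mapsto> c(\<xi>, m)\<close>. For each \<open>m\<close> the map \<open>\<xi> \<mapsto> \<sigma>(c(\<xi>, m))\<close> is left colinear, so by (b) it is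
  \<open>\<xi> \<mapsto> \<Sum> \<xi> b\<^sub>i \<otimes> m\<^sub>i\<close> for a unique element \<open>s(m) = \<Sum> b\<^sub>i \<otimes> m\<^sub>i\<close> of \<open>B \<otimes> M\<close>. Uniqueness makes \<open>s\<close>
  left \<open>B\<close>-linear, since \<open>c(\<xi>, b m) = c(\<xi> b, m)\<close>. As \<open>\<epsilon> c(\<xi>, m) = \<xi>(m)\<close> and \<open>M\<^sup>*\<close> separates the points
  of \<open>M\<close>, one gets \<open>\<Sum> b\<^sub>i m\<^sub>i = m\<close>: the action map \<open>B \<otimes> M \<rightarrow> M\<close> splits, whence relative projectivity.
  Every colinear \<open>f : M \<rightarrow> C\<close> is \<open>c(\<xi>, -)\<close> with \<open>\<xi> = \<epsilon> f\<close>, and in \<open>Hom\<^sup>-\<^sup>C(M, C) \<otimes>\<^sub>B M\<close> the class of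
  \<open>\<sigma>(c(\<xi>, m)) = \<Sum> \<xi> b\<^sub>i \<otimes> m\<^sub>i\<close> is \<open>c(\<xi>, -) \<otimes> \<Sum> b\<^sub>i m\<^sub>i = f \<otimes> m\<close>; so \<open>\<sigma>\<close> induces the inverse of the
  evaluation map.
\<close>

section \<open>Additive maps and groups of maps\<close>

text \<open>Two colinearity facts lie behind the argument: c(-, m) must be left colinear before
  \<sigma> is composed with it, and c(\<xi>, -) right colinear before it belongs to Hom(M, C). Both
  come from \<Delta> c(\<xi>, m) = \<Sum> c(\<xi>, e_i) \<otimes> c(x_i, m) for a dual basis e_i,
  x_i, which is colinearity of the map in (c), evaluated at \<xi> \<otimes> m. The obstacle is the
  coaction of the dual of M: it is written in a chosen dual basis, which hides how it meets scalars
  and endomorphisms. Expanding c(\<xi>, b e_i) along the basis shows that \<xi> b goes to \<Sum>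
  c(\<xi>, e_i) \<otimes> x_i b. As K acts on M through elements of B, this formula yields
  balancedness over K as well as colinearity of \<xi> \<mapsto> \<xi> b \<otimes> m. The class in
  the overview is the image under q : \<xi> \<otimes> m \<mapsto> c(\<xi>, -) \<otimes> m.
  Evaluation after q is the map in (c), so q \<sigma> is a right inverse of evaluation; the
  overview's computation makes it a left inverse.\<close>

definition additive_on :: "('x, 'p) ring_scheme \<Rightarrow> ('y, 'q) ring_scheme \<Rightarrow> ('x \<Rightarrow> 'y) \<Rightarrow> bool" where
  "additive_on X Y f \<longleftrightarrow> (\<forall>x\<in>carrier X. f x \<in> carrier Y) \<and>
     (\<forall>x\<in>carrier X. \<forall>y\<in>carrier X. f (x \<oplus>\<^bsub>X\<^esub> y) = f x \<oplus>\<^bsub>Y\<^esub> f y)"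

lemma additive_onI:
  assumes "\<And>x. x \<in> carrier X \<Longrightarrow> f x \<in> carrier Y"
    "\<And>x y. \<lbrakk>x \<in> carrier X; y \<in> carrier X\<rbrakk> \<Longrightarrow> f (x \<oplus>\<^bsub>X\<^esub> y) = f x \<oplus>\<^bsub>Y\<^esub> f y"
  shows "additive_on X Y f"
  using assms by (simp add: additive_on_def)

lemma additive_onD:
  assumes "additive_on X Y f"
  shows "\<And>x. x \<in> carrier X \<Longrightarrow> f x \<in> carrier Y"
    "\<And>x y. \<lbrakk>x \<in> carrier X; y \<in> carrier X\<rbrakk> \<Longrightarrow> f (x \<oplus>\<^bsub>X\<^esub> y) = f x \<oplus>\<^bsub>Y\<^esub> f y"
  using assms by (simp_all add: additive_on_def)

lemma additive_maps_additive_on: "f \<in> additive_maps X Y \<Longrightarrow> additive_on X Y f"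
  by (auto simp: additive_on_def additive_maps_def)

text \<open>\<open>additive_maps\<close> contains extensional functions only, so a composite written
  as a lambda term need not be a member. The proofs work with \<open>additive_on\<close> instead,
  and restriction restores membership where a hom set asks for it.\<close>

lemma restrict_additive_maps:
  assumes "abelian_group X" "additive_on X Y f"
  shows "restrict f (carrier X) \<in> additive_maps X Y"
proof -
  interpret abelian_group X by (rule assms)
  show ?thesis using assms(2) by (simp add: additive_on_def additive_maps_def)
qed

lemma additive_on_compose:
  "\<lbrakk>additive_on X Y f; additive_on Y Z g\<rbrakk> \<Longrightarrow> additive_on X Z (\<lambda>x. g (f x))"
  by (simp add: additive_on_def)

lemma additive_on_id: "additive_on X X (\<lambda>x. x)"
  by (simp add: additive_on_def)

lemma additive_on_add:
  assumes "abelian_group Y" "additive_on X Y f" "additive_on X Y g"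
  shows "additive_on X Y (\<lambda>x. f x \<oplus>\<^bsub>Y\<^esub> g x)"
proof -
  interpret Y: abelian_group Y by (rule assms)
  show ?thesis using assms(2,3) by (auto simp: additive_on_def Y.a_ac)
qed

lemma additive_on_zero:
  assumes "abelian_group Y"
  shows "additive_on X Y (\<lambda>x. \<zero>\<^bsub>Y\<^esub>)"
proof -
  interpret Y: abelian_group Y by (rule assms)
  show ?thesis by (auto simp: additive_on_def)
qed

lemma additive_on_minus:
  assumes "abelian_group Y" "additive_on X Y f" "additive_on X Y g"
  shows "additive_on X Y (\<lambda>x. f x \<ominus>\<^bsub>Y\<^esub> g x)"
proof -
  interpret Y: abelian_group Y by (rule assms)
  show ?thesis using assms(2,3) by (auto simp: additive_on_def Y.a_ac a_minus_def Y.minus_add)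
qed

lemma additive_on_finsum:
  assumes "abelian_group Y" "\<And>i. i \<in> I \<Longrightarrow> additive_on X Y (f i)"
  shows "additive_on X Y (\<lambda>x. \<Oplus>\<^bsub>Y\<^esub>i\<in>I. f i x)"
proof -
  interpret Y: abelian_group Y by (rule assms)
  show ?thesis
  proof (rule additive_onI)
    show "(\<Oplus>\<^bsub>Y\<^esub>i\<in>I. f i x) \<in> carrier Y" if "x \<in> carrier X" for x
      using assms(2) that by (intro Y.finsum_closed) (auto simp: additive_on_def)
    fix x y assume xy: "x \<in> carrier X" "y \<in> carrier X"
    have "(\<Oplus>\<^bsub>Y\<^esub>i\<in>I. f i (x \<oplus>\<^bsub>X\<^esub> y)) = (\<Oplus>\<^bsub>Y\<^esub>i\<in>I. f i x \<oplus>\<^bsub>Y\<^esub> f i y)"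
      using assms(2) xy by (intro Y.finsum_cong') (auto simp: additive_on_def)
    also have "\<dots> = (\<Oplus>\<^bsub>Y\<^esub>i\<in>I. f i x) \<oplus>\<^bsub>Y\<^esub> (\<Oplus>\<^bsub>Y\<^esub>i\<in>I. f i y)"
      using assms(2) xy by (intro Y.finsum_addf) (auto simp: additive_on_def)
    finally show "(\<Oplus>\<^bsub>Y\<^esub>i\<in>I. f i (x \<oplus>\<^bsub>X\<^esub> y)) = (\<Oplus>\<^bsub>Y\<^esub>i\<in>I. f i x) \<oplus>\<^bsub>Y\<^esub> (\<Oplus>\<^bsub>Y\<^esub>i\<in>I. f i y)" .
  qed
qed

lemma additive_on_zero_eq:
  assumes "abelian_group X" "abelian_group Y" "additive_on X Y f"
  shows "f \<zero>\<^bsub>X\<^esub> = \<zero>\<^bsub>Y\<^esub>"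
  using additive_maps_zero[OF assms(1,2) restrict_additive_maps[OF assms(1,3)]]
    abelian_monoid.zero_closed[of X] assms(1) by (simp add: abelian_group_def)

lemma additive_on_minus_eq:
  assumes "abelian_group X" "abelian_group Y" "additive_on X Y f" "x \<in> carrier X" "y \<in> carrier X"
  shows "f (x \<ominus>\<^bsub>X\<^esub> y) = f x \<ominus>\<^bsub>Y\<^esub> f y"
  using additive_maps_diff[OF assms(1,2) restrict_additive_maps[OF assms(1,3)] assms(4,5)]
    abelian_group.minus_closed[OF assms(1,4,5)] assms(4,5) by simp

lemma additive_on_finsum_eq:
  assumes "abelian_group X" "abelian_group Y" "additive_on X Y f" "finite I" "x \<in> I \<rightarrow> carrier X"
  shows "f (\<Oplus>\<^bsub>X\<^esub>i\<in>I. x i) = (\<Oplus>\<^bsub>Y\<^esub>i\<in>I. f (x i))"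
proof -
  interpret X: abelian_group X by (rule assms)
  interpret Y: abelian_group Y by (rule assms)
  have "(\<Oplus>\<^bsub>Y\<^esub>i\<in>I. restrict f (carrier X) (x i)) = (\<Oplus>\<^bsub>Y\<^esub>i\<in>I. f (x i))"
    using assms(3,5) by (intro Y.finsum_cong') (auto simp: additive_on_def)
  then show ?thesis
    using additive_maps_finsum[OF assms(1,2) restrict_additive_maps[OF assms(1,3)] assms(4,5)]
      X.finsum_closed[OF assms(5)] by simp
qed

text \<open>Zero and differences suffice, because -f = 0 - f and f + g = f - (-g); the group laws
  are inherited pointwise. One criterion serves the dual of M, the ring B, Hom(M, C) and the left
  comodule maps out of the dual.\<close>

lemma abelian_group_maps:
  fixes G :: "('x \<Rightarrow> 'y, 'q) ring_scheme"
  assumes Y: "abelian_group Y" and sub: "carrier G \<subseteq> I \<rightarrow>\<^sub>E carrier Y"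
    and add: "add G = (\<lambda>f g. \<lambda>x\<in>I. f x \<oplus>\<^bsub>Y\<^esub> g x)" and zero: "\<zero>\<^bsub>G\<^esub> = (\<lambda>x\<in>I. \<zero>\<^bsub>Y\<^esub>)"
    and zero_closed: "(\<lambda>x\<in>I. \<zero>\<^bsub>Y\<^esub>) \<in> carrier G"
    and minus_closed: "\<And>f g. \<lbrakk>f \<in> carrier G; g \<in> carrier G\<rbrakk> \<Longrightarrow> (\<lambda>x\<in>I. f x \<ominus>\<^bsub>Y\<^esub> g x) \<in> carrier G"
  shows "abelian_group G"
proof -
  interpret Y: abelian_group Y by (rule Y)
  have cl: "f x \<in> carrier Y" if "f \<in> carrier G" "x \<in> I" for f x using that sub by auto
  have arb: "f x = undefined" if "f \<in> carrier G" "x \<notin> I" for f x using PiE_arb[of f I "\<lambda>_. carrier Y" x] that sub by blast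
  have neg: "(\<lambda>x\<in>I. \<ominus>\<^bsub>Y\<^esub> f x) \<in> carrier G" if f: "f \<in> carrier G" for f
  proof -
    have "(\<lambda>x\<in>I. \<ominus>\<^bsub>Y\<^esub> f x) = (\<lambda>x\<in>I. (\<lambda>x\<in>I. \<zero>\<^bsub>Y\<^esub>) x \<ominus>\<^bsub>Y\<^esub> f x)"
      by (rule restrict_ext) (simp add: a_minus_def cl[OF f])
    then show ?thesis using minus_closed[OF zero_closed f] by simp
  qed
  have plus: "(\<lambda>x\<in>I. f x \<oplus>\<^bsub>Y\<^esub> g x) \<in> carrier G" if f: "f \<in> carrier G" and g: "g \<in> carrier G" for f g
  proof -
    have "(\<lambda>x\<in>I. f x \<oplus>\<^bsub>Y\<^esub> g x) = (\<lambda>x\<in>I. f x \<ominus>\<^bsub>Y\<^esub> (\<lambda>x\<in>I. \<ominus>\<^bsub>Y\<^esub> g x) x)"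
      by (rule restrict_ext) (simp add: a_minus_def cl[OF g])
    then show ?thesis using minus_closed[OF f neg[OF g]] by simp
  qed
  show ?thesis
  proof (rule abelian_groupI)
    fix f assume f: "f \<in> carrier G"
    show "\<exists>g\<in>carrier G. g \<oplus>\<^bsub>G\<^esub> f = \<zero>\<^bsub>G\<^esub>"
      by (intro bexI[OF _ neg[OF f]]) (auto simp: add zero cl[OF f] Y.l_neg)
    show "\<zero>\<^bsub>G\<^esub> \<oplus>\<^bsub>G\<^esub> f = f" by (rule ext) (simp add: add zero cl[OF f] arb[OF f] restrict_def)
    fix g assume g: "g \<in> carrier G"
    show "f \<oplus>\<^bsub>G\<^esub> g \<in> carrier G" using plus[OF f g] by (simp add: add)
    show "f \<oplus>\<^bsub>G\<^esub> g = g \<oplus>\<^bsub>G\<^esub> f" by (auto simp: add cl[OF f] cl[OF g] Y.a_comm)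
    fix h assume h: "h \<in> carrier G"
    show "(f \<oplus>\<^bsub>G\<^esub> g) \<oplus>\<^bsub>G\<^esub> h = f \<oplus>\<^bsub>G\<^esub> (g \<oplus>\<^bsub>G\<^esub> h)"
      by (rule ext) (simp add: add cl[OF f] cl[OF g] cl[OF h] Y.a_assoc restrict_def)
  qed (simp add: zero zero_closed)
qed

lemma additive_on_cong:
  assumes "abelian_group X" "\<And>x. x \<in> carrier X \<Longrightarrow> f x = g x"
  shows "additive_on X Y f \<longleftrightarrow> additive_on X Y g"
proof -
  interpret abelian_group X by (rule assms)
  show ?thesis by (simp add: additive_on_def assms(2))
qed

lemma finsum_swap:
  assumes "abelian_group G" "finite I" "finite J" "\<And>i j. \<lbrakk>i \<in> I; j \<in> J\<rbrakk> \<Longrightarrow> f i j \<in> carrier G"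
  shows "(\<Oplus>\<^bsub>G\<^esub>i\<in>I. \<Oplus>\<^bsub>G\<^esub>j\<in>J. f i j) = (\<Oplus>\<^bsub>G\<^esub>j\<in>J. \<Oplus>\<^bsub>G\<^esub>i\<in>I. f i j)"
proof -
  interpret G: abelian_group G by (rule assms)
  show ?thesis using assms(2,4)
  proof (induction I rule: finite_induct)
    case empty
    then show ?case by (simp add: G.finsum_zero)
  next
    case (insert i I)
    have "(\<Oplus>\<^bsub>G\<^esub>j\<in>J. \<Oplus>\<^bsub>G\<^esub>i\<in>insert i I. f i j) = (\<Oplus>\<^bsub>G\<^esub>j\<in>J. f i j \<oplus>\<^bsub>G\<^esub> (\<Oplus>\<^bsub>G\<^esub>i\<in>I. f i j))"
      using insert by (intro G.finsum_cong') (auto simp: Pi_iff intro!: G.finsum_closed G.finsum_insert)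
    also have "\<dots> = (\<Oplus>\<^bsub>G\<^esub>j\<in>J. f i j) \<oplus>\<^bsub>G\<^esub> (\<Oplus>\<^bsub>G\<^esub>j\<in>J. \<Oplus>\<^bsub>G\<^esub>i\<in>I. f i j)"
      using insert by (intro G.finsum_addf) (auto intro!: G.finsum_closed)
    also have "\<dots> = (\<Oplus>\<^bsub>G\<^esub>i\<in>insert i I. \<Oplus>\<^bsub>G\<^esub>j\<in>J. f i j)"
      using insert by (subst G.finsum_insert) (auto intro!: G.finsum_closed)
    finally show ?case by simp
  qed
qed

section \<open>Tensor products of bimodules\<close>

text \<open>Elementary tensors generate, and no extensionality is asked, so lambda composites can be
  compared directly. Most identities below are reduced to a computation on x \<otimes> y by this
  rule, often after a particular element such as \<open>\<rho> m\<close> is replaced by an arbitrary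
  tensor.\<close>

lemma tensor_eqI:
  assumes "right_module S X" "left_module S Y" "abelian_group Z"
    and "additive_on (tensor_group S X Y) Z f" "additive_on (tensor_group S X Y) Z g"
    and "\<And>x y. \<lbrakk>x \<in> carrier X; y \<in> carrier Y\<rbrakk> \<Longrightarrow> f (tens S X Y x y) = g (tens S X Y x y)"
    and u: "u \<in> carrier (tensor_group S X Y)"
  shows "f u = g u"
proof -
  have ag: "abelian_group (tensor_group S X Y)" by (rule tensor_group_abelian[OF assms(1,2)])
  have "restrict f (carrier (tensor_group S X Y)) u = restrict g (carrier (tensor_group S X Y)) u"
    by (rule tensor_additive_eq[OF assms(1-3) restrict_additive_maps[OF ag assms(4)] restrict_additive_maps[OF ag assms(5)] _ u])
      (simp add: assms(6) tens_closed[OF assms(1,2)])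
  then show ?thesis using u by simp
qed

definition balanced_map ::
  "('s, 'w) ring_scheme \<Rightarrow> ('r, 's, 'x) bimodule \<Rightarrow> ('s, 't, 'y) bimodule \<Rightarrow> ('z, 'q) ring_scheme
     \<Rightarrow> ('x \<Rightarrow> 'y \<Rightarrow> 'z) \<Rightarrow> bool"
  where "balanced_map S X Y Z f \<longleftrightarrow>
     (\<forall>y\<in>carrier Y. additive_on X Z (\<lambda>x. f x y)) \<and> (\<forall>x\<in>carrier X. additive_on Y Z (f x)) \<and>
     (\<forall>x\<in>carrier X. \<forall>s\<in>carrier S. \<forall>y\<in>carrier Y. f (x \<triangleleft>\<^bsub>X\<^esub> s) y = f x (s \<odot>\<^bsub>Y\<^esub> y))"

lemma balanced_mapI:
  assumes "\<And>y. y \<in> carrier Y \<Longrightarrow> additive_on X Z (\<lambda>x. f x y)"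
    "\<And>x. x \<in> carrier X \<Longrightarrow> additive_on Y Z (f x)"
    "\<And>x s y. \<lbrakk>x \<in> carrier X; s \<in> carrier S; y \<in> carrier Y\<rbrakk> \<Longrightarrow> f (x \<triangleleft>\<^bsub>X\<^esub> s) y = f x (s \<odot>\<^bsub>Y\<^esub> y)"
  shows "balanced_map S X Y Z f"
  using assms by (simp add: balanced_map_def)

text \<open>\<open>tensor_lift\<close> is a definite description, so it can be computed with only
  once the map is known to be balanced. The \<open>_lift\<close> collections below are instances:
  fact 1 is membership in \<open>additive_maps\<close>, fact 2 additivity, fact 3 the value on x
  \<otimes> y.\<close>

lemma tensor_lift_balanced:
  assumes "right_module S X" "left_module S Y" "abelian_group Z" "balanced_map S X Y Z f"
  shows "tensor_lift S X Y Z f \<in> additive_maps (tensor_group S X Y) Z"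
    and "additive_on (tensor_group S X Y) Z (tensor_lift S X Y Z f)"
    and "\<lbrakk>x \<in> carrier X; y \<in> carrier Y\<rbrakk> \<Longrightarrow> tensor_lift S X Y Z f (tens S X Y x y) = f x y"
proof -
  note * = tensor_lift[OF assms(1-3), of f] and ** = assms(4)[unfolded balanced_map_def additive_on_def]
  show "tensor_lift S X Y Z f \<in> additive_maps (tensor_group S X Y) Z"
    by (rule *(1)) (use ** in auto)
  then show "additive_on (tensor_group S X Y) Z (tensor_lift S X Y Z f)"
    by (rule additive_maps_additive_on)
  show "tensor_lift S X Y Z f (tens S X Y x y) = f x y" if "x \<in> carrier X" "y \<in> carrier Y"
    by (rule *(2)[OF _ _ _ _ that]) (use ** in auto)
qed

text \<open>\<open>tensor\<close> has the carrier, zero and addition of \<open>tensor_group\<close>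
  and adds the two actions. These rules normalise additive statements to
  \<open>tensor_group\<close>, while module statements keep \<open>tensor\<close>.\<close>

lemma additive_on_tensor [simp]:
  "additive_on (tensor S X Y) Z f = additive_on (tensor_group S X Y) Z f"
  "additive_on Z (tensor S X Y) g = additive_on Z (tensor_group S X Y) g"
  by (simp_all add: additive_on_def)

lemma additive_maps_tensor [simp]:
  "additive_maps (tensor S X Y) Z = additive_maps (tensor_group S X Y) Z"
  "additive_maps Z (tensor S X Y) = additive_maps Z (tensor_group S X Y)"
  by (simp_all add: additive_maps_def)

lemma balanced_map_tensor [simp]:
  "balanced_map S X Y (tensor R U V) f = balanced_map S X Y (tensor_group R U V) f"
  by (simp add: balanced_map_def)

lemma finsum_tensor [simp]: "finsum (tensor S X Y) = finsum (tensor_group S X Y)"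
  by (simp add: finsum_def finprod_def fun_eq_iff)

lemma tens_additive_left:
  assumes "right_module S X" "left_module S Y" "y \<in> carrier Y"
  shows "additive_on X (tensor_group S X Y) (\<lambda>x. tens S X Y x y)"
  using assms by (intro additive_onI) (simp_all add: tens_closed tens_add_left)

lemma tens_additive_right:
  assumes "right_module S X" "left_module S Y" "x \<in> carrier X"
  shows "additive_on Y (tensor_group S X Y) (tens S X Y x)"
  using assms by (intro additive_onI) (simp_all add: tens_closed tens_add_right)

lemma left_homD:
  assumes "f \<in> left_hom S X Y"
  shows "f \<in> additive_maps X Y" "additive_on X Y f" "\<And>x. x \<in> carrier X \<Longrightarrow> f x \<in> carrier Y"
    "\<And>s x. \<lbrakk>s \<in> carrier S; x \<in> carrier X\<rbrakk> \<Longrightarrow> f (s \<odot>\<^bsub>X\<^esub> x) = s \<odot>\<^bsub>Y\<^esub> f x"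
  using assms additive_mapsD[of f X Y] by (auto simp: left_hom_def additive_on_def)

lemma restrict_left_hom:
  assumes "left_module S X" "additive_on X Y f"
    "\<And>s x. \<lbrakk>s \<in> carrier S; x \<in> carrier X\<rbrakk> \<Longrightarrow> f (s \<odot>\<^bsub>X\<^esub> x) = s \<odot>\<^bsub>Y\<^esub> f x"
  shows "(\<lambda>x\<in>carrier X. f x) \<in> left_hom S X Y"
proof -
  interpret X: left_module S X by (rule assms)
  show ?thesis
    using restrict_additive_maps[OF X.X.abelian_group_axioms assms(2)]
    by (simp add: left_hom_def assms(3) X.lact_closed)
qed

lemma restrict_right_hom:
  assumes "right_module S X" "additive_on X Y f"
    "\<And>s x. \<lbrakk>s \<in> carrier S; x \<in> carrier X\<rbrakk> \<Longrightarrow> f (x \<triangleleft>\<^bsub>X\<^esub> s) = f x \<triangleleft>\<^bsub>Y\<^esub> s"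
  shows "(\<lambda>x\<in>carrier X. f x) \<in> right_hom S X Y"
proof -
  interpret X: right_module S X by (rule assms)
  show ?thesis
    using restrict_additive_maps[OF X.X.abelian_group_axioms assms(2)]
    by (simp add: right_hom_def assms(3) X.ract_closed)
qed

lemma right_hom_additive_on: "f \<in> right_hom S X Y \<Longrightarrow> additive_on X Y f"
  using right_homD(1) by (rule additive_maps_additive_on)

lemma tensor_map_id_left:
  fixes C :: "('r, 'a, 'c) bimodule" and X :: "('a, 's, 'x) bimodule" and Y :: "('a, 't, 'y) bimodule"
  assumes C: "right_module A C" and X: "left_module A X" and Y: "left_module A Y" and f: "f \<in> left_hom A X Y"
  shows "additive_on (tensor_group A C X) (tensor_group A C Y) (tensor_map A C X C Y (\<lambda>c. c) f)"
    and "\<lbrakk>c \<in> carrier C; x \<in> carrier X\<rbrakk> \<Longrightarrow>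
      tensor_map A C X C Y (\<lambda>c. c) f (tens A C X c x) = tens A C Y c (f x)"
proof -
  have "balanced_map A C X (tensor A C Y) (\<lambda>c x. tens A C Y c (f x))"
    using left_homD[OF f] unfolding balanced_map_tensor
    by (intro balanced_mapI tens_additive_left[OF C Y]
        additive_on_compose[OF left_homD(2)[OF f] tens_additive_right[OF C Y]]) (simp_all add: tens_balanced[OF C Y])
  note * = tensor_lift_balanced[OF C X abelian_group_tensor[OF C Y] this]
  show "additive_on (tensor_group A C X) (tensor_group A C Y) (tensor_map A C X C Y (\<lambda>c. c) f)"
    using *(2) by (simp add: tensor_map_def)
  show "tensor_map A C X C Y (\<lambda>c. c) f (tens A C X c x) = tens A C Y c (f x)"
    if "c \<in> carrier C" "x \<in> carrier X" using *(3)[OF that] by (simp add: tensor_map_def)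
qed

lemma tensor_map_comp_left:
  assumes C: "right_module A C" and X: "left_module A X" and Y: "left_module A Y" and Z: "left_module A Z"
    and f: "f \<in> left_hom A X Y" and g: "g \<in> left_hom A Y Z" and u: "u \<in> carrier (tensor_group A C X)"
  shows "tensor_map A C Y C Z (\<lambda>c. c) g (tensor_map A C X C Y (\<lambda>c. c) f u)
    = tensor_map A C X C Z (\<lambda>c. c) (\<lambda>x\<in>carrier X. g (f x)) u"
proof -
  have gf: "(\<lambda>x\<in>carrier X. g (f x)) \<in> left_hom A X Z"
    by (rule restrict_left_hom[OF X additive_on_compose[OF left_homD(2)[OF f] left_homD(2)[OF g]]])
      (simp add: left_homD[OF f] left_homD[OF g])
  note F = tensor_map_id_left[OF C X Y f] and G = tensor_map_id_left[OF C Y Z g]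
    and GF = tensor_map_id_left[OF C X Z gf]
  show ?thesis
    by (rule tensor_eqI[OF C X tensor_group_abelian[OF C Z] additive_on_compose[OF F(1) G(1)] GF(1) _ u])
      (simp add: F G GF left_homD(3)[OF f])
qed

text \<open>\<open>compat\<close> is what makes x \<otimes> y \<mapsto> r x \<otimes> y balanced
  over S. Each module law is then an equality of additive maps in the tensor and holds because it
  holds in X.\<close>

lemma tensor_left_module:
  fixes X :: "('r, 's, 'x) bimodule" and Y :: "('s, 't, 'y) bimodule"
  assumes XS: "right_module S X" and X: "left_module R X" and Y: "left_module S Y"
    and compat: "\<And>r x s. \<lbrakk>r \<in> carrier R; x \<in> carrier X; s \<in> carrier S\<rbrakk> \<Longrightarrow>
      r \<odot>\<^bsub>X\<^esub> (x \<triangleleft>\<^bsub>X\<^esub> s) = (r \<odot>\<^bsub>X\<^esub> x) \<triangleleft>\<^bsub>X\<^esub> s"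
  shows "left_module R (tensor S X Y)"
    and "\<lbrakk>r \<in> carrier R; x \<in> carrier X; y \<in> carrier Y\<rbrakk> \<Longrightarrow>
      r \<odot>\<^bsub>tensor S X Y\<^esub> tens S X Y x y = tens S X Y (r \<odot>\<^bsub>X\<^esub> x) y"
proof -
  interpret X: left_module R X by (rule X)
  let ?T = "tensor_group S X Y"
  interpret T: abelian_group ?T by (rule tensor_group_abelian[OF XS Y])
  have add: "additive_on X X (\<lambda>x. r \<odot>\<^bsub>X\<^esub> x)" if "r \<in> carrier R" for r
    using that by (intro additive_onI) (simp_all add: X.lact_closed X.lact_add_right)
  have "balanced_map S X Y ?T (\<lambda>x y. tens S X Y (r \<odot>\<^bsub>X\<^esub> x) y)" if r: "r \<in> carrier R" for r
    using r by (intro balanced_mapI tens_additive_right[OF XS Y] additive_on_compose[OF add[OF r] tens_additive_left[OF XS Y]])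
      (simp_all add: X.lact_closed compat[symmetric] tens_balanced[OF XS Y, symmetric])
  note * = tensor_lift_balanced[OF XS Y T.abelian_group_axioms this]
  have act: "smult (tensor S X Y) r = tensor_lift S X Y ?T (\<lambda>x y. tens S X Y (r \<odot>\<^bsub>X\<^esub> x) y)" for r
    by (simp add: tensor_def Let_def)
  have A: "additive_on ?T ?T (smult (tensor S X Y) r)" if "r \<in> carrier R" for r
    using *(2)[OF that] by (simp add: act)
  have V: "r \<odot>\<^bsub>tensor S X Y\<^esub> tens S X Y x y = tens S X Y (r \<odot>\<^bsub>X\<^esub> x) y"
    if "r \<in> carrier R" "x \<in> carrier X" "y \<in> carrier Y" for r x y
    using *(3)[OF that] by (simp add: act)
  interpret TT: abelian_group "tensor S X Y" by (rule abelian_group_tensor[OF XS Y])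
  note eqI = tensor_eqI[OF XS Y T.abelian_group_axioms]
  show "\<lbrakk>r \<in> carrier R; x \<in> carrier X; y \<in> carrier Y\<rbrakk> \<Longrightarrow>
      r \<odot>\<^bsub>tensor S X Y\<^esub> tens S X Y x y = tens S X Y (r \<odot>\<^bsub>X\<^esub> x) y"
    by (rule V)
  show "left_module R (tensor S X Y)"
  proof (unfold_locales, unfold tensor_simps)
    fix r u assume r: "r \<in> carrier R" and u: "u \<in> carrier ?T"
    show "r \<odot>\<^bsub>tensor S X Y\<^esub> u \<in> carrier ?T" using A[OF r] u by (rule additive_onD)
    fix s assume s: "s \<in> carrier R"
    show "(r \<oplus>\<^bsub>R\<^esub> s) \<odot>\<^bsub>tensor S X Y\<^esub> u = r \<odot>\<^bsub>tensor S X Y\<^esub> u \<oplus>\<^bsub>?T\<^esub> s \<odot>\<^bsub>tensor S X Y\<^esub> u"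
      by (rule eqI[OF A additive_on_add[OF _ A A] _ u])
        (simp_all add: V r s X.lact_add_left X.lact_closed tens_add_left[OF XS Y] T.abelian_group_axioms)
    show "(r \<otimes>\<^bsub>R\<^esub> s) \<odot>\<^bsub>tensor S X Y\<^esub> u = r \<odot>\<^bsub>tensor S X Y\<^esub> (s \<odot>\<^bsub>tensor S X Y\<^esub> u)"
      by (rule eqI[OF A additive_on_compose[OF A A] _ u]) (simp_all add: V r s X.lact_mult X.lact_closed)
  next
    show "\<one>\<^bsub>R\<^esub> \<odot>\<^bsub>tensor S X Y\<^esub> u = u" if u: "u \<in> carrier ?T" for u
      by (rule eqI[OF A additive_on_id _ u]) (simp_all add: V X.lact_one)
  qed (rule additive_onD(2)[OF A])
qed

lemma tensor_right_module:
  fixes X :: "('r, 's, 'x) bimodule" and Y :: "('s, 't, 'y) bimodule"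
  assumes X: "right_module S X" and YS: "left_module S Y" and Y: "right_module R Y"
    and compat: "\<And>r y s. \<lbrakk>r \<in> carrier R; y \<in> carrier Y; s \<in> carrier S\<rbrakk> \<Longrightarrow>
      s \<odot>\<^bsub>Y\<^esub> (y \<triangleleft>\<^bsub>Y\<^esub> r) = (s \<odot>\<^bsub>Y\<^esub> y) \<triangleleft>\<^bsub>Y\<^esub> r"
  shows "right_module R (tensor S X Y)"
    and "\<lbrakk>r \<in> carrier R; x \<in> carrier X; y \<in> carrier Y\<rbrakk> \<Longrightarrow>
      tens S X Y x y \<triangleleft>\<^bsub>tensor S X Y\<^esub> r = tens S X Y x (y \<triangleleft>\<^bsub>Y\<^esub> r)"
    and "r \<in> carrier R \<Longrightarrow> additive_on (tensor_group S X Y) (tensor_group S X Y) (\<lambda>u. u \<triangleleft>\<^bsub>tensor S X Y\<^esub> r)"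
proof -
  interpret Y: right_module R Y by (rule Y)
  let ?T = "tensor_group S X Y"
  interpret T: abelian_group ?T by (rule tensor_group_abelian[OF X YS])
  have add: "additive_on Y Y (\<lambda>y. y \<triangleleft>\<^bsub>Y\<^esub> r)" if "r \<in> carrier R" for r
    using that by (intro additive_onI) (simp_all add: Y.ract_closed Y.ract_add_left)
  have "balanced_map S X Y ?T (\<lambda>x y. tens S X Y x (y \<triangleleft>\<^bsub>Y\<^esub> r))" if r: "r \<in> carrier R" for r
    using r by (intro balanced_mapI tens_additive_left[OF X YS] additive_on_compose[OF add[OF r] tens_additive_right[OF X YS]])
      (simp_all add: Y.ract_closed tens_balanced[OF X YS] compat)
  note * = tensor_lift_balanced[OF X YS T.abelian_group_axioms this]
  have act: "u \<triangleleft>\<^bsub>tensor S X Y\<^esub> r = tensor_lift S X Y ?T (\<lambda>x y. tens S X Y x (y \<triangleleft>\<^bsub>Y\<^esub> r)) u" for r u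
    by (simp add: tensor_def Let_def)
  have A: "additive_on ?T ?T (\<lambda>u. u \<triangleleft>\<^bsub>tensor S X Y\<^esub> r)" if "r \<in> carrier R" for r
    using *(2)[OF that] by (simp add: act)
  have V: "tens S X Y x y \<triangleleft>\<^bsub>tensor S X Y\<^esub> r = tens S X Y x (y \<triangleleft>\<^bsub>Y\<^esub> r)"
    if "r \<in> carrier R" "x \<in> carrier X" "y \<in> carrier Y" for r x y
    using *(3)[OF that] by (simp add: act)
  interpret TT: abelian_group "tensor S X Y" by (rule abelian_group_tensor[OF X YS])
  note eqI = tensor_eqI[OF X YS T.abelian_group_axioms]
  show "\<lbrakk>r \<in> carrier R; x \<in> carrier X; y \<in> carrier Y\<rbrakk> \<Longrightarrow>
      tens S X Y x y \<triangleleft>\<^bsub>tensor S X Y\<^esub> r = tens S X Y x (y \<triangleleft>\<^bsub>Y\<^esub> r)"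
    by (rule V)
  show "r \<in> carrier R \<Longrightarrow> additive_on ?T ?T (\<lambda>u. u \<triangleleft>\<^bsub>tensor S X Y\<^esub> r)"
    by (rule A)
  show "right_module R (tensor S X Y)"
  proof (unfold_locales, unfold tensor_simps)
    fix u r assume u: "u \<in> carrier ?T" and r: "r \<in> carrier R"
    show "u \<triangleleft>\<^bsub>tensor S X Y\<^esub> r \<in> carrier ?T" using A[OF r] u by (rule additive_onD)
    fix s assume s: "s \<in> carrier R"
    show "u \<triangleleft>\<^bsub>tensor S X Y\<^esub> (r \<oplus>\<^bsub>R\<^esub> s) = u \<triangleleft>\<^bsub>tensor S X Y\<^esub> r \<oplus>\<^bsub>?T\<^esub> u \<triangleleft>\<^bsub>tensor S X Y\<^esub> s"
      by (rule eqI[OF A additive_on_add[OF _ A A] _ u])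
        (simp_all add: V r s Y.ract_add_right Y.ract_closed tens_add_right[OF X YS] T.abelian_group_axioms)
    show "u \<triangleleft>\<^bsub>tensor S X Y\<^esub> (r \<otimes>\<^bsub>R\<^esub> s) = u \<triangleleft>\<^bsub>tensor S X Y\<^esub> r \<triangleleft>\<^bsub>tensor S X Y\<^esub> s"
      by (rule eqI[OF A additive_on_compose[OF A A] _ u]) (simp_all add: V r s Y.ract_mult Y.ract_closed)
  next
    show "u \<triangleleft>\<^bsub>tensor S X Y\<^esub> \<one>\<^bsub>R\<^esub> = u" if u: "u \<in> carrier ?T" for u
      by (rule eqI[OF A additive_on_id _ u]) (simp_all add: V Y.ract_one)
  qed (rule additive_onD(2)[OF A])
qed

lemma regular_simps [simp]:
  "carrier (regular A) = carrier A" "zero (regular A) = zero A" "add (regular A) = add A"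
  "smult (regular A) = mult A" "rsmult (regular A) = mult A"
  by (simp_all add: regular_def)

lemma right_hom_bimodule_simps [simp]:
  "carrier (right_hom_bimodule H X Y) = H" "\<zero>\<^bsub>right_hom_bimodule H X Y\<^esub> = (\<lambda>x\<in>carrier X. \<zero>\<^bsub>Y\<^esub>)"
  "add (right_hom_bimodule H X Y) = (\<lambda>f g. \<lambda>x\<in>carrier X. f x \<oplus>\<^bsub>Y\<^esub> g x)"
  "smult (right_hom_bimodule H X Y) = (\<lambda>r f. \<lambda>x\<in>carrier X. r \<odot>\<^bsub>Y\<^esub> f x)"
  "rsmult (right_hom_bimodule H X Y) = (\<lambda>f s. \<lambda>x\<in>carrier X. f (s \<odot>\<^bsub>X\<^esub> x))"
  by (simp_all add: right_hom_bimodule_def)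

lemma left_hom_bimodule_simps [simp]:
  "carrier (left_hom_bimodule H X Y) = H" "\<zero>\<^bsub>left_hom_bimodule H X Y\<^esub> = (\<lambda>x\<in>carrier X. \<zero>\<^bsub>Y\<^esub>)"
  "add (left_hom_bimodule H X Y) = (\<lambda>f g. \<lambda>x\<in>carrier X. f x \<oplus>\<^bsub>Y\<^esub> g x)"
  "smult (left_hom_bimodule H X Y) = (\<lambda>s f. \<lambda>x\<in>carrier X. f (x \<triangleleft>\<^bsub>X\<^esub> s))"
  by (simp_all add: left_hom_bimodule_def)

lemma eval_bimodule_simps [simp]:
  "carrier (eval_bimodule M) = carrier M" "zero (eval_bimodule M) = zero M" "add (eval_bimodule M) = add M"
  "smult (eval_bimodule M) = (\<lambda>b. b)" "rsmult (eval_bimodule M) = rsmult M"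
  by (simp_all add: eval_bimodule_def)

lemma algebra_bimodule_simps [simp]:
  "carrier (algebra_bimodule A) = carrier A" "zero (algebra_bimodule A) = zero A" "add (algebra_bimodule A) = add A"
  "smult (algebra_bimodule A) = mult A" "rsmult (algebra_bimodule A) = (\<lambda>a c. c \<odot>\<^bsub>A\<^esub> a)"
  by (simp_all add: algebra_bimodule_def)

lemma comodule_End_simps [simp]:
  "carrier (comodule_End A C M \<rho>) = right_comodule_hom A C M \<rho> M \<rho>"
  "mult (comodule_End A C M \<rho>) = compose (carrier M)"
  "\<one>\<^bsub>comodule_End A C M \<rho>\<^esub> = (\<lambda>m\<in>carrier M. m)"
  "\<zero>\<^bsub>comodule_End A C M \<rho>\<^esub> = (\<lambda>m\<in>carrier M. \<zero>\<^bsub>M\<^esub>)"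
  "add (comodule_End A C M \<rho>) = (\<lambda>f g. \<lambda>m\<in>carrier M. f m \<oplus>\<^bsub>M\<^esub> g m)"
  "smult (comodule_End A C M \<rho>) = (\<lambda>c f. \<lambda>m\<in>carrier M. c \<odot>\<^bsub>M\<^esub> f m)"
  by (simp_all add: comodule_End_def)

text \<open>\<open>eval_bimodule M\<close> differs from M in its left action, and the relators of a
  tensor product with M as left factor mention only the right action of M.\<close>

lemma tensor_group_eval [simp]:
  "tensor_group S (eval_bimodule M) C = tensor_group S M C" "tens S (eval_bimodule M) C = tens S M C"
proof -
  have "tensor_pairs (eval_bimodule M) C = tensor_pairs M C" by (simp add: tensor_pairs_def)
  moreover have "tensor_kernel S (eval_bimodule M) C = tensor_kernel S M C"
    by (simp add: tensor_kernel_def tensor_relators_def calculation)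
  ultimately show "tensor_group S (eval_bimodule M) C = tensor_group S M C" "tens S (eval_bimodule M) C = tens S M C"
    by (simp_all add: tensor_group_def tens_def tensor_class_def fun_eq_iff)
qed

section \<open>Groups of comodule maps\<close>

text \<open>Supplies the closure conditions of \<open>abelian_group_maps\<close> for colinear maps.
  The reason is that f \<otimes> id depends additively on f; \<open>rY\<close> must be additive
  because it is applied to f x - g x.\<close>

lemma right_comodule_hom_zero_minus:
  fixes C :: "('a, 'a, 'c) bimodule" and X :: "('r, 'a, 'x) bimodule" and Y :: "('t, 'a, 'y) bimodule"
  assumes X: "right_module A X" and Y: "right_module A Y" and C: "left_module A C"
    and rX: "\<And>x. x \<in> carrier X \<Longrightarrow> rX x \<in> carrier (tensor_group A X C)"
    and rY: "additive_on Y (tensor_group A Y C) rY"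
  shows "(\<lambda>x\<in>carrier X. \<zero>\<^bsub>Y\<^esub>) \<in> right_comodule_hom A C X rX Y rY"
    and "\<lbrakk>f \<in> right_comodule_hom A C X rX Y rY; g \<in> right_comodule_hom A C X rX Y rY\<rbrakk> \<Longrightarrow>
      (\<lambda>x\<in>carrier X. f x \<ominus>\<^bsub>Y\<^esub> g x) \<in> right_comodule_hom A C X rX Y rY"
proof -
  interpret Y: right_module A Y by (rule Y)
  let ?T = "tensor_group A Y C"
  have T: "abelian_group ?T" by (rule tensor_group_abelian[OF Y C])
  have Yag: "abelian_group Y" by unfold_locales
  have ract: "additive_on Y Y (\<lambda>y. y \<triangleleft>\<^bsub>Y\<^esub> a)" if "a \<in> carrier A" for a
    using that by (intro additive_onI) (simp_all add: Y.ract_closed Y.ract_add_left)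
  have zero: "(\<lambda>x\<in>carrier X. \<zero>\<^bsub>Y\<^esub>) \<in> right_hom A X Y"
    using additive_on_zero_eq[OF Yag Yag ract] by (intro restrict_right_hom[OF X additive_on_zero[OF Yag]]) simp
  note Z = tensor_map_id_right[OF X Y C zero]
  have "tensor_map A X C Y C (\<lambda>x\<in>carrier X. \<zero>\<^bsub>Y\<^esub>) (\<lambda>c. c) u = \<zero>\<^bsub>?T\<^esub>" if u: "u \<in> carrier (tensor_group A X C)" for u
    by (rule tensor_eqI[OF X C T additive_maps_additive_on[OF Z(1)] additive_on_zero[OF T] _ u])
      (simp add: Z(2) additive_on_zero_eq[OF Yag T tens_additive_left[OF Y C]])
  then show "(\<lambda>x\<in>carrier X. \<zero>\<^bsub>Y\<^esub>) \<in> right_comodule_hom A C X rX Y rY"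
    using zero rX additive_on_zero_eq[OF Yag T rY] by (simp add: right_comodule_hom_def)
  assume f: "f \<in> right_comodule_hom A C X rX Y rY" and g: "g \<in> right_comodule_hom A C X rX Y rY"
  then have f': "f \<in> right_hom A X Y" and g': "g \<in> right_hom A X Y" by (simp_all add: right_comodule_hom_def)
  let ?h = "\<lambda>x\<in>carrier X. f x \<ominus>\<^bsub>Y\<^esub> g x"
  have h: "?h \<in> right_hom A X Y"
    by (rule restrict_right_hom[OF X additive_on_minus[OF Yag right_hom_additive_on[OF f'] right_hom_additive_on[OF g']]])
      (simp add: right_homD[OF f'] right_homD[OF g'] additive_on_minus_eq[OF Yag Yag ract])
  note F = tensor_map_id_right[OF X Y C f'] and G = tensor_map_id_right[OF X Y C g'] and H = tensor_map_id_right[OF X Y C h]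
  have "tensor_map A X C Y C ?h (\<lambda>c. c) u
      = tensor_map A X C Y C f (\<lambda>c. c) u \<ominus>\<^bsub>?T\<^esub> tensor_map A X C Y C g (\<lambda>c. c) u"
    if u: "u \<in> carrier (tensor_group A X C)" for u
    by (rule tensor_eqI[OF X C T additive_maps_additive_on[OF H(1)]
          additive_on_minus[OF T additive_maps_additive_on[OF F(1)] additive_maps_additive_on[OF G(1)]] _ u])
      (simp add: F(2) G(2) H(2) right_homD[OF f'] right_homD[OF g'] additive_on_minus_eq[OF Yag T tens_additive_left[OF Y C]])
  then show "?h \<in> right_comodule_hom A C X rX Y rY"
    using h f g rX by (simp add: right_comodule_hom_def right_homD(2)[OF f'] right_homD(2)[OF g'] additive_on_minus_eq[OF Yag T rY])
qed

lemma left_comodule_hom_zero_minus: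
  fixes C :: "('a, 'a, 'c) bimodule" and X :: "('a, 'r, 'x) bimodule" and Y :: "('a, 't, 'y) bimodule"
  assumes C: "right_module A C" and X: "left_module A X" and Y: "left_module A Y"
    and lX: "\<And>x. x \<in> carrier X \<Longrightarrow> lX x \<in> carrier (tensor_group A C X)"
    and lY: "additive_on Y (tensor_group A C Y) lY"
  shows "(\<lambda>x\<in>carrier X. \<zero>\<^bsub>Y\<^esub>) \<in> left_comodule_hom A C X lX Y lY"
    and "\<lbrakk>f \<in> left_comodule_hom A C X lX Y lY; g \<in> left_comodule_hom A C X lX Y lY\<rbrakk> \<Longrightarrow>
      (\<lambda>x\<in>carrier X. f x \<ominus>\<^bsub>Y\<^esub> g x) \<in> left_comodule_hom A C X lX Y lY"
proof -
  interpret Y: left_module A Y by (rule Y)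
  let ?T = "tensor_group A C Y"
  have T: "abelian_group ?T" by (rule tensor_group_abelian[OF C Y])
  have Yag: "abelian_group Y" by unfold_locales
  have lact: "additive_on Y Y (\<lambda>y. a \<odot>\<^bsub>Y\<^esub> y)" if "a \<in> carrier A" for a
    using that by (intro additive_onI) (simp_all add: Y.lact_closed Y.lact_add_right)
  have zero: "(\<lambda>x\<in>carrier X. \<zero>\<^bsub>Y\<^esub>) \<in> left_hom A X Y"
    using additive_on_zero_eq[OF Yag Yag lact] by (intro restrict_left_hom[OF X additive_on_zero[OF Yag]]) simp
  note Z = tensor_map_id_left[OF C X Y zero]
  have "tensor_map A C X C Y (\<lambda>c. c) (\<lambda>x\<in>carrier X. \<zero>\<^bsub>Y\<^esub>) u = \<zero>\<^bsub>?T\<^esub>" if u: "u \<in> carrier (tensor_group A C X)" for u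
    by (rule tensor_eqI[OF C X T Z(1) additive_on_zero[OF T] _ u])
      (simp add: Z(2) additive_on_zero_eq[OF Yag T tens_additive_right[OF C Y]])
  then show "(\<lambda>x\<in>carrier X. \<zero>\<^bsub>Y\<^esub>) \<in> left_comodule_hom A C X lX Y lY"
    using zero lX additive_on_zero_eq[OF Yag T lY] by (simp add: left_comodule_hom_def)
  assume f: "f \<in> left_comodule_hom A C X lX Y lY" and g: "g \<in> left_comodule_hom A C X lX Y lY"
  then have f': "f \<in> left_hom A X Y" and g': "g \<in> left_hom A X Y" by (simp_all add: left_comodule_hom_def)
  let ?h = "\<lambda>x\<in>carrier X. f x \<ominus>\<^bsub>Y\<^esub> g x"
  have h: "?h \<in> left_hom A X Y"
    by (rule restrict_left_hom[OF X additive_on_minus[OF Yag left_homD(2)[OF f'] left_homD(2)[OF g']]])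
      (simp add: left_homD[OF f'] left_homD[OF g'] additive_on_minus_eq[OF Yag Yag lact])
  note F = tensor_map_id_left[OF C X Y f'] and G = tensor_map_id_left[OF C X Y g'] and H = tensor_map_id_left[OF C X Y h]
  have "tensor_map A C X C Y (\<lambda>c. c) ?h u
      = tensor_map A C X C Y (\<lambda>c. c) f u \<ominus>\<^bsub>?T\<^esub> tensor_map A C X C Y (\<lambda>c. c) g u"
    if u: "u \<in> carrier (tensor_group A C X)" for u
    by (rule tensor_eqI[OF C X T H(1) additive_on_minus[OF T F(1) G(1)] _ u])
      (simp add: F(2) G(2) H(2) left_homD[OF f'] left_homD[OF g'] additive_on_minus_eq[OF Yag T tens_additive_right[OF C Y]])
  then show "?h \<in> left_comodule_hom A C X lX Y lY"
    using h f g lX by (simp add: left_comodule_hom_def left_homD(3)[OF f'] left_homD(3)[OF g'] additive_on_minus_eq[OF Yag T lY])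
qed

lemma left_comodule_hom_compose:
  fixes C :: "('a, 'a, 'c) bimodule"
  assumes C: "right_module A C" and X: "left_module A X" and Y: "left_module A Y" and Z: "left_module A Z"
    and lX: "\<And>x. x \<in> carrier X \<Longrightarrow> lX x \<in> carrier (tensor_group A C X)"
    and f: "f \<in> left_comodule_hom A C X lX Y lY" and g: "g \<in> left_comodule_hom A C Y lY Z lZ"
  shows "(\<lambda>x\<in>carrier X. g (f x)) \<in> left_comodule_hom A C X lX Z lZ"
proof -
  have f': "f \<in> left_hom A X Y" and g': "g \<in> left_hom A Y Z"
    using f g by (simp_all add: left_comodule_hom_def)
  have "(\<lambda>x\<in>carrier X. g (f x)) \<in> left_hom A X Z"
    by (rule restrict_left_hom[OF X additive_on_compose[OF left_homD(2)[OF f'] left_homD(2)[OF g']]])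
      (simp add: left_homD[OF f'] left_homD[OF g'])
  then show ?thesis
    using f g lX by (simp add: left_comodule_hom_def left_homD(3)[OF f'] tensor_map_comp_left[OF C X Y Z f' g'])
qed

lemma left_comodule_homD:
  assumes "f \<in> left_comodule_hom A C X lX Y lY"
  shows "f \<in> left_hom A X Y" "x \<in> carrier X \<Longrightarrow> lY (f x) = tensor_map A C X C Y (\<lambda>c. c) f (lX x)"
  using assms by (simp_all add: left_comodule_hom_def)

text \<open>Precomposition turns a left action into a right one: (f s) t and f (s t) both send x to
  f (s (t x)). Used for K acting on the dual of M and for B acting on Hom(M, C).\<close>

lemma right_module_right_hom_bimodule:
  assumes X: "left_module S X" and ab: "abelian_group (right_hom_bimodule H X Y)"
    and add: "\<And>f. f \<in> H \<Longrightarrow> f \<in> additive_maps X Y"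
    and closed: "\<And>f s. \<lbrakk>f \<in> H; s \<in> carrier S\<rbrakk> \<Longrightarrow> (\<lambda>x\<in>carrier X. f (s \<odot>\<^bsub>X\<^esub> x)) \<in> H"
  shows "right_module S (right_hom_bimodule H X Y)"
proof -
  interpret X: left_module S X by (rule X)
  interpret G: abelian_group "right_hom_bimodule H X Y" by (rule ab)
  note addD = additive_mapsD[OF add]
  show ?thesis
  proof (unfold_locales, unfold right_hom_bimodule_simps)
    fix f s t assume f: "f \<in> H" and s: "s \<in> carrier S" and t: "t \<in> carrier S"
    show "(\<lambda>x\<in>carrier X. f ((s \<otimes>\<^bsub>S\<^esub> t) \<odot>\<^bsub>X\<^esub> x))
        = (\<lambda>x\<in>carrier X. (\<lambda>x\<in>carrier X. f (s \<odot>\<^bsub>X\<^esub> x)) (t \<odot>\<^bsub>X\<^esub> x))"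
      by (rule restrict_ext) (simp add: X.lact_mult X.lact_closed s t)
    show "(\<lambda>x\<in>carrier X. f ((s \<oplus>\<^bsub>S\<^esub> t) \<odot>\<^bsub>X\<^esub> x))
        = (\<lambda>x\<in>carrier X. (\<lambda>x\<in>carrier X. f (s \<odot>\<^bsub>X\<^esub> x)) x \<oplus>\<^bsub>Y\<^esub> (\<lambda>x\<in>carrier X. f (t \<odot>\<^bsub>X\<^esub> x)) x)"
      by (rule restrict_ext) (simp add: X.lact_add_left X.lact_closed addD[OF f] s t)
  next
    fix f assume f: "f \<in> H"
    show "(\<lambda>x\<in>carrier X. f (\<one>\<^bsub>S\<^esub> \<odot>\<^bsub>X\<^esub> x)) = f"
      by (rule extensionalityI[where A = "carrier X"]) (simp_all add: X.lact_one addD[OF f])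
  next
    fix f g s assume "f \<in> H" "g \<in> H" and s: "s \<in> carrier S"
    show "(\<lambda>x\<in>carrier X. (\<lambda>x\<in>carrier X. f x \<oplus>\<^bsub>Y\<^esub> g x) (s \<odot>\<^bsub>X\<^esub> x))
        = (\<lambda>x\<in>carrier X. (\<lambda>x\<in>carrier X. f (s \<odot>\<^bsub>X\<^esub> x)) x \<oplus>\<^bsub>Y\<^esub> (\<lambda>x\<in>carrier X. g (s \<odot>\<^bsub>X\<^esub> x)) x)"
      by (rule restrict_ext) (simp add: X.lact_closed s)
  qed (rule closed)
qed

section \<open>Matrix coefficients and the dual comodule\<close>

text \<open>\<open>dual_coaction\<close> selects a dual basis by \<open>SOME\<close>. The locale
  fixes a basis together with the formula for the coaction in that same basis, so the choice never
  has to be compared with another one.\<close>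

locale comodule_with_dual_basis =
  fixes K :: "('k, 'w) ring_scheme" and A :: "('k, 'a) module" and C :: "('a, 'a, 'c) bimodule"
    and \<Delta> :: "'c \<Rightarrow> ('c, 'c) tensor" and \<epsilon> :: "'c \<Rightarrow> 'a"
    and M :: "('k, 'a, 'm) bimodule" and \<rho> :: "'m \<Rightarrow> ('m, 'c) tensor"
    and n :: nat and e :: "nat \<Rightarrow> 'm" and x :: "nat \<Rightarrow> 'm \<Rightarrow> 'a"
  assumes comodule: "right_comodule K A C \<Delta> \<epsilon> M \<rho>"
    and basis: "dual_basis A M n e x"
    and dual_coaction: "dual_coaction A C M \<rho> = (\<lambda>\<xi>\<in>carrier (dual A M).
      \<Oplus>\<^bsub>tensor A C (dual A M)\<^esub>i\<in>{..<n}. tens A C (dual A M) (coefficient A C M \<rho> \<xi> (e i)) (x i))"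
begin

abbreviation "D \<equiv> dual A M"
abbreviation "B \<equiv> comodule_End A C M \<rho>"
abbreviation "N \<equiv> eval_bimodule M"
abbreviation "H \<equiv> comodule_Hom_coring A C \<Delta> M \<rho>"
abbreviation "coef \<equiv> coefficient A C M \<rho>"
abbreviation "DM \<equiv> tensor K D M"
abbreviation "DM_coaction \<equiv> tensor_left_coaction A K C D (dual_coaction A C M \<rho>) M"

end

sublocale comodule_with_dual_basis \<subseteq> C: bimodule_over K A C
  using comodule by (simp add: right_comodule_def coring_def)

sublocale comodule_with_dual_basis \<subseteq> M: right_module_over K A M
  using comodule by (simp add: right_comodule_def)

context comodule_with_dual_basis
begin

lemma coring: "coring K A C \<Delta> \<epsilon>"
  using comodule by (simp add: right_comodule_def)

lemma groups: "abelian_group A" "abelian_group C" "abelian_group M"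
  by unfold_locales

lemma modules: "left_module A C" "right_module A C" "right_module A M"
  by unfold_locales

lemma coaction: "additive_on M (tensor_group A M C) \<rho>"
  "\<lbrakk>m \<in> carrier M; a \<in> carrier A\<rbrakk> \<Longrightarrow> \<rho> (m \<triangleleft>\<^bsub>M\<^esub> a) = \<rho> m \<triangleleft>\<^bsub>tensor A M C\<^esub> a"
  using right_comodule.coact_right[OF comodule] right_homD[of \<rho> A M "tensor A M C"]
  by (auto simp: additive_on_def)

lemma comult: "additive_on C (tensor_group A C C) \<Delta>"
  using right_hom_additive_on[OF coring.comult_right[OF coring]] by simp

lemma counit: "additive_on C A \<epsilon>"
  "\<lbrakk>a \<in> carrier A; c \<in> carrier C\<rbrakk> \<Longrightarrow> \<epsilon> (a \<odot>\<^bsub>C\<^esub> c) = a \<otimes>\<^bsub>A\<^esub> \<epsilon> c"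
  "\<lbrakk>a \<in> carrier A; c \<in> carrier C\<rbrakk> \<Longrightarrow> \<epsilon> (c \<triangleleft>\<^bsub>C\<^esub> a) = \<epsilon> c \<otimes>\<^bsub>A\<^esub> a"
  using left_homD[OF coring.counit_left[OF coring]] right_homD[OF coring.counit_right[OF coring]]
  by (simp_all add: additive_on_def)

section \<open>The actions of K and A on M, on its dual \<open>D\<close> and on \<open>D\<close>
  \<otimes> M\<close>

lemma scalar_closed: "k \<in> carrier K \<Longrightarrow> k \<odot>\<^bsub>A\<^esub> \<one>\<^bsub>A\<^esub> \<in> carrier A"
  by simp

lemma scalar_central:
  "\<lbrakk>k \<in> carrier K; a \<in> carrier A\<rbrakk> \<Longrightarrow> a \<otimes>\<^bsub>A\<^esub> (k \<odot>\<^bsub>A\<^esub> \<one>\<^bsub>A\<^esub>) = (k \<odot>\<^bsub>A\<^esub> \<one>\<^bsub>A\<^esub>) \<otimes>\<^bsub>A\<^esub> a"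
  by (simp add: C.smult_mult_left C.smult_mult_right)

lemma k_action_closed: "\<lbrakk>k \<in> carrier K; m \<in> carrier M\<rbrakk> \<Longrightarrow> k \<odot>\<^bsub>M\<^esub> m \<in> carrier M"
  by (simp add: M.k_action M.ract_closed)

lemma k_action_ract:
  assumes "k \<in> carrier K" "m \<in> carrier M" "a \<in> carrier A"
  shows "k \<odot>\<^bsub>M\<^esub> (m \<triangleleft>\<^bsub>M\<^esub> a) = (k \<odot>\<^bsub>M\<^esub> m) \<triangleleft>\<^bsub>M\<^esub> a"
  using assms scalar_central[of k a] by (simp add: M.k_action M.ract_closed M.ract_mult[symmetric])

lemma left_module_KM: "left_module K M"
proof (unfold_locales)
  fix k l m assume klm: "k \<in> carrier K" "l \<in> carrier K" "m \<in> carrier M"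
  show "(k \<oplus>\<^bsub>K\<^esub> l) \<odot>\<^bsub>M\<^esub> m = k \<odot>\<^bsub>M\<^esub> m \<oplus>\<^bsub>M\<^esub> l \<odot>\<^bsub>M\<^esub> m"
    using klm by (simp add: M.k_action C.smult_l_distr M.ract_add_right)
  \<comment> \<open>K acts on M through the right action of A, which reverses the order of two
    scalars; commutativity of K restores it.\<close>
  have "(k \<otimes>\<^bsub>K\<^esub> l) \<odot>\<^bsub>A\<^esub> \<one>\<^bsub>A\<^esub> = (l \<odot>\<^bsub>A\<^esub> \<one>\<^bsub>A\<^esub>) \<otimes>\<^bsub>A\<^esub> (k \<odot>\<^bsub>A\<^esub> \<one>\<^bsub>A\<^esub>)"
    using klm by (subst C.R.m_comm) (simp_all add: C.smult_mult_left C.smult_assoc1)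
  then show "(k \<otimes>\<^bsub>K\<^esub> l) \<odot>\<^bsub>M\<^esub> m = k \<odot>\<^bsub>M\<^esub> (l \<odot>\<^bsub>M\<^esub> m)"
    using klm by (simp add: M.k_action M.ract_mult M.ract_closed)
qed (simp_all add: M.k_action M.ract_closed M.ract_add_left C.smult_one M.ract_one)

lemma carrier_dual: "carrier D = right_hom A M (regular A)"
  by (simp add: dual_def)

lemma dual_simps [simp]:
  "\<zero>\<^bsub>D\<^esub> = (\<lambda>m\<in>carrier M. \<zero>\<^bsub>A\<^esub>)" "add D = (\<lambda>\<xi> \<eta>. \<lambda>m\<in>carrier M. \<xi> m \<oplus>\<^bsub>A\<^esub> \<eta> m)"
  "smult D = (\<lambda>a \<xi>. \<lambda>m\<in>carrier M. a \<otimes>\<^bsub>A\<^esub> \<xi> m)" "rsmult D = (\<lambda>\<xi> k. \<lambda>m\<in>carrier M. \<xi> (k \<odot>\<^bsub>M\<^esub> m))"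
  by (simp_all add: dual_def)

lemma dualD:
  assumes "\<xi> \<in> carrier D"
  shows "\<xi> \<in> additive_maps M A" "additive_on M A \<xi>" "\<And>m. m \<in> carrier M \<Longrightarrow> \<xi> m \<in> carrier A"
    "\<And>m m'. \<lbrakk>m \<in> carrier M; m' \<in> carrier M\<rbrakk> \<Longrightarrow> \<xi> (m \<oplus>\<^bsub>M\<^esub> m') = \<xi> m \<oplus>\<^bsub>A\<^esub> \<xi> m'"
    "\<And>m a. \<lbrakk>m \<in> carrier M; a \<in> carrier A\<rbrakk> \<Longrightarrow> \<xi> (m \<triangleleft>\<^bsub>M\<^esub> a) = \<xi> m \<otimes>\<^bsub>A\<^esub> a"
  using assms right_homD[of \<xi> A M "regular A"]
  by (auto simp: carrier_dual additive_maps_def additive_on_def)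

lemma restrict_dual:
  assumes "additive_on M A f" "\<And>m a. \<lbrakk>m \<in> carrier M; a \<in> carrier A\<rbrakk> \<Longrightarrow> f (m \<triangleleft>\<^bsub>M\<^esub> a) = f m \<otimes>\<^bsub>A\<^esub> a"
  shows "(\<lambda>m\<in>carrier M. f m) \<in> carrier D"
  unfolding carrier_dual using assms by (intro restrict_right_hom modules) (simp_all add: additive_on_def)

lemma abelian_group_dual: "abelian_group D"
proof (rule abelian_group_maps[where Y = A and I = "carrier M"])
  show "abelian_group A" by (rule groups)
  show "carrier D \<subseteq> carrier M \<rightarrow>\<^sub>E carrier A" using dualD(1) by (auto simp: additive_maps_def)
  show "(\<lambda>m\<in>carrier M. \<zero>\<^bsub>A\<^esub>) \<in> carrier D"
    by (rule restrict_dual[OF additive_on_zero[OF groups(1)]]) simp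
  show "(\<lambda>m\<in>carrier M. \<xi> m \<ominus>\<^bsub>A\<^esub> \<eta> m) \<in> carrier D" if "\<xi> \<in> carrier D" "\<eta> \<in> carrier D" for \<xi> \<eta>
    using that by (intro restrict_dual[OF additive_on_minus[OF groups(1) dualD(2) dualD(2)]])
      (simp_all add: dualD a_minus_def C.A.l_distr C.A.l_minus)
qed simp_all

lemma left_module_dual: "left_module A D"
proof -
  interpret D: abelian_group D by (rule abelian_group_dual)
  show ?thesis
  proof (unfold_locales, unfold dual_simps)
    fix a \<xi> assume a: "a \<in> carrier A" and \<xi>: "\<xi> \<in> carrier D"
    show "(\<lambda>m\<in>carrier M. a \<otimes>\<^bsub>A\<^esub> \<xi> m) \<in> carrier D"
      by (intro restrict_dual additive_onI) (simp_all add: a dualD[OF \<xi>] C.A.r_distr C.A.m_assoc)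
    fix b assume b: "b \<in> carrier A"
    show "(\<lambda>m\<in>carrier M. (a \<oplus>\<^bsub>A\<^esub> b) \<otimes>\<^bsub>A\<^esub> \<xi> m)
        = (\<lambda>m\<in>carrier M. (\<lambda>m\<in>carrier M. a \<otimes>\<^bsub>A\<^esub> \<xi> m) m \<oplus>\<^bsub>A\<^esub> (\<lambda>m\<in>carrier M. b \<otimes>\<^bsub>A\<^esub> \<xi> m) m)"
      by (rule restrict_ext) (simp add: a b dualD[OF \<xi>] C.A.l_distr)
    show "(\<lambda>m\<in>carrier M. a \<otimes>\<^bsub>A\<^esub> b \<otimes>\<^bsub>A\<^esub> \<xi> m)
        = (\<lambda>m\<in>carrier M. a \<otimes>\<^bsub>A\<^esub> (\<lambda>m\<in>carrier M. b \<otimes>\<^bsub>A\<^esub> \<xi> m) m)"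
      by (rule restrict_ext) (simp add: a b dualD[OF \<xi>] C.A.m_assoc)
  next
    fix a \<xi> \<eta> assume "a \<in> carrier A" "\<xi> \<in> carrier D" "\<eta> \<in> carrier D"
    then show "(\<lambda>m\<in>carrier M. a \<otimes>\<^bsub>A\<^esub> (\<lambda>m\<in>carrier M. \<xi> m \<oplus>\<^bsub>A\<^esub> \<eta> m) m)
        = (\<lambda>m\<in>carrier M. (\<lambda>m\<in>carrier M. a \<otimes>\<^bsub>A\<^esub> \<xi> m) m \<oplus>\<^bsub>A\<^esub> (\<lambda>m\<in>carrier M. a \<otimes>\<^bsub>A\<^esub> \<eta> m) m)"
      by (intro restrict_ext) (simp add: dualD C.A.r_distr)
  next
    fix \<xi> assume \<xi>: "\<xi> \<in> carrier D"
    show "(\<lambda>m\<in>carrier M. \<one>\<^bsub>A\<^esub> \<otimes>\<^bsub>A\<^esub> \<xi> m) = \<xi>"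
      by (rule extensionalityI[where A = "carrier M"]) (simp_all add: dualD[OF \<xi>] additive_mapsD[OF dualD(1)[OF \<xi>]])
  qed
qed

lemma right_module_dual: "right_module K D"
  unfolding dual_def
proof (rule right_module_right_hom_bimodule[OF left_module_KM abelian_group_dual[unfolded dual_def]])
  fix \<xi> k assume "\<xi> \<in> right_hom A M (regular A)" and k: "k \<in> carrier K"
  then have \<xi>: "\<xi> \<in> carrier D" by (simp add: carrier_dual)
  interpret M: left_module K M by (rule left_module_KM)
  show "(\<lambda>m\<in>carrier M. \<xi> (k \<odot>\<^bsub>M\<^esub> m)) \<in> right_hom A M (regular A)"
    unfolding carrier_dual[symmetric] using k
    by (intro restrict_dual additive_onI) (simp_all add: dualD[OF \<xi>] M.lact_closed M.lact_add_right k_action_ract)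
qed (rule right_homD(1))

lemma dual_actions_commute:
  assumes "a \<in> carrier A" "\<xi> \<in> carrier D" "k \<in> carrier K"
  shows "a \<odot>\<^bsub>D\<^esub> (\<xi> \<triangleleft>\<^bsub>D\<^esub> k) = (a \<odot>\<^bsub>D\<^esub> \<xi>) \<triangleleft>\<^bsub>D\<^esub> k"
  unfolding dual_simps by (rule restrict_ext) (simp add: k_action_closed assms)

lemma left_module_DM: "left_module A DM"
  and lact_DM: "\<lbrakk>a \<in> carrier A; \<xi> \<in> carrier D; m \<in> carrier M\<rbrakk> \<Longrightarrow>
    a \<odot>\<^bsub>DM\<^esub> tens K D M \<xi> m = tens K D M (a \<odot>\<^bsub>D\<^esub> \<xi>) m"
  using tensor_left_module[OF right_module_dual left_module_dual left_module_KM dual_actions_commute] by simp_all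

section \<open>Matrix coefficients c(\<xi>, m)\<close>

lemma coefficient_balanced:
  assumes \<xi>: "\<xi> \<in> carrier D"
  shows "balanced_map A M C C (\<lambda>m c. \<xi> m \<odot>\<^bsub>C\<^esub> c)"
  by (intro balanced_mapI additive_onI)
    (simp_all add: dualD[OF \<xi>] C.lact_closed C.lact_add_left C.lact_add_right C.lact_mult)

lemmas coefficient_lift = tensor_lift_balanced[OF modules(3,1) groups(2) coefficient_balanced]

lemma coef_additive_right: "\<xi> \<in> carrier D \<Longrightarrow> additive_on M C (coef \<xi>)"
  unfolding coefficient_def by (rule additive_on_compose[OF coaction(1) coefficient_lift(2)])

lemma coef_closed: "\<lbrakk>\<xi> \<in> carrier D; m \<in> carrier M\<rbrakk> \<Longrightarrow> coef \<xi> m \<in> carrier C"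
  using additive_onD(1)[OF coef_additive_right] by simp

text \<open>\<open>coef \<xi> m\<close> is a lift evaluated at \<open>\<rho> m\<close>, and nothing
  is known about the shape of \<open>\<rho> m\<close>. The identity is therefore proved for every
  element of M \<otimes> C in its place, on elementary tensors; \<open>coef_lact\<close>,
  \<open>coef_ract\<close>, \<open>counit_coef\<close> and \<open>coef_End\<close> use the same
  replacement.\<close>

lemma coef_additive_left:
  assumes m: "m \<in> carrier M"
  shows "additive_on D C (\<lambda>\<xi>. coef \<xi> m)"
proof (rule additive_onI)
  fix \<xi> \<eta> assume \<xi>: "\<xi> \<in> carrier D" and \<eta>: "\<eta> \<in> carrier D"
  interpret D: left_module A D by (rule left_module_dual)
  have \<xi>\<eta>: "\<xi> \<oplus>\<^bsub>D\<^esub> \<eta> \<in> carrier D" using \<xi> \<eta> by (rule D.X.a_closed)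
  \<comment> \<open>Each instance contributes three facts, so \<open>L(2)\<close>,
    \<open>L(5)\<close> and \<open>L(8)\<close> are the additivity statements for the sum, for \<xi>
    and for \<eta>.\<close>
  note L = coefficient_lift[OF \<xi>\<eta>] coefficient_lift[OF \<xi>] coefficient_lift[OF \<eta>]
  show "coef (\<xi> \<oplus>\<^bsub>D\<^esub> \<eta>) m = coef \<xi> m \<oplus>\<^bsub>C\<^esub> coef \<eta> m"
    unfolding coefficient_def
    by (rule tensor_eqI[OF modules(3,1) groups(2) L(2) additive_on_add[OF groups(2) L(5,8)] _ additive_onD(1)[OF coaction(1) m]])
      (subst L, simp_all, subst L, simp_all, subst L, simp_all add: C.lact_add_left dualD[OF \<xi>] dualD[OF \<eta>])
qed (simp add: coef_closed m)

lemma coef_lact: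
  assumes a: "a \<in> carrier A" and \<xi>: "\<xi> \<in> carrier D" and m: "m \<in> carrier M"
  shows "coef (a \<odot>\<^bsub>D\<^esub> \<xi>) m = a \<odot>\<^bsub>C\<^esub> coef \<xi> m"
proof -
  interpret D: left_module A D by (rule left_module_dual)
  have a\<xi>: "a \<odot>\<^bsub>D\<^esub> \<xi> \<in> carrier D" using a \<xi> by (rule D.lact_closed)
  have act: "additive_on C C (\<lambda>c. a \<odot>\<^bsub>C\<^esub> c)"
    using a by (intro additive_onI) (simp_all add: C.lact_closed C.lact_add_right)
  show ?thesis
    unfolding coefficient_def
    by (rule tensor_eqI[OF modules(3,1) groups(2) coefficient_lift(2)[OF a\<xi>]
          additive_on_compose[OF coefficient_lift(2)[OF \<xi>] act] _ additive_onD(1)[OF coaction(1) m]])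
      (subst coefficient_lift(3)[OF a\<xi>], simp_all add: coefficient_lift(3)[OF \<xi>] C.lact_mult dualD[OF \<xi>] a)
qed

lemma ract_MC:
  "a \<in> carrier A \<Longrightarrow> additive_on (tensor_group A M C) (tensor_group A M C) (\<lambda>u. u \<triangleleft>\<^bsub>tensor A M C\<^esub> a)"
  "\<lbrakk>a \<in> carrier A; m \<in> carrier M; c \<in> carrier C\<rbrakk> \<Longrightarrow>
    tens A M C m c \<triangleleft>\<^bsub>tensor A M C\<^esub> a = tens A M C m (c \<triangleleft>\<^bsub>C\<^esub> a)"
  using tensor_right_module[OF modules(3,1,2)] C.lact_ract by simp_all

lemma coef_ract:
  assumes a: "a \<in> carrier A" and \<xi>: "\<xi> \<in> carrier D" and m: "m \<in> carrier M"
  shows "coef \<xi> (m \<triangleleft>\<^bsub>M\<^esub> a) = coef \<xi> m \<triangleleft>\<^bsub>C\<^esub> a"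
proof -
  have act: "additive_on C C (\<lambda>c. c \<triangleleft>\<^bsub>C\<^esub> a)"
    using a by (intro additive_onI) (simp_all add: C.ract_closed C.ract_add_left)
  show ?thesis
    unfolding coefficient_def coaction(2)[OF m a]
    by (rule tensor_eqI[OF modules(3,1) groups(2) additive_on_compose[OF ract_MC(1)[OF a] coefficient_lift(2)[OF \<xi>]]
          additive_on_compose[OF coefficient_lift(2)[OF \<xi>] act] _ additive_onD(1)[OF coaction(1) m]])
      (simp add: ract_MC a coefficient_lift(3)[OF \<xi>] C.ract_closed C.lact_ract dualD[OF \<xi>])
qed

text \<open>On n \<otimes> c, left linearity of \<epsilon> and right linearity of \<xi> give
  \<epsilon>(\<xi>(n) c) = \<xi>(n) \<epsilon>(c) = \<xi>(n \<epsilon>(c)); the counit law of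
  \<open>\<rho>\<close> evaluates the last expression at \<open>\<rho> m\<close>.\<close>

lemma counit_coef:
  assumes \<xi>: "\<xi> \<in> carrier D" and m: "m \<in> carrier M"
  shows "\<epsilon> (coef \<xi> m) = \<xi> m"
proof -
  have bal: "balanced_map A M C M (\<lambda>m c. m \<triangleleft>\<^bsub>M\<^esub> \<epsilon> c)"
    by (intro balanced_mapI additive_onI)
      (simp_all add: additive_onD[OF counit(1)] counit M.ract_closed M.ract_add_left M.ract_add_right M.ract_mult)
  note L = tensor_lift_balanced[OF modules(3,1) groups(3) bal]
  have "\<epsilon> (coef \<xi> m) = \<xi> (tensor_lift A M C M (\<lambda>m c. m \<triangleleft>\<^bsub>M\<^esub> \<epsilon> c) (\<rho> m))"
    unfolding coefficient_def
    by (rule tensor_eqI[OF modules(3,1) groups(1) additive_on_compose[OF coefficient_lift(2)[OF \<xi>] counit(1)]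
          additive_on_compose[OF L(2) dualD(2)[OF \<xi>]] _ additive_onD(1)[OF coaction(1) m]])
      (simp add: coefficient_lift(3)[OF \<xi>] L counit dualD[OF \<xi>] additive_onD[OF counit(1)])
  then show ?thesis using right_comodule.coact_counital[OF comodule m] by simp
qed

lemma EndD:
  assumes "b \<in> carrier B"
  shows "b \<in> right_hom A M M" "additive_on M M b" "\<And>m. m \<in> carrier M \<Longrightarrow> b m \<in> carrier M"
    "\<And>m a. \<lbrakk>m \<in> carrier M; a \<in> carrier A\<rbrakk> \<Longrightarrow> b (m \<triangleleft>\<^bsub>M\<^esub> a) = b m \<triangleleft>\<^bsub>M\<^esub> a"
    "\<And>m. m \<in> carrier M \<Longrightarrow> \<rho> (b m) = tensor_map A M C M C b (\<lambda>c. c) (\<rho> m)"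
  using assms right_homD[of b A M M] right_hom_additive_on[of b A M M] by (auto simp: right_comodule_hom_def)

lemma compose_dual:
  assumes "\<xi> \<in> carrier D" "b \<in> carrier B"
  shows "compose (carrier M) \<xi> b \<in> carrier D"
  unfolding compose_def
  by (rule restrict_dual[OF additive_on_compose[OF EndD(2) dualD(2)]]) (simp_all add: assms EndD[OF assms(2)] dualD[OF assms(1)] del: comodule_End_simps)

text \<open>This is colinearity of b, \<open>\<rho> (b m)\<close> = (b \<otimes> id)
  \<open>\<rho> m\<close>, tested with \<xi>. It lets elements of B pass between the two arguments
  of c, which is the source of every compatibility with B and, through \<open>scalar_End\<close>,
  with K.\<close>

lemma coef_End:
  assumes \<xi>: "\<xi> \<in> carrier D" and b: "b \<in> carrier B" and m: "m \<in> carrier M"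
  shows "coef (compose (carrier M) \<xi> b) m = coef \<xi> (b m)"
proof -
  note \<xi>b = compose_dual[OF \<xi> b] and T = tensor_map_id_right[OF modules(3,3,1) EndD(1)[OF b]]
  show ?thesis
    unfolding coefficient_def EndD(5)[OF b m]
    by (rule tensor_eqI[OF modules(3,1) groups(2) coefficient_lift(2)[OF \<xi>b]
          additive_on_compose[OF additive_maps_additive_on[OF T(1)] coefficient_lift(2)[OF \<xi>]] _ additive_onD(1)[OF coaction(1) m]])
      (simp add: coefficient_lift(3)[OF \<xi>] coefficient_lift(3)[OF \<xi>b] T(2) EndD(3)[OF b] compose_eq del: comodule_End_simps)
qed

lemma basisD: "i < n \<Longrightarrow> e i \<in> carrier M" "i < n \<Longrightarrow> x i \<in> carrier D"
  "m \<in> carrier M \<Longrightarrow> (\<Oplus>\<^bsub>M\<^esub>i\<in>{..<n}. e i \<triangleleft>\<^bsub>M\<^esub> x i m) = m"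
  using basis by (simp_all add: dual_basis_def)

lemma hom_expand:
  assumes "abelian_group Y" "additive_on M Y f" "m \<in> carrier M"
  shows "(\<Oplus>\<^bsub>Y\<^esub>i\<in>{..<n}. f (e i \<triangleleft>\<^bsub>M\<^esub> x i m)) = f m"
  using additive_on_finsum_eq[OF groups(3) assms(1,2), of "{..<n}" "\<lambda>i. e i \<triangleleft>\<^bsub>M\<^esub> x i m"]
  by (simp add: basisD assms(3) M.ract_closed dualD Pi_iff)

lemma coef_expand:
  assumes \<xi>: "\<xi> \<in> carrier D" and m: "m \<in> carrier M"
  shows "(\<Oplus>\<^bsub>C\<^esub>i\<in>{..<n}. coef \<xi> (e i) \<triangleleft>\<^bsub>C\<^esub> x i m) = coef \<xi> m"
proof -
  have "(\<Oplus>\<^bsub>C\<^esub>i\<in>{..<n}. coef \<xi> (e i \<triangleleft>\<^bsub>M\<^esub> x i m)) = (\<Oplus>\<^bsub>C\<^esub>i\<in>{..<n}. coef \<xi> (e i) \<triangleleft>\<^bsub>C\<^esub> x i m)"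
    by (rule C.finsum_cong') (auto simp: basisD coef_ract dualD \<xi> m C.ract_closed coef_closed)
  then show ?thesis using hom_expand[OF groups(2) coef_additive_right[OF \<xi>] m] by simp
qed

text \<open>The counterpart of \<open>basisD(3)\<close> on the dual side: the \<open>x i\<close>
  generate \<open>D\<close> as a left A-module. In \<open>L_End\<close> it recognises a combination
  of the \<open>x i\<close> as a map precomposed with b.\<close>

lemma dual_expand:
  assumes \<xi>: "\<xi> \<in> carrier D"
  shows "(\<Oplus>\<^bsub>D\<^esub>i\<in>{..<n}. \<xi> (e i) \<odot>\<^bsub>D\<^esub> x i) = \<xi>"
proof -
  interpret D: left_module A D by (rule left_module_dual)
  have cl: "\<xi> (e i) \<odot>\<^bsub>D\<^esub> x i \<in> carrier D" if "i < n" for i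
    using that by (intro D.lact_closed) (simp_all add: basisD dualD[OF \<xi>])
  then have sum: "(\<Oplus>\<^bsub>D\<^esub>i\<in>{..<n}. \<xi> (e i) \<odot>\<^bsub>D\<^esub> x i) \<in> carrier D" by (intro D.X.finsum_closed) auto
  show ?thesis
  proof (rule extensionalityI)
    show "(\<Oplus>\<^bsub>D\<^esub>i\<in>{..<n}. \<xi> (e i) \<odot>\<^bsub>D\<^esub> x i) \<in> extensional (carrier M)" "\<xi> \<in> extensional (carrier M)"
      by (rule additive_mapsD(1)[OF dualD(1)[OF sum]], rule additive_mapsD(1)[OF dualD(1)[OF \<xi>]])
    fix m assume m: "m \<in> carrier M"
    \<comment> \<open>A sum in \<open>D\<close> is a function; evaluation at m is additive on
      \<open>D\<close> and turns it into a sum in A.\<close>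
    have ev: "additive_on D A (\<lambda>\<xi>. \<xi> m)" by (rule additive_onI) (simp_all add: dualD m)
    have "(\<Oplus>\<^bsub>D\<^esub>i\<in>{..<n}. \<xi> (e i) \<odot>\<^bsub>D\<^esub> x i) m = (\<Oplus>\<^bsub>A\<^esub>i\<in>{..<n}. (\<xi> (e i) \<odot>\<^bsub>D\<^esub> x i) m)"
      using cl by (intro additive_on_finsum_eq[OF abelian_group_dual groups(1) ev]) auto
    also have "\<dots> = (\<Oplus>\<^bsub>A\<^esub>i\<in>{..<n}. \<xi> (e i \<triangleleft>\<^bsub>M\<^esub> x i m))"
      by (rule C.M.finsum_cong') (auto simp: m basisD dualD[OF \<xi>] dualD[OF basisD(2)])
    also have "\<dots> = \<xi> m" by (rule hom_expand[OF groups(1) dualD(2)[OF \<xi>] m])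
    finally show "(\<Oplus>\<^bsub>D\<^esub>i\<in>{..<n}. \<xi> (e i) \<odot>\<^bsub>D\<^esub> x i) m = \<xi> m" .
  qed
qed

section \<open>The left coactions of \<open>D\<close> and of \<open>D\<close> \<otimes> M, and how B
  acts on them\<close>

abbreviation "CD \<equiv> tensor_group A C D"
abbreviation "CDM \<equiv> tensor_group A C DM"
abbreviation "L \<equiv> dual_coaction A C M \<rho>"

lemma tensor_groups: "abelian_group CD" "abelian_group CDM" "abelian_group (tensor_group K D M)"
  "abelian_group (tensor_group A C C)" "abelian_group (tensor_group A M C)"
  by (rule tensor_group_abelian[OF modules(2) left_module_dual] tensor_group_abelian[OF modules(2) left_module_DM]
      tensor_group_abelian[OF right_module_dual left_module_KM] tensor_group_abelian[OF modules(2,1)]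
      tensor_group_abelian[OF modules(3,1)])+

text \<open>The four facts are, in order: closure, additivity in the left factor, additivity in the
  right factor, balancedness. \<open>tens_DM\<close>, \<open>tens_CDM\<close>,
  \<open>tens_HN\<close> and \<open>tens_HNC\<close> are numbered in the same way.\<close>

lemmas tens_CD = tens_closed[OF modules(2) left_module_dual] tens_additive_left[OF modules(2) left_module_dual]
  tens_additive_right[OF modules(2) left_module_dual] tens_balanced[OF modules(2) left_module_dual]

lemma L_eq: "\<xi> \<in> carrier D \<Longrightarrow> L \<xi> = (\<Oplus>\<^bsub>CD\<^esub>i\<in>{..<n}. tens A C D (coef \<xi> (e i)) (x i))"
  by (simp add: dual_coaction)

lemma L_additive: "additive_on D CD L"
  by (rule iffD2[OF additive_on_cong[OF abelian_group_dual L_eq]], assumption)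
    (intro additive_on_finsum tensor_groups additive_on_compose[OF coef_additive_left tens_CD(2)]; simp_all add: basisD)

lemma L_closed: "\<xi> \<in> carrier D \<Longrightarrow> L \<xi> \<in> carrier CD"
  using L_additive by (rule additive_onD)

text \<open>In other words, precomposition with b is colinear on \<open>D\<close>. Expand c(\<xi>, b
  e_i) = \<Sum> c(\<xi>, e_j) x_j(b e_i) over j, move the scalars across the tensor sign, and
  exchange the sums; the inner sum over i of x_j(b e_i) x_i is x_j \<circ> b by
  \<open>dual_expand\<close>.\<close>

lemma L_End:
  assumes \<xi>: "\<xi> \<in> carrier D" and b: "b \<in> carrier B"
  shows "L (compose (carrier M) \<xi> b) = (\<Oplus>\<^bsub>CD\<^esub>i\<in>{..<n}. tens A C D (coef \<xi> (e i)) (compose (carrier M) (x i) b))"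
proof -
  interpret CD: abelian_group CD by (rule tensor_groups)
  interpret D: left_module A D by (rule left_module_dual)
  \<comment> \<open>The matrix of b in the dual basis: b (e_i) is the sum over j of e_j
    \<open>?c i j\<close>.\<close>
  let ?c = "\<lambda>i j. x j (b (e i))"
  have b_e: "b (e i) \<in> carrier M" if "i < n" for i using that by (rule EndD(3)[OF b basisD(1)])
  have c: "?c i j \<in> carrier A" if "i < n" "j < n" for i j using that by (simp add: dualD basisD b_e)
  have x_b: "compose (carrier M) (x j) b \<in> carrier D" if "j < n" for j using that by (simp add: compose_dual basisD b del: comodule_End_simps)
  have \<xi>e: "coef \<xi> (e j) \<in> carrier C" if "j < n" for j using that by (simp add: coef_closed \<xi> basisD)
  have cx: "?c i j \<odot>\<^bsub>D\<^esub> x i \<in> carrier D" if "i < n" "j < n" for i j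
    using that by (intro D.lact_closed c basisD)
  have "L (compose (carrier M) \<xi> b) = (\<Oplus>\<^bsub>CD\<^esub>i\<in>{..<n}. tens A C D (coef \<xi> (b (e i))) (x i))"
    unfolding L_eq[OF compose_dual[OF \<xi> b]]
    by (rule CD.finsum_cong') (auto simp: coef_End[OF \<xi> b] basisD b_e intro!: tens_CD coef_closed \<xi>)
  also have "\<dots> = (\<Oplus>\<^bsub>CD\<^esub>i\<in>{..<n}. \<Oplus>\<^bsub>CD\<^esub>j\<in>{..<n}. tens A C D (coef \<xi> (e j)) (?c i j \<odot>\<^bsub>D\<^esub> x i))"
  proof (rule CD.finsum_cong'[OF refl])
    fix i assume "i \<in> {..<n}"
    then have i: "i < n" by simp
    have "tens A C D (coef \<xi> (b (e i))) (x i) = tens A C D (\<Oplus>\<^bsub>C\<^esub>j\<in>{..<n}. coef \<xi> (e j) \<triangleleft>\<^bsub>C\<^esub> ?c i j) (x i)"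
      by (simp add: coef_expand[OF \<xi> b_e[OF i]])
    also have "\<dots> = (\<Oplus>\<^bsub>CD\<^esub>j\<in>{..<n}. tens A C D (coef \<xi> (e j) \<triangleleft>\<^bsub>C\<^esub> ?c i j) (x i))"
      by (rule additive_on_finsum_eq[OF groups(2) tensor_groups(1) tens_CD(2)])
        (auto simp: basisD i \<xi>e c C.ract_closed)
    also have "\<dots> = (\<Oplus>\<^bsub>CD\<^esub>j\<in>{..<n}. tens A C D (coef \<xi> (e j)) (?c i j \<odot>\<^bsub>D\<^esub> x i))"
      by (rule CD.finsum_cong'[OF refl]) (auto simp only: tens_CD(4) i basisD \<xi>e c lessThan_iff intro!: tens_CD(1) cx)
    finally show "tens A C D (coef \<xi> (b (e i))) (x i)
      = (\<Oplus>\<^bsub>CD\<^esub>j\<in>{..<n}. tens A C D (coef \<xi> (e j)) (?c i j \<odot>\<^bsub>D\<^esub> x i))" .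
  qed (intro funcsetI CD.finsum_closed tens_CD \<xi>e cx; simp)
  also have "\<dots> = (\<Oplus>\<^bsub>CD\<^esub>j\<in>{..<n}. \<Oplus>\<^bsub>CD\<^esub>i\<in>{..<n}. tens A C D (coef \<xi> (e j)) (?c i j \<odot>\<^bsub>D\<^esub> x i))"
    by (rule finsum_swap[OF tensor_groups(1)]) (simp_all only: tens_CD(1) \<xi>e cx lessThan_iff finite_lessThan)
  also have "\<dots> = (\<Oplus>\<^bsub>CD\<^esub>j\<in>{..<n}. tens A C D (coef \<xi> (e j)) (compose (carrier M) (x j) b))"
  proof (rule CD.finsum_cong'[OF refl])
    fix j assume "j \<in> {..<n}"
    then have j: "j < n" by simp
    have "(\<Oplus>\<^bsub>D\<^esub>i\<in>{..<n}. ?c i j \<odot>\<^bsub>D\<^esub> x i) = (\<Oplus>\<^bsub>D\<^esub>i\<in>{..<n}. compose (carrier M) (x j) b (e i) \<odot>\<^bsub>D\<^esub> x i)"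
      by (rule D.X.finsum_cong'[OF refl]) (auto simp only: compose_eq basisD lessThan_iff intro!: D.lact_closed dualD(3)[OF x_b[OF j]])
    also have "\<dots> = compose (carrier M) (x j) b" by (rule dual_expand[OF x_b[OF j]])
    finally have "tens A C D (coef \<xi> (e j)) (compose (carrier M) (x j) b) =
      tens A C D (coef \<xi> (e j)) (\<Oplus>\<^bsub>D\<^esub>i\<in>{..<n}. ?c i j \<odot>\<^bsub>D\<^esub> x i)" by simp
    also have "\<dots> = (\<Oplus>\<^bsub>CD\<^esub>i\<in>{..<n}. tens A C D (coef \<xi> (e j)) (?c i j \<odot>\<^bsub>D\<^esub> x i))"
      by (rule additive_on_finsum_eq[OF abelian_group_dual tensor_groups(1) tens_CD(3)[OF \<xi>e[OF j]]])
        (auto simp only: cx j lessThan_iff)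
    finally show "(\<Oplus>\<^bsub>CD\<^esub>i\<in>{..<n}. tens A C D (coef \<xi> (e j)) (?c i j \<odot>\<^bsub>D\<^esub> x i)) =
      tens A C D (coef \<xi> (e j)) (compose (carrier M) (x j) b)" by simp
  qed (auto simp only: lessThan_iff intro!: tens_CD \<xi>e x_b)
  finally show ?thesis .
qed

text \<open>\<open>\<rho>\<close> is right A-linear, so the scalar appears on the right of C; it is
  central on C, becomes a left scalar there and crosses to M. Balancedness over K thereby becomes a
  special case of statements about elements of B.\<close>

lemma scalar_End:
  assumes k: "k \<in> carrier K"
  shows "(\<lambda>m\<in>carrier M. k \<odot>\<^bsub>M\<^esub> m) \<in> carrier B"
proof -
  interpret KM: left_module K M by (rule left_module_KM)
  let ?f = "\<lambda>m\<in>carrier M. k \<odot>\<^bsub>M\<^esub> m" and ?s = "k \<odot>\<^bsub>A\<^esub> \<one>\<^bsub>A\<^esub>"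
  note s = scalar_closed[OF k]
  have f: "?f \<in> right_hom A M M"
    using k by (intro restrict_right_hom[OF modules(3)] additive_onI)
      (simp_all add: KM.lact_closed KM.lact_add_right k_action_ract)
  note T = tensor_map_id_right[OF modules(3,3,1) f]
  have "\<rho> (k \<odot>\<^bsub>M\<^esub> m) = tensor_map A M C M C ?f (\<lambda>c. c) (\<rho> m)" if m: "m \<in> carrier M" for m
    unfolding M.k_action[OF k m] coaction(2)[OF m s]
    by (rule tensor_eqI[OF modules(3,1) tensor_groups(5) ract_MC(1)[OF s] additive_maps_additive_on[OF T(1)] _
          additive_onD(1)[OF coaction(1) m]])
      (simp add: ract_MC(2)[OF s] T(2) M.k_action[OF k] C.k_central[OF k, symmetric] tens_balanced[OF modules(3,1)] s)
  then show ?thesis using f by (simp add: right_comodule_hom_def)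
qed

lemma dual_ract_K: "\<xi> \<triangleleft>\<^bsub>D\<^esub> k = compose (carrier M) \<xi> (\<lambda>m\<in>carrier M. k \<odot>\<^bsub>M\<^esub> m)"
  unfolding dual_simps compose_def by (rule restrict_ext) simp

lemmas tens_DM = tens_closed[OF right_module_dual left_module_KM] tens_additive_left[OF right_module_dual left_module_KM]
  tens_additive_right[OF right_module_dual left_module_KM] tens_balanced[OF right_module_dual left_module_KM]

lemmas tens_CDM = tens_closed[OF modules(2) left_module_DM] tens_additive_left[OF modules(2) left_module_DM]
  tens_additive_right[OF modules(2) left_module_DM] tens_balanced[OF modules(2) left_module_DM]

text \<open>The inner lift of \<open>tensor_left_coaction\<close>: m is held fixed, and \<xi>
  \<mapsto> \<xi> \<otimes> m is left A-linear because A acts on \<open>D\<close> \<otimes> M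
  through \<open>D\<close>.\<close>

lemma coaction_with_balanced:
  assumes m: "m \<in> carrier M"
  shows "balanced_map A C D (tensor A C DM) (\<lambda>c \<xi>. tens A C DM c (tens K D M \<xi> m))"
  using additive_on_compose[OF tens_DM(2)[OF m] tens_CDM(3)[unfolded additive_on_tensor]] m
  by (intro balanced_mapI) (simp_all add: tens_CDM(2,4) tens_DM(1) lact_DM[symmetric] del: dual_simps)

lemmas coaction_with = tensor_lift_balanced[OF modules(2) left_module_dual abelian_group_tensor[OF modules(2) left_module_DM]
  coaction_with_balanced, unfolded additive_on_tensor]

text \<open>One formula with three uses: a scalar of K as b gives balancedness of the coaction on
  \<open>D\<close> \<otimes> M, the identity gives its value on \<xi> \<otimes> m, and a general b
  gives colinearity of \<xi> \<mapsto> \<xi> \<circ> b \<otimes> m.\<close>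

lemma coaction_with_L:
  assumes \<xi>: "\<xi> \<in> carrier D" and b: "b \<in> carrier B" and m: "m \<in> carrier M"
  shows "tensor_lift A C D (tensor A C DM) (\<lambda>c \<xi>. tens A C DM c (tens K D M \<xi> m)) (L (compose (carrier M) \<xi> b))
    = (\<Oplus>\<^bsub>CDM\<^esub>i\<in>{..<n}. tens A C DM (coef \<xi> (e i)) (tens K D M (compose (carrier M) (x i) b) m))"
proof -
  interpret CDM: abelian_group CDM by (rule tensor_groups)
  have x_b: "compose (carrier M) (x j) b \<in> carrier D" if "j < n" for j using that by (simp add: compose_dual basisD b del: comodule_End_simps)
  have \<xi>e: "coef \<xi> (e j) \<in> carrier C" if "j < n" for j using that by (simp add: coef_closed \<xi> basisD)
  show ?thesis
    unfolding L_End[OF \<xi> b]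
  proof (rule trans[OF additive_on_finsum_eq[OF tensor_groups(1,2) coaction_with(2)[OF m]] CDM.finsum_cong'[OF refl]])
    show "(\<lambda>i. tens A C D (coef \<xi> (e i)) (compose (carrier M) (x i) b)) \<in> {..<n} \<rightarrow> carrier CD"
      by (simp add: Pi_iff tens_CD(1) \<xi>e x_b)
    show "(\<lambda>i. tens A C DM (coef \<xi> (e i)) (tens K D M (compose (carrier M) (x i) b) m)) \<in> {..<n} \<rightarrow> carrier CDM"
      by (simp add: Pi_iff tens_CDM(1) tens_DM(1) \<xi>e x_b m)
  qed (simp_all add: coaction_with(3)[OF m] \<xi>e x_b)
qed

abbreviation "coaction_with m \<equiv> tensor_lift A C D (tensor A C DM) (\<lambda>c \<xi>. tens A C DM c (tens K D M \<xi> m))"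

lemma DM_coaction_balanced: "balanced_map K D M (tensor A C DM) (\<lambda>\<xi> m. coaction_with m (L \<xi>))"
  unfolding balanced_map_tensor
proof (rule balanced_mapI)
  show "additive_on D CDM (\<lambda>\<xi>. coaction_with m (L \<xi>))" if "m \<in> carrier M" for m
    by (rule additive_on_compose[OF L_additive coaction_with(2)[OF that]])
next
  interpret KM: left_module K M by (rule left_module_KM)
  fix \<xi> assume \<xi>: "\<xi> \<in> carrier D"
  show "additive_on M CDM (\<lambda>m. coaction_with m (L \<xi>))"
  proof (rule additive_onI)
    show "coaction_with m (L \<xi>) \<in> carrier CDM" if "m \<in> carrier M" for m
      using coaction_with(2)[OF that] L_closed[OF \<xi>] by (rule additive_onD)
    fix m m' assume m: "m \<in> carrier M" and m': "m' \<in> carrier M"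
    then have mm': "m \<oplus>\<^bsub>M\<^esub> m' \<in> carrier M" by simp
    show "coaction_with (m \<oplus>\<^bsub>M\<^esub> m') (L \<xi>) = coaction_with m (L \<xi>) \<oplus>\<^bsub>CDM\<^esub> coaction_with m' (L \<xi>)"
    proof (rule tensor_eqI[OF modules(2) left_module_dual tensor_groups(2) coaction_with(2)[OF mm']
          additive_on_add[OF tensor_groups(2) coaction_with(2)[OF m] coaction_with(2)[OF m']] _ L_closed[OF \<xi>]])
      fix c \<eta> assume c: "c \<in> carrier C" and \<eta>: "\<eta> \<in> carrier D"
      show "coaction_with (m \<oplus>\<^bsub>M\<^esub> m') (tens A C D c \<eta>)
          = coaction_with m (tens A C D c \<eta>) \<oplus>\<^bsub>CDM\<^esub> coaction_with m' (tens A C D c \<eta>)"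
        unfolding coaction_with(3)[OF m c \<eta>] coaction_with(3)[OF m' c \<eta>] coaction_with(3)[OF mm' c \<eta>]
          additive_onD(2)[OF tens_DM(3)[OF \<eta>] m m']
        using additive_onD(2)[OF tens_CDM(3)[OF c]] tens_DM(1)[OF \<eta>] m m' by simp
    qed
  qed
  fix k m assume k: "k \<in> carrier K" and m: "m \<in> carrier M"
  have \<xi>e: "coef \<xi> (e j) \<in> carrier C" if "j < n" for j using that by (simp add: coef_closed \<xi> basisD)
  interpret CDM: abelian_group CDM by (rule tensor_groups)
  have km: "k \<odot>\<^bsub>M\<^esub> m \<in> carrier M" using k m by (rule KM.lact_closed)
  \<comment> \<open>k acts on \<open>D\<close> by precomposition with an element of B, so
    \<open>coaction_with_L\<close> places it on each \<open>x i\<close>, next to the tensor sign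
    over K, where it crosses to m.\<close>
  have "coaction_with m (L (\<xi> \<triangleleft>\<^bsub>D\<^esub> k)) = (\<Oplus>\<^bsub>CDM\<^esub>i\<in>{..<n}. tens A C DM (coef \<xi> (e i)) (tens K D M (x i \<triangleleft>\<^bsub>D\<^esub> k) m))"
    unfolding dual_ract_K by (rule coaction_with_L[OF \<xi> scalar_End[OF k] m])
  also have "\<dots> = (\<Oplus>\<^bsub>CDM\<^esub>i\<in>{..<n}. tens A C DM (coef \<xi> (e i)) (tens K D M (x i) (k \<odot>\<^bsub>M\<^esub> m)))"
    by (rule CDM.finsum_cong'[OF refl])
      (simp_all add: Pi_iff tens_CDM(1) tens_DM(1) \<xi>e basisD km tens_DM(4) k m del: dual_simps)
  also have "\<dots> = coaction_with (k \<odot>\<^bsub>M\<^esub> m) (L \<xi>)"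
    unfolding L_eq[OF \<xi>]
  proof (rule sym[OF trans[OF additive_on_finsum_eq[OF tensor_groups(1,2) coaction_with(2)[OF km]] CDM.finsum_cong'[OF refl]]])
    show "(\<lambda>i. tens A C D (coef \<xi> (e i)) (x i)) \<in> {..<n} \<rightarrow> carrier CD"
      by (simp add: Pi_iff tens_CD(1) \<xi>e basisD)
    show "(\<lambda>i. tens A C DM (coef \<xi> (e i)) (tens K D M (x i) (k \<odot>\<^bsub>M\<^esub> m))) \<in> {..<n} \<rightarrow> carrier CDM"
      by (simp add: Pi_iff tens_CDM(1) tens_DM(1) \<xi>e basisD km)
  qed (simp_all add: coaction_with(3)[OF km] \<xi>e basisD)
  finally show "coaction_with m (L (\<xi> \<triangleleft>\<^bsub>D\<^esub> k)) = coaction_with (k \<odot>\<^bsub>M\<^esub> m) (L \<xi>)" .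
qed

lemmas DM_coaction_lift = tensor_lift_balanced[OF right_module_dual left_module_KM
    abelian_group_tensor[OF modules(2) left_module_DM] DM_coaction_balanced, folded tensor_left_coaction_def, unfolded additive_on_tensor]

lemma one_End: "(\<lambda>m\<in>carrier M. m) \<in> carrier B"
proof -
  have f: "(\<lambda>m\<in>carrier M. m) \<in> right_hom A M M"
    by (rule restrict_right_hom[OF modules(3) additive_on_id]) simp
  note T = tensor_map_id_right[OF modules(3,3,1) f]
  have "\<rho> m = tensor_map A M C M C (\<lambda>m\<in>carrier M. m) (\<lambda>c. c) (\<rho> m)" if "m \<in> carrier M" for m
    by (rule tensor_eqI[OF modules(3,1) tensor_groups(5) additive_on_id additive_maps_additive_on[OF T(1)] _
          additive_onD(1)[OF coaction(1) that]]) (simp add: T(2))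
  then show ?thesis using f by (simp add: right_comodule_hom_def)
qed

lemma compose_one: "\<xi> \<in> carrier D \<Longrightarrow> compose (carrier M) \<xi> (\<lambda>m\<in>carrier M. m) = \<xi>"
  by (rule extensionalityI[where A = "carrier M"]) (simp_all add: additive_mapsD(1)[OF dualD(1)] compose_eq)

lemma DM_coaction_tens:
  assumes \<xi>: "\<xi> \<in> carrier D" and m: "m \<in> carrier M"
  shows "DM_coaction (tens K D M \<xi> m) = (\<Oplus>\<^bsub>CDM\<^esub>i\<in>{..<n}. tens A C DM (coef \<xi> (e i)) (tens K D M (x i) m))"
proof -
  interpret CDM: abelian_group CDM by (rule tensor_groups)
  have "DM_coaction (tens K D M \<xi> m)
      = (\<Oplus>\<^bsub>CDM\<^esub>i\<in>{..<n}. tens A C DM (coef \<xi> (e i)) (tens K D M (compose (carrier M) (x i) (\<lambda>m\<in>carrier M. m)) m))"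
    using coaction_with_L[OF \<xi> one_End m] by (simp add: DM_coaction_lift(3) \<xi> m compose_one)
  also have "\<dots> = (\<Oplus>\<^bsub>CDM\<^esub>i\<in>{..<n}. tens A C DM (coef \<xi> (e i)) (tens K D M (x i) m))"
    by (rule CDM.finsum_cong'[OF refl])
      (simp_all add: Pi_iff tens_CDM(1) tens_DM(1) coef_closed \<xi> basisD m compose_one)
  finally show ?thesis .
qed

text \<open>Needed for the map in (b) to take values in the left comodule maps. It is A-linear
  because A acts on the values of \<xi> and b on its arguments; colinearity is
  \<open>coaction_with_L\<close> read on both sides.\<close>

lemma translate_comodule_hom:
  assumes b: "b \<in> carrier B" and m: "m \<in> carrier M"
  shows "(\<lambda>\<xi>\<in>carrier D. tens K D M (compose (carrier M) \<xi> b) m) \<in> left_comodule_hom A C D L DM DM_coaction"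
proof -
  interpret CDM: abelian_group CDM by (rule tensor_groups)
  interpret D: left_module A D by (rule left_module_dual)
  let ?f = "\<lambda>\<xi>\<in>carrier D. tens K D M (compose (carrier M) \<xi> b) m"
  note cl = compose_dual[OF _ b]
  have add: "additive_on D D (\<lambda>\<xi>. compose (carrier M) \<xi> b)"
    by (rule additive_onI[OF cl]) (auto simp: compose_def EndD(3)[OF b] simp del: comodule_End_simps)
  have lact: "compose (carrier M) (a \<odot>\<^bsub>D\<^esub> \<xi>) b = a \<odot>\<^bsub>D\<^esub> compose (carrier M) \<xi> b" for a \<xi>
    by (auto simp: compose_def EndD(3)[OF b] simp del: comodule_End_simps)
  have f: "?f \<in> left_hom A D DM"
  proof (rule restrict_left_hom[OF left_module_dual], unfold additive_on_tensor)
    show "additive_on D (tensor_group K D M) (\<lambda>\<xi>. tens K D M (compose (carrier M) \<xi> b) m)"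
      by (rule additive_on_compose[OF add tens_DM(2)[OF m]])
    show "tens K D M (compose (carrier M) (a \<odot>\<^bsub>D\<^esub> \<xi>) b) m = a \<odot>\<^bsub>DM\<^esub> tens K D M (compose (carrier M) \<xi> b) m"
      if "a \<in> carrier A" "\<xi> \<in> carrier D" for a \<xi>
      unfolding lact by (rule lact_DM[OF that(1) cl[OF that(2)] m, symmetric])
  qed
  note T = tensor_map_id_left[OF modules(2) left_module_dual left_module_DM f]
  have "DM_coaction (?f \<xi>) = tensor_map A C D C DM (\<lambda>c. c) ?f (L \<xi>)" if \<xi>: "\<xi> \<in> carrier D" for \<xi>
  proof -
    have \<xi>e: "coef \<xi> (e j) \<in> carrier C" if "j < n" for j using that by (simp add: coef_closed \<xi> basisD)
    have "DM_coaction (?f \<xi>) = coaction_with m (L (compose (carrier M) \<xi> b))"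
      by (simp add: \<xi> DM_coaction_lift(3)[OF cl[OF \<xi>] m])
    also have "\<dots> = (\<Oplus>\<^bsub>CDM\<^esub>i\<in>{..<n}. tens A C DM (coef \<xi> (e i)) (?f (x i)))"
      unfolding coaction_with_L[OF \<xi> b m]
      by (rule CDM.finsum_cong'[OF refl]) (simp_all add: Pi_iff basisD tens_CDM(1) tens_DM(1) cl m \<xi>e)
    also have "\<dots> = tensor_map A C D C DM (\<lambda>c. c) ?f (L \<xi>)"
      unfolding L_eq[OF \<xi>]
    proof (rule sym[OF trans[OF additive_on_finsum_eq[OF tensor_groups(1,2) T(1)] CDM.finsum_cong'[OF refl]]])
      show "(\<lambda>i. tens A C D (coef \<xi> (e i)) (x i)) \<in> {..<n} \<rightarrow> carrier CD"
        by (simp add: Pi_iff tens_CD(1) \<xi>e basisD)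
      show "(\<lambda>i. tens A C DM (coef \<xi> (e i)) (?f (x i))) \<in> {..<n} \<rightarrow> carrier CDM"
        using left_homD(3)[OF f] by (simp add: Pi_iff tens_CDM(1) tens_DM(1) cl m \<xi>e basisD)
    qed (simp_all add: T(2) \<xi>e basisD)
    finally show ?thesis .
  qed
  then show ?thesis using f by (simp add: left_comodule_hom_def)
qed

section \<open>The group \<open>Z\<close> of left comodule maps, the ring B and its modules\<close>

abbreviation "Z \<equiv> comodule_Hom_dual K A C M \<rho>"

lemma Z_simps [simp]:
  "carrier Z = left_comodule_hom A C D L DM DM_coaction"
  "\<zero>\<^bsub>Z\<^esub> = (\<lambda>\<xi>\<in>carrier D. \<zero>\<^bsub>tensor_group K D M\<^esub>)"
  "add Z = (\<lambda>f g. \<lambda>\<xi>\<in>carrier D. f \<xi> \<oplus>\<^bsub>tensor_group K D M\<^esub> g \<xi>)"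
  "smult Z = (\<lambda>b f. \<lambda>\<xi>\<in>carrier D. f (compose (carrier M) \<xi> b))"
proof -
  \<comment> \<open>\<open>comodule_Hom_dual\<close> is built on the dual of
    \<open>eval_bimodule M\<close>, so that B rather than K acts by precomposition. Its set of right
    A-linear maps is still that of \<open>D\<close>.\<close>
  have D: "carrier (dual A N) = carrier D"
    by (simp add: dual_def right_hom_def additive_maps_def)
  show "carrier Z = left_comodule_hom A C D L DM DM_coaction"
    by (simp add: comodule_Hom_dual_def Let_def)
  show "\<zero>\<^bsub>Z\<^esub> = (\<lambda>\<xi>\<in>carrier D. \<zero>\<^bsub>tensor_group K D M\<^esub>)"
    "add Z = (\<lambda>f g. \<lambda>\<xi>\<in>carrier D. f \<xi> \<oplus>\<^bsub>tensor_group K D M\<^esub> g \<xi>)"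
    by (simp_all add: comodule_Hom_dual_def Let_def D)
  show "smult Z = (\<lambda>b f. \<lambda>\<xi>\<in>carrier D. f (compose (carrier M) \<xi> b))"
    by (simp add: comodule_Hom_dual_def Let_def D) (simp add: dual_def compose_def)
qed

lemma abelian_group_Z: "abelian_group Z"
proof (rule abelian_group_maps[where Y = DM and I = "carrier D"])
  show "abelian_group DM" by (rule abelian_group_tensor[OF right_module_dual left_module_KM])
  show "carrier Z \<subseteq> carrier D \<rightarrow>\<^sub>E carrier DM"
  proof
    fix f assume "f \<in> carrier Z"
    then have "f \<in> additive_maps D DM" unfolding Z_simps by (rule left_homD(1)[OF left_comodule_homD(1)])
    then show "f \<in> carrier D \<rightarrow>\<^sub>E carrier DM" by (simp add: additive_maps_def)
  qed
  show "(\<lambda>\<xi>\<in>carrier D. \<zero>\<^bsub>DM\<^esub>) \<in> carrier Z"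
    unfolding Z_simps
    by (rule left_comodule_hom_zero_minus(1)[OF modules(2) left_module_dual left_module_DM L_closed])
      (simp_all add: DM_coaction_lift(2))
  show "(\<lambda>\<xi>\<in>carrier D. f \<xi> \<ominus>\<^bsub>DM\<^esub> g \<xi>) \<in> carrier Z" if "f \<in> carrier Z" "g \<in> carrier Z" for f g
    using that unfolding Z_simps
    by (rule left_comodule_hom_zero_minus(2)[OF modules(2) left_module_dual left_module_DM L_closed, rotated 2])
      (simp_all add: DM_coaction_lift(2))
qed simp_all

lemma ring_End: "ring B"
proof -
  have sub: "f \<in> carrier M \<rightarrow>\<^sub>E carrier M" if "f \<in> carrier B" for f
    using right_homD(1)[OF EndD(1)[OF that]] by (simp add: additive_maps_def)
  have rho: "\<rho> m \<in> carrier (tensor_group A M C)" if "m \<in> carrier M" for m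
    using coaction(1) that by (rule additive_onD)
  have B: "abelian_group B"
  proof (rule abelian_group_maps[where Y = M and I = "carrier M"])
    show "(\<lambda>m\<in>carrier M. \<zero>\<^bsub>M\<^esub>) \<in> carrier B"
      using right_comodule_hom_zero_minus(1)[OF modules(3,3,1) rho coaction(1)] by simp
    show "(\<lambda>m\<in>carrier M. f m \<ominus>\<^bsub>M\<^esub> g m) \<in> carrier B" if "f \<in> carrier B" "g \<in> carrier B" for f g
      using right_comodule_hom_zero_minus(2)[OF modules(3,3,1) rho coaction(1)] that by simp
    show "carrier B \<subseteq> carrier M \<rightarrow>\<^sub>E carrier M" using sub by blast
  qed (simp_all add: groups)
  have comp: "compose (carrier M) f g \<in> carrier B" if f: "f \<in> carrier B" and g: "g \<in> carrier B" for f g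
  proof -
    have "compose (carrier M) f g \<in> right_hom A M M"
      unfolding compose_def by (rule right_hom_comp[OF modules(3) EndD(1)[OF g] EndD(1)[OF f]])
    moreover have "\<rho> (compose (carrier M) f g m) = tensor_map A M C M C (compose (carrier M) f g) (\<lambda>c. c) (\<rho> m)"
      if m: "m \<in> carrier M" for m
      using tensor_map_comp[OF modules(3,3,3,1) EndD(1)[OF g] EndD(1)[OF f] rho[OF m]]
      by (simp add: compose_eq m EndD(5)[OF f EndD(3)[OF g m]] EndD(5)[OF g m] compose_def del: comodule_End_simps)
    ultimately show ?thesis by (simp add: right_comodule_hom_def)
  qed
  interpret B: abelian_group B by (rule B)
  have mon: "monoid B"
  proof (rule monoidI)
    show "\<one>\<^bsub>B\<^esub> \<in> carrier B" using one_End by simp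
    fix f g h assume f: "f \<in> carrier B" and g: "g \<in> carrier B" and h: "h \<in> carrier B"
    show "f \<otimes>\<^bsub>B\<^esub> g \<in> carrier B" using comp[OF f g] by simp
    show "f \<otimes>\<^bsub>B\<^esub> g \<otimes>\<^bsub>B\<^esub> h = f \<otimes>\<^bsub>B\<^esub> (g \<otimes>\<^bsub>B\<^esub> h)"
      using EndD(3)[OF h] by (auto simp: compose_def fun_eq_iff)
  next
    fix f assume f: "f \<in> carrier B"
    show "\<one>\<^bsub>B\<^esub> \<otimes>\<^bsub>B\<^esub> f = f" "f \<otimes>\<^bsub>B\<^esub> \<one>\<^bsub>B\<^esub> = f"
      using sub[OF f] unfolding comodule_End_simps
      by (auto intro!: Id_compose[where A = "carrier M" and B = "carrier M"] compose_Id simp: PiE_def)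
  qed
  show ?thesis
  proof (rule ringI[OF B mon])
    fix f g h assume f: "f \<in> carrier B" and g: "g \<in> carrier B" and h: "h \<in> carrier B"
    show "(f \<oplus>\<^bsub>B\<^esub> g) \<otimes>\<^bsub>B\<^esub> h = f \<otimes>\<^bsub>B\<^esub> h \<oplus>\<^bsub>B\<^esub> g \<otimes>\<^bsub>B\<^esub> h"
      unfolding comodule_End_simps compose_def by (rule restrict_ext) (simp add: EndD(3)[OF h])
    show "h \<otimes>\<^bsub>B\<^esub> (f \<oplus>\<^bsub>B\<^esub> g) = h \<otimes>\<^bsub>B\<^esub> f \<oplus>\<^bsub>B\<^esub> h \<otimes>\<^bsub>B\<^esub> g"
      unfolding comodule_End_simps compose_def
      by (rule restrict_ext) (simp add: EndD(3)[OF f] EndD(3)[OF g] additive_onD(2)[OF EndD(2)[OF h]])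
  qed
qed

lemma left_module_eval: "left_module B N"
proof -
  interpret B: ring B by (rule ring_End)
  interpret N: abelian_group N
    by (rule abelian_groupI) (auto simp: M.a_ac intro: M.l_neg bexI[where x = "\<ominus>\<^bsub>M\<^esub> m" for m])
  show ?thesis
    by unfold_locales (auto simp: EndD(3)[simplified] additive_onD(2)[OF EndD(2)[simplified]] compose_eq)
qed

lemma left_module_End: "left_module B (algebra_bimodule B)"
proof -
  interpret B: ring B by (rule ring_End)
  interpret N: abelian_group "algebra_bimodule B"
    by (rule abelian_groupI) (auto simp del: comodule_End_simps simp: B.a_ac intro: B.l_neg bexI[where x = "\<ominus>\<^bsub>B\<^esub> m" for m])
  show ?thesis
    by unfold_locales (simp_all del: comodule_End_simps add: B.m_assoc B.l_distr B.r_distr)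
qed

text \<open>K acts on M through A and elements of B are right A-linear, so scalars commute with B.
  The form b (k 1) puts the scalar next to the second tensor factor, where a K-linear map can absorb
  it.\<close>

lemma End_ract:
  assumes "k \<in> carrier K" "b \<in> carrier B"
  shows "k \<odot>\<^bsub>B\<^esub> b = b \<otimes>\<^bsub>B\<^esub> (k \<odot>\<^bsub>B\<^esub> \<one>\<^bsub>B\<^esub>)" "k \<odot>\<^bsub>B\<^esub> b \<in> carrier B" "k \<odot>\<^bsub>B\<^esub> \<one>\<^bsub>B\<^esub> \<in> carrier B"
proof -
  interpret B: ring B by (rule ring_End)
  note s = scalar_closed[OF assms(1)]
  have eq: "k \<odot>\<^bsub>B\<^esub> \<one>\<^bsub>B\<^esub> = (\<lambda>m\<in>carrier M. k \<odot>\<^bsub>M\<^esub> m)" by auto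
  then show kB: "k \<odot>\<^bsub>B\<^esub> \<one>\<^bsub>B\<^esub> \<in> carrier B" using scalar_End[OF assms(1)] by simp
  show "k \<odot>\<^bsub>B\<^esub> b = b \<otimes>\<^bsub>B\<^esub> (k \<odot>\<^bsub>B\<^esub> \<one>\<^bsub>B\<^esub>)"
    unfolding eq unfolding comodule_End_simps compose_def
    by (rule restrict_ext) (simp add: EndD(3,4)[OF assms(2)] s M.k_action[OF assms(1)])
  then show "k \<odot>\<^bsub>B\<^esub> b \<in> carrier B" using B.m_closed[OF assms(2) kB] by (simp only:)
qed

section \<open>The bimodule B \<otimes> M, the map \<open>\<Phi>\<close> of (b) and the action
  map\<close>

abbreviation "BB \<equiv> algebra_bimodule B"
abbreviation "BM \<equiv> tensor K BB M"
abbreviation "\<Phi> \<equiv> End_tensor_map K A C M \<rho>"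

lemma End_k_action: "\<lbrakk>b \<in> carrier B; k \<in> carrier K; m \<in> carrier M\<rbrakk> \<Longrightarrow> b (k \<odot>\<^bsub>M\<^esub> m) = k \<odot>\<^bsub>M\<^esub> b m"
  using EndD(3,4)[of b] by (simp add: M.k_action del: comodule_End_simps)

lemma right_module_End: "right_module K BB"
proof -
  interpret BB: left_module B BB by (rule left_module_End)
  interpret KM: left_module K M by (rule left_module_KM)
  show ?thesis
  proof (unfold_locales, unfold algebra_bimodule_simps)
    fix b k assume b: "b \<in> carrier B" and k: "k \<in> carrier K"
    show "k \<odot>\<^bsub>B\<^esub> b \<in> carrier B" by (rule End_ract(2)[OF k b])
    fix l assume l: "l \<in> carrier K"
    show "(k \<oplus>\<^bsub>K\<^esub> l) \<odot>\<^bsub>B\<^esub> b = k \<odot>\<^bsub>B\<^esub> b \<oplus>\<^bsub>B\<^esub> l \<odot>\<^bsub>B\<^esub> b"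
      unfolding comodule_End_simps by (rule restrict_ext) (simp add: KM.lact_add_left k l EndD(3)[OF b])
    show "(k \<otimes>\<^bsub>K\<^esub> l) \<odot>\<^bsub>B\<^esub> b = l \<odot>\<^bsub>B\<^esub> (k \<odot>\<^bsub>B\<^esub> b)"
      unfolding comodule_End_simps C.R.m_comm[OF k l] by (rule restrict_ext) (simp add: KM.lact_mult k l EndD(3)[OF b])
  next
    fix b c k assume b: "b \<in> carrier B" and c: "c \<in> carrier B" and k: "k \<in> carrier K"
    show "k \<odot>\<^bsub>B\<^esub> (b \<oplus>\<^bsub>B\<^esub> c) = k \<odot>\<^bsub>B\<^esub> b \<oplus>\<^bsub>B\<^esub> k \<odot>\<^bsub>B\<^esub> c"
      unfolding comodule_End_simps by (rule restrict_ext) (simp add: KM.lact_add_right k EndD(3)[OF b] EndD(3)[OF c])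
  next
    fix b assume b: "b \<in> carrier B"
    show "\<one>\<^bsub>K\<^esub> \<odot>\<^bsub>B\<^esub> b = b"
      using additive_mapsD(1)[OF right_homD(1)[OF EndD(1)[OF b]]]
      by (intro extensionalityI[where A = "carrier M"]) (simp_all add: KM.lact_one EndD(3)[OF b])
  qed
qed

lemma End_actions_commute:
  assumes "b \<in> carrier B" "c \<in> carrier BB" "k \<in> carrier K"
  shows "b \<odot>\<^bsub>BB\<^esub> (c \<triangleleft>\<^bsub>BB\<^esub> k) = (b \<odot>\<^bsub>BB\<^esub> c) \<triangleleft>\<^bsub>BB\<^esub> k"
proof -
  have c: "c \<in> carrier B" using assms by simp
  show ?thesis
    unfolding algebra_bimodule_simps comodule_End_simps compose_def
    by (rule restrict_ext) (simp add: End_k_action[OF assms(1,3)] EndD(3)[OF c])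
qed

lemma left_module_BM: "left_module B BM"
  and lact_BM: "\<lbrakk>b \<in> carrier B; c \<in> carrier BB; m \<in> carrier M\<rbrakk> \<Longrightarrow>
    b \<odot>\<^bsub>BM\<^esub> tens K BB M c m = tens K BB M (b \<otimes>\<^bsub>B\<^esub> c) m"
  using tensor_left_module[OF right_module_End left_module_End left_module_KM End_actions_commute]
  by (simp_all del: comodule_End_simps)

lemma compose_dual_add:
  assumes \<xi>: "\<xi> \<in> carrier D" and b: "b \<in> carrier B" and c: "c \<in> carrier B"
  shows "compose (carrier M) \<xi> (b \<oplus>\<^bsub>B\<^esub> c) = compose (carrier M) \<xi> b \<oplus>\<^bsub>D\<^esub> compose (carrier M) \<xi> c"
  unfolding comodule_End_simps dual_simps compose_def
  by (rule restrict_ext) (simp add: dualD[OF \<xi>] EndD(3)[OF b] EndD(3)[OF c])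

lemma compose_dual_ract:
  assumes \<xi>: "\<xi> \<in> carrier D" and b: "b \<in> carrier B" and k: "k \<in> carrier K"
  shows "compose (carrier M) \<xi> (k \<odot>\<^bsub>B\<^esub> b) = compose (carrier M) \<xi> b \<triangleleft>\<^bsub>D\<^esub> k"
  unfolding comodule_End_simps dual_simps compose_def
  by (rule restrict_ext) (simp add: k_action_closed[OF k] End_k_action[OF b k] EndD(3)[OF b])

text \<open>Precomposing \<xi> with k b is precomposing with b and then acting by k in
  \<open>D\<close>, from where k crosses to m. This is what entitles \<open>\<Phi>\<close> to its
  value \<xi> \<mapsto> \<xi> \<circ> b \<otimes> m on b \<otimes> m.\<close>

lemma End_tensor_map_balanced:
  "balanced_map K BB M Z (\<lambda>b m. \<lambda>\<xi>\<in>carrier D. tens K D M (compose (carrier M) \<xi> b) m)"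
proof (rule balanced_mapI)
  fix m assume m: "m \<in> carrier M"
  show "additive_on BB Z (\<lambda>b. \<lambda>\<xi>\<in>carrier D. tens K D M (compose (carrier M) \<xi> b) m)"
  proof (rule additive_onI, unfold algebra_bimodule_simps)
    show "(\<lambda>\<xi>\<in>carrier D. tens K D M (compose (carrier M) \<xi> b) m) \<in> carrier Z" if "b \<in> carrier B" for b
      using translate_comodule_hom[OF that m] by simp
    fix b c assume b: "b \<in> carrier B" and c: "c \<in> carrier B"
    show "(\<lambda>\<xi>\<in>carrier D. tens K D M (compose (carrier M) \<xi> (b \<oplus>\<^bsub>B\<^esub> c)) m)
      = (\<lambda>\<xi>\<in>carrier D. tens K D M (compose (carrier M) \<xi> b) m) \<oplus>\<^bsub>Z\<^esub> (\<lambda>\<xi>\<in>carrier D. tens K D M (compose (carrier M) \<xi> c) m)"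
      unfolding Z_simps
      by (rule restrict_ext)
        (simp add: compose_dual_add b c additive_onD(2)[OF tens_DM(2)[OF m]] compose_dual del: comodule_End_simps dual_simps)
  qed
next
  fix b assume "b \<in> carrier BB"
  then have b: "b \<in> carrier B" by simp
  show "additive_on M Z (\<lambda>m. \<lambda>\<xi>\<in>carrier D. tens K D M (compose (carrier M) \<xi> b) m)"
  proof (rule additive_onI)
    show "(\<lambda>\<xi>\<in>carrier D. tens K D M (compose (carrier M) \<xi> b) m) \<in> carrier Z" if "m \<in> carrier M" for m
      using translate_comodule_hom[OF b that] by simp
    fix m m' assume m: "m \<in> carrier M" and m': "m' \<in> carrier M"
    show "(\<lambda>\<xi>\<in>carrier D. tens K D M (compose (carrier M) \<xi> b) (m \<oplus>\<^bsub>M\<^esub> m'))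
      = (\<lambda>\<xi>\<in>carrier D. tens K D M (compose (carrier M) \<xi> b) m) \<oplus>\<^bsub>Z\<^esub> (\<lambda>\<xi>\<in>carrier D. tens K D M (compose (carrier M) \<xi> b) m')"
      unfolding Z_simps
      by (rule restrict_ext) (simp add: additive_onD(2)[OF tens_DM(3)[OF compose_dual[OF _ b]]] m m')
  qed
  fix k m assume k: "k \<in> carrier K" and m: "m \<in> carrier M"
  show "(\<lambda>\<xi>\<in>carrier D. tens K D M (compose (carrier M) \<xi> (b \<triangleleft>\<^bsub>BB\<^esub> k)) m)
      = (\<lambda>\<xi>\<in>carrier D. tens K D M (compose (carrier M) \<xi> b) (k \<odot>\<^bsub>M\<^esub> m))"
    unfolding algebra_bimodule_simps
    by (rule restrict_ext)
      (simp only: compose_dual_ract[OF _ b k] tens_DM(4)[OF compose_dual[OF _ b] k m])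
qed

lemmas End_tensor_map_lift = tensor_lift_balanced[OF right_module_End left_module_KM abelian_group_Z
  End_tensor_map_balanced, folded End_tensor_map_def]

lemma evaluation_balanced: "balanced_map K BB M M (\<lambda>b m. b m)"
proof (rule balanced_mapI)
  fix b assume "b \<in> carrier BB"
  then have b: "b \<in> carrier B" by simp
  show "additive_on M M b" by (rule EndD(2)[OF b])
  show "(b \<triangleleft>\<^bsub>BB\<^esub> k) m = b (k \<odot>\<^bsub>M\<^esub> m)" if "k \<in> carrier K" "m \<in> carrier M" for k m
    using End_k_action[OF b that] that by simp
qed (auto intro!: additive_onI simp: EndD(3)[simplified])

abbreviation "action \<equiv> tensor_lift K BB M M (\<lambda>b m. b m)"

lemmas action_lift = tensor_lift_balanced[OF right_module_End left_module_KM groups(3) evaluation_balanced]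

lemma lifted_can_balanced: "balanced_map K D M C coef"
proof (rule balanced_mapI[OF coef_additive_left coef_additive_right])
  fix \<xi> k m assume "\<xi> \<in> carrier D" "k \<in> carrier K" "m \<in> carrier M"
  then show "coef (\<xi> \<triangleleft>\<^bsub>D\<^esub> k) m = coef \<xi> (k \<odot>\<^bsub>M\<^esub> m)"
    unfolding dual_ract_K by (subst coef_End[OF _ scalar_End]) simp_all
qed

lemmas lifted_can_lift = tensor_lift_balanced[OF right_module_dual left_module_KM groups(2) lifted_can_balanced, folded lifted_can_def]

text \<open>Makes u \<mapsto> \<open>\<Phi> u \<xi>\<close> additive for fixed \<xi>, so that
  identities about \<open>\<Phi>\<close> can be checked on the tensors b \<otimes> m.\<close>

lemma Z_evaluation:
  assumes \<xi>: "\<xi> \<in> carrier D"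
  shows "additive_on Z (tensor_group K D M) (\<lambda>f. f \<xi>)"
proof (rule additive_onI)
  fix f assume "f \<in> carrier Z"
  then have "f \<in> left_comodule_hom A C D L DM DM_coaction" by simp
  from left_homD(3)[OF left_comodule_homD(1)[OF this] \<xi>] show "f \<xi> \<in> carrier (tensor_group K D M)" by simp
qed (simp add: \<xi>)

text \<open>On b \<otimes> m this is c(\<xi> b, m) = c(\<xi>, b m). It links (b) with (c): what the
  map of (c) does after \<open>\<Phi>\<close> is controlled by the action map alone.\<close>

lemma lifted_can_End_tensor_map:
  assumes u: "u \<in> carrier (tensor_group K BB M)" and \<xi>: "\<xi> \<in> carrier D"
  shows "lifted_can K A C M \<rho> (\<Phi> u \<xi>) = coef \<xi> (action u)"
proof (rule tensor_eqI[OF right_module_End left_module_KM groups(2)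
      additive_on_compose[OF additive_on_compose[OF End_tensor_map_lift(2) Z_evaluation[OF \<xi>]] lifted_can_lift(2)]
      additive_on_compose[OF action_lift(2) coef_additive_right[OF \<xi>]] _ u])
  fix b m assume b: "b \<in> carrier BB" and m: "m \<in> carrier M"
  then have b': "b \<in> carrier B" by simp
  show "lifted_can K A C M \<rho> (\<Phi> (tens K BB M b m) \<xi>) = coef \<xi> (action (tens K BB M b m))"
    by (simp only: End_tensor_map_lift(3)[OF b m] action_lift(3)[OF b m] restrict_apply' \<xi>
        lifted_can_lift(3)[OF compose_dual[OF \<xi> b'] m] coef_End[OF \<xi> b' m])
qed

text \<open>The values \<open>x i m\<close> are the coordinates from which the dual basis rebuilds
  m.\<close>

lemma dual_separates:
  assumes "a \<in> carrier M" "m \<in> carrier M" "\<And>\<xi>. \<xi> \<in> carrier D \<Longrightarrow> \<xi> a = \<xi> m"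
  shows "a = m"
proof -
  have "(\<Oplus>\<^bsub>M\<^esub>i\<in>{..<n}. e i \<triangleleft>\<^bsub>M\<^esub> x i a) = (\<Oplus>\<^bsub>M\<^esub>i\<in>{..<n}. e i \<triangleleft>\<^bsub>M\<^esub> x i m)"
    using assms(1,2) assms(3)[OF basisD(2)]
    by (intro M.finsum_cong') (auto simp: basisD intro!: M.ract_closed dualD(3)[OF basisD(2)])
  then show ?thesis using basisD(3) assms by simp
qed

section \<open>The evaluation map\<close>

lemma H_simps [simp]:
  "carrier H = right_comodule_hom A C M \<rho> C \<Delta>" "\<zero>\<^bsub>H\<^esub> = (\<lambda>m\<in>carrier M. \<zero>\<^bsub>C\<^esub>)"
  "add H = (\<lambda>f g. \<lambda>m\<in>carrier M. f m \<oplus>\<^bsub>C\<^esub> g m)" "rsmult H = (\<lambda>f b. compose (carrier M) f b)"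
  by (simp_all add: comodule_Hom_coring_def compose_def)

lemma HD:
  assumes "f \<in> carrier H"
  shows "f \<in> right_hom A M C" "additive_on M C f" "\<And>m. m \<in> carrier M \<Longrightarrow> f m \<in> carrier C"
    "\<And>m a. \<lbrakk>m \<in> carrier M; a \<in> carrier A\<rbrakk> \<Longrightarrow> f (m \<triangleleft>\<^bsub>M\<^esub> a) = f m \<triangleleft>\<^bsub>C\<^esub> a"
    "\<And>m. m \<in> carrier M \<Longrightarrow> \<Delta> (f m) = tensor_map A M C C C f (\<lambda>c. c) (\<rho> m)"
  using assms right_homD[of f A M C] right_hom_additive_on[of f A M C] by (auto simp: right_comodule_hom_def)

lemma rho_closed: "m \<in> carrier M \<Longrightarrow> \<rho> m \<in> carrier (tensor_group A M C)"
  using coaction(1) by (rule additive_onD)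

lemma right_module_H: "right_module B H"
proof -
  have "abelian_group H"
  proof (rule abelian_group_maps[where Y = C and I = "carrier M"])
    show "carrier H \<subseteq> carrier M \<rightarrow>\<^sub>E carrier C"
      using right_homD(1)[OF HD(1)] unfolding additive_maps_def by blast
    show "(\<lambda>m\<in>carrier M. \<zero>\<^bsub>C\<^esub>) \<in> carrier H"
      using right_comodule_hom_zero_minus(1)[OF modules(3,2,1) rho_closed comult] by simp
    show "(\<lambda>m\<in>carrier M. f m \<ominus>\<^bsub>C\<^esub> g m) \<in> carrier H" if "f \<in> carrier H" "g \<in> carrier H" for f g
      using right_comodule_hom_zero_minus(2)[OF modules(3,2,1) rho_closed comult] that by simp
  qed (simp_all add: groups)
  then show ?thesis
    unfolding comodule_Hom_coring_def
  proof (rule right_module_right_hom_bimodule[OF left_module_eval])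
    fix f assume "f \<in> right_comodule_hom A C M \<rho> C \<Delta>"
    then have f: "f \<in> carrier H" by simp
    show "f \<in> additive_maps N C"
      using right_homD(1)[OF HD(1)[OF f]] by (simp add: additive_maps_def)
    fix b assume b: "b \<in> carrier B"
    have fb: "(\<lambda>m\<in>carrier M. f (b m)) \<in> right_hom A M C"
      by (rule right_hom_comp[OF modules(3) EndD(1)[OF b] HD(1)[OF f]])
    have "\<Delta> (f (b m)) = tensor_map A M C C C (\<lambda>m\<in>carrier M. f (b m)) (\<lambda>c. c) (\<rho> m)" if m: "m \<in> carrier M" for m
      using tensor_map_comp[OF modules(3,3,2,1) EndD(1)[OF b] HD(1)[OF f] rho_closed[OF m]]
      by (simp only: HD(5)[OF f EndD(3)[OF b m]] EndD(5)[OF b m])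
    then show "(\<lambda>m\<in>carrier N. f (b \<odot>\<^bsub>N\<^esub> m)) \<in> right_comodule_hom A C M \<rho> C \<Delta>"
      using fb by (simp add: right_comodule_hom_def)
  qed
qed

lemma right_module_eval: "right_module A N"
proof -
  interpret N: left_module B N by (rule left_module_eval)
  show ?thesis
    by unfold_locales (simp_all add: M.ract_closed M.ract_add_left M.ract_add_right M.ract_mult M.ract_one)
qed

section \<open>The right comodule Hom(M, C) \<otimes> M over B\<close>

abbreviation "HN \<equiv> tensor B H N"
abbreviation "HNg \<equiv> tensor_group B H N"

lemma right_module_HN: "right_module A HN"
  and ract_HN: "\<lbrakk>a \<in> carrier A; f \<in> carrier H; m \<in> carrier N\<rbrakk> \<Longrightarrow>
      tens B H N f m \<triangleleft>\<^bsub>HN\<^esub> a = tens B H N f (m \<triangleleft>\<^bsub>M\<^esub> a)"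
  and ract_HN_additive: "a \<in> carrier A \<Longrightarrow> additive_on HNg HNg (\<lambda>u. u \<triangleleft>\<^bsub>HN\<^esub> a)"
proof -
  have compat: "b \<odot>\<^bsub>N\<^esub> (m \<triangleleft>\<^bsub>N\<^esub> a) = b \<odot>\<^bsub>N\<^esub> m \<triangleleft>\<^bsub>N\<^esub> a"
    if "a \<in> carrier A" "m \<in> carrier N" "b \<in> carrier B" for a m b
    using EndD(4)[OF that(3)] that by (simp del: comodule_End_simps)
  note T = tensor_right_module[OF right_module_H left_module_eval right_module_eval]
  show "right_module A HN" by (rule T(1)) (rule compat)
  show "tens B H N f m \<triangleleft>\<^bsub>HN\<^esub> a = tens B H N f (m \<triangleleft>\<^bsub>M\<^esub> a)"
    if "a \<in> carrier A" "f \<in> carrier H" "m \<in> carrier N"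
  proof -
    have "tens B H N f m \<triangleleft>\<^bsub>HN\<^esub> a = tens B H N f (m \<triangleleft>\<^bsub>N\<^esub> a)"
      by (rule T(2)[OF _ that]) (rule compat)
    then show ?thesis by simp
  qed
  show "additive_on HNg HNg (\<lambda>u. u \<triangleleft>\<^bsub>HN\<^esub> a)" if "a \<in> carrier A"
    by (rule T(3)[OF _ that]) (rule compat)
qed

lemmas tens_HN = tens_closed[OF right_module_H left_module_eval] tens_additive_left[OF right_module_H left_module_eval]
  tens_additive_right[OF right_module_H left_module_eval] tens_balanced[OF right_module_H left_module_eval]

lemma HN_groups: "abelian_group HNg" "abelian_group (tensor_group A HN C)"
  by (rule tensor_group_abelian[OF right_module_H left_module_eval] tensor_group_abelian[OF right_module_HN modules(1)])+

lemma H_add_apply: "\<lbrakk>f \<in> carrier H; g \<in> carrier H; m \<in> carrier M\<rbrakk> \<Longrightarrow> (f \<oplus>\<^bsub>H\<^esub> g) m = f m \<oplus>\<^bsub>C\<^esub> g m"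
  by simp

lemma ev_balanced: "balanced_map B H N C (\<lambda>f m. f m)"
proof (rule balanced_mapI)
  show "additive_on H C (\<lambda>f. f m)" if "m \<in> carrier N" for m
    using that by (intro additive_onI HD(3) H_add_apply) simp_all
  fix f assume f: "f \<in> carrier H"
  show "additive_on N C f" using HD(2)[OF f] by (simp add: additive_on_def)
  show "(f \<triangleleft>\<^bsub>H\<^esub> b) m = f (b \<odot>\<^bsub>N\<^esub> m)" if "b \<in> carrier B" "m \<in> carrier N" for b m
    using that(2) by (simp add: compose_eq)
qed

abbreviation "ev \<equiv> tensor_lift B H N C (\<lambda>f m. f m)"

lemmas ev_lift = tensor_lift_balanced[OF right_module_H left_module_eval groups(2) ev_balanced]

lemma ev_right_hom: "ev \<in> right_hom A HN C"
proof -
  have "ev (u \<triangleleft>\<^bsub>HN\<^esub> a) = ev u \<triangleleft>\<^bsub>C\<^esub> a" if u: "u \<in> carrier HNg" and a: "a \<in> carrier A" for u a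
  proof -
    have act: "additive_on C C (\<lambda>c. c \<triangleleft>\<^bsub>C\<^esub> a)"
      using a by (intro additive_onI) (simp_all add: C.ract_closed C.ract_add_left)
    show ?thesis
    proof (rule tensor_eqI[OF right_module_H left_module_eval groups(2)
          additive_on_compose[OF ract_HN_additive[OF a] ev_lift(2)] additive_on_compose[OF ev_lift(2) act] _ u])
      fix f m assume f: "f \<in> carrier H" and m: "m \<in> carrier N"
      have m': "m \<in> carrier M" and ma: "m \<triangleleft>\<^bsub>M\<^esub> a \<in> carrier N" using m M.ract_closed[of m a] a by simp_all
      show "ev (tens B H N f m \<triangleleft>\<^bsub>HN\<^esub> a) = ev (tens B H N f m) \<triangleleft>\<^bsub>C\<^esub> a"
        unfolding ract_HN[OF a f m] ev_lift(3)[OF f m] ev_lift(3)[OF f ma] by (rule HD(4)[OF f m' a])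
    qed
  qed
  then show ?thesis using ev_lift(1) by (simp add: right_hom_def)
qed

abbreviation "HNC \<equiv> tensor_group A HN C"
abbreviation "insert_left f \<equiv> tensor_lift A N C (tensor A HN C) (\<lambda>m c. tens A HN C (tens B H N f m) c)"

lemmas tens_HNC = tens_closed[OF right_module_HN modules(1)] tens_additive_left[OF right_module_HN modules(1)]
  tens_additive_right[OF right_module_HN modules(1)] tens_balanced[OF right_module_HN modules(1)]

text \<open>The inner lift of \<open>tensor_right_coaction\<close>: A acts on Hom(M, C) \<otimes> M
  through M, so a scalar on m is a scalar on f \<otimes> m and crosses to c.\<close>

lemma insert_left_balanced:
  assumes f: "f \<in> carrier H"
  shows "balanced_map A N C (tensor A HN C) (\<lambda>m c. tens A HN C (tens B H N f m) c)"
  unfolding balanced_map_tensor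
proof (rule balanced_mapI)
  show "additive_on N HNC (\<lambda>m. tens A HN C (tens B H N f m) c)" if "c \<in> carrier C" for c
    using additive_on_compose[OF tens_HN(3)[OF f] tens_HNC(2)[OF that, unfolded additive_on_tensor]] .
  fix m assume m: "m \<in> carrier N"
  have fm: "tens B H N f m \<in> carrier HN" using tens_HN(1)[OF f m] by simp
  show "additive_on C HNC (tens A HN C (tens B H N f m))" by (rule tens_HNC(3)[OF fm])
  fix a c assume a: "a \<in> carrier A" and c: "c \<in> carrier C"
  show "tens A HN C (tens B H N f (m \<triangleleft>\<^bsub>N\<^esub> a)) c = tens A HN C (tens B H N f m) (a \<odot>\<^bsub>C\<^esub> c)"
    using tens_HNC(4)[OF fm a c] ract_HN[OF a f m] by simp
qed

lemmas insert_left_lift = tensor_lift_balanced[OF right_module_eval modules(1) abelian_group_tensor[OF right_module_HN modules(1)]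
  insert_left_balanced, unfolded additive_on_tensor tensor_group_eval eval_bimodule_simps]

text \<open>Balancedness over B combines two facts: \<open>\<rho> (b m)\<close> is (b \<otimes> id)
  \<open>\<rho> m\<close> by colinearity of b, and inside the left factor b crosses the tensor sign
  over B to f.\<close>

lemma HN_coaction_balanced: "balanced_map B H N (tensor A HN C) (\<lambda>f m. insert_left f (\<rho> m))"
  unfolding balanced_map_tensor
proof (rule balanced_mapI)
  interpret H: right_module B H by (rule right_module_H)
  fix m assume "m \<in> carrier N"
  then have m: "m \<in> carrier M" by simp
  show "additive_on H HNC (\<lambda>f. insert_left f (\<rho> m))"
  proof (rule additive_onI)
    fix f assume f: "f \<in> carrier H"
    show "insert_left f (\<rho> m) \<in> carrier HNC" using insert_left_lift(2)[OF f] rho_closed[OF m] by (rule additive_onD)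
    fix g assume g: "g \<in> carrier H"
    have fg: "f \<oplus>\<^bsub>H\<^esub> g \<in> carrier H" by (rule H.X.a_closed[OF f g])
    show "insert_left (f \<oplus>\<^bsub>H\<^esub> g) (\<rho> m) = insert_left f (\<rho> m) \<oplus>\<^bsub>HNC\<^esub> insert_left g (\<rho> m)"
    proof (rule tensor_eqI[OF modules(3,1) HN_groups(2) insert_left_lift(2)[OF fg]
          additive_on_add[OF HN_groups(2) insert_left_lift(2)[OF f] insert_left_lift(2)[OF g]] _ rho_closed[OF m]])
      fix m c assume m: "m \<in> carrier M" and c: "c \<in> carrier C"
      then have mN: "m \<in> carrier N" by simp
      show "insert_left (f \<oplus>\<^bsub>H\<^esub> g) (tens A M C m c) = insert_left f (tens A M C m c) \<oplus>\<^bsub>HNC\<^esub> insert_left g (tens A M C m c)"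
        unfolding insert_left_lift(3)[OF fg m c] insert_left_lift(3)[OF f m c] insert_left_lift(3)[OF g m c]
          additive_onD(2)[OF tens_HN(2)[OF mN] f g]
        using additive_onD(2)[OF tens_HNC(2)[OF c]] tens_HN(1) f g mN by simp
    qed
  qed
next
  fix f assume f: "f \<in> carrier H"
  show "additive_on N HNC (\<lambda>m. insert_left f (\<rho> m))"
    using additive_on_compose[OF coaction(1) insert_left_lift(2)[OF f]] by (simp add: additive_on_def)
  fix b m assume b: "b \<in> carrier B" and "m \<in> carrier N"
  then have m: "m \<in> carrier M" by simp
  interpret H: right_module B H by (rule right_module_H)
  have fb: "f \<triangleleft>\<^bsub>H\<^esub> b \<in> carrier H" by (rule H.ract_closed[OF f b])
  note T = tensor_map_id_right[OF modules(3,3,1) EndD(1)[OF b]]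
  have "insert_left (f \<triangleleft>\<^bsub>H\<^esub> b) (\<rho> m) = insert_left f (tensor_map A M C M C b (\<lambda>c. c) (\<rho> m))"
  proof (rule tensor_eqI[OF modules(3,1) HN_groups(2) insert_left_lift(2)[OF fb]
        additive_on_compose[OF additive_maps_additive_on[OF T(1)] insert_left_lift(2)[OF f]] _ rho_closed[OF m]])
    fix m c assume m: "m \<in> carrier M" and c: "c \<in> carrier C"
    then have mN: "m \<in> carrier N" by simp
    show "insert_left (f \<triangleleft>\<^bsub>H\<^esub> b) (tens A M C m c) = insert_left f (tensor_map A M C M C b (\<lambda>c. c) (tens A M C m c))"
      using tens_HN(4)[OF f b mN]
      by (simp only: insert_left_lift(3)[OF fb m c] T(2)[OF m c] insert_left_lift(3)[OF f EndD(3)[OF b m] c] eval_bimodule_simps)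
  qed
  then show "insert_left (f \<triangleleft>\<^bsub>H\<^esub> b) (\<rho> m) = insert_left f (\<rho> (b \<odot>\<^bsub>N\<^esub> m))"
    by (simp only: EndD(5)[OF b m] eval_bimodule_simps)
qed

abbreviation "HN_coaction \<equiv> tensor_right_coaction A B C H N \<rho>"

lemmas HN_coaction_lift = tensor_lift_balanced[OF right_module_H left_module_eval
    abelian_group_tensor[OF right_module_HN modules(1)] HN_coaction_balanced, folded tensor_right_coaction_def, unfolded additive_on_tensor]

text \<open>On f \<otimes> m the claim is colinearity of f at m, because evaluation after
  \<open>insert_left f\<close> is f \<otimes> id.\<close>

lemma ev_comodule_hom: "ev \<in> right_comodule_hom A C HN HN_coaction C \<Delta>"
proof -
  note E = tensor_map_id_right[OF right_module_HN modules(2,1) ev_right_hom]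
  have "\<Delta> (ev u) = tensor_map A HN C C C ev (\<lambda>c. c) (HN_coaction u)" if u: "u \<in> carrier HNg" for u
  proof (rule tensor_eqI[OF right_module_H left_module_eval tensor_groups(4) additive_on_compose[OF ev_lift(2) comult]
        additive_on_compose[OF HN_coaction_lift(2) additive_maps_additive_on[OF E(1)]] _ u])
    fix f m assume f: "f \<in> carrier H" and mN: "m \<in> carrier N"
    then have m: "m \<in> carrier M" by simp
    note T = tensor_map_id_right[OF modules(3,2,1) HD(1)[OF f]]
    have "tensor_map A M C C C f (\<lambda>c. c) (\<rho> m) = tensor_map A HN C C C ev (\<lambda>c. c) (insert_left f (\<rho> m))"
    proof (rule tensor_eqI[OF modules(3,1) tensor_groups(4) additive_maps_additive_on[OF T(1)]
          additive_on_compose[OF insert_left_lift(2)[OF f] additive_maps_additive_on[OF E(1)]] _ rho_closed[OF m]])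
      fix m c assume m: "m \<in> carrier M" and c: "c \<in> carrier C"
      then have mN: "m \<in> carrier N" by simp
      have fm: "tens B H N f m \<in> carrier HN" using tens_HN(1)[OF f mN] by simp
      show "tensor_map A M C C C f (\<lambda>c. c) (tens A M C m c)
          = tensor_map A HN C C C ev (\<lambda>c. c) (insert_left f (tens A M C m c))"
        by (simp only: T(2)[OF m c] insert_left_lift(3)[OF f m c] E(2)[OF fm c] ev_lift(3)[OF f mN])
    qed
    then show "\<Delta> (ev (tens B H N f m)) = tensor_map A HN C C C ev (\<lambda>c. c) (HN_coaction (tens B H N f m))"
      by (simp only: ev_lift(3)[OF f mN] HN_coaction_lift(3)[OF f mN] HD(5)[OF f m])
  qed
  then show ?thesis using ev_right_hom by (simp add: right_comodule_hom_def)
qed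

section \<open>Right comodule maps to C as coefficients\<close>

abbreviation "coefs \<xi> \<equiv> \<lambda>m\<in>carrier M. coef \<xi> m"

lemma coefs_End:
  assumes "\<xi> \<in> carrier D" "b \<in> carrier B"
  shows "coefs (compose (carrier M) \<xi> b) = coefs \<xi> \<triangleleft>\<^bsub>H\<^esub> b"
  unfolding H_simps compose_def[of "carrier M" "coefs \<xi>"]
  by (rule restrict_ext) (simp add: coef_End[OF assms] EndD(3)[OF assms(2)] del: comodule_End_simps)

text \<open>Apply \<epsilon> \<otimes> id to \<Delta>(f m) = (f \<otimes> id)
  \<open>\<rho> m\<close>. The left counit law turns one side into f m, and the other side is the
  coefficient of \<epsilon> f.\<close>

lemma H_eq_coefs:
  assumes f: "f \<in> carrier H"
  obtains \<xi> where "\<xi> \<in> carrier D" "f = coefs \<xi>"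
proof
  let ?\<xi> = "\<lambda>m\<in>carrier M. \<epsilon> (f m)"
  show \<xi>: "?\<xi> \<in> carrier D"
    by (rule restrict_dual[OF additive_on_compose[OF HD(2)[OF f] counit(1)]])
      (simp only: HD(3,4)[OF f] counit(3))
  have bal: "balanced_map A C C C (\<lambda>d d'. \<epsilon> d \<odot>\<^bsub>C\<^esub> d')"
    by (intro balanced_mapI additive_onI)
      (simp_all add: additive_onD[OF counit(1)] counit C.lact_closed C.lact_add_left C.lact_add_right C.lact_mult)
  note E = tensor_lift_balanced[OF modules(2,1) groups(2) bal]
  note T = tensor_map_id_right[OF modules(3,2,1) HD(1)[OF f]]
  have "f m = coef ?\<xi> m" if m: "m \<in> carrier M" for m
  proof -
    have "coef ?\<xi> m = tensor_lift A C C C (\<lambda>d d'. \<epsilon> d \<odot>\<^bsub>C\<^esub> d') (tensor_map A M C C C f (\<lambda>c. c) (\<rho> m))"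
      unfolding coefficient_def
    proof (rule tensor_eqI[OF modules(3,1) groups(2) coefficient_lift(2)[OF \<xi>]
          additive_on_compose[OF additive_maps_additive_on[OF T(1)] E(2)] _ rho_closed[OF m]])
      fix m c assume m: "m \<in> carrier M" and c: "c \<in> carrier C"
      show "tensor_lift A M C C (\<lambda>m c. ?\<xi> m \<odot>\<^bsub>C\<^esub> c) (tens A M C m c)
          = tensor_lift A C C C (\<lambda>d d'. \<epsilon> d \<odot>\<^bsub>C\<^esub> d') (tensor_map A M C C C f (\<lambda>c. c) (tens A M C m c))"
        unfolding coefficient_lift(3)[OF \<xi> m c] T(2)[OF m c] E(3)[OF HD(3)[OF f m] c] by (simp add: m)
    qed
    also have "\<dots> = f m"
      unfolding HD(5)[OF f m, symmetric] by (rule coring.counital_left[OF coring HD(3)[OF f m]])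
    finally show ?thesis by simp
  qed
  then show "f = coefs ?\<xi>"
    using additive_mapsD(1)[OF right_homD(1)[OF HD(1)[OF f]]]
    by (intro extensionalityI[where A = "carrier M"]) simp_all
qed

end

section \<open>The splitting of the action map\<close>

text \<open>The data of (b) and (c), with one section \<sigma> fixed. Colinearity of the map in (c)
  is recorded besides that of \<sigma>: it is the source of \<open>comult_coef\<close>.\<close>

locale galois_criterion = comodule_with_dual_basis K A C \<Delta> \<epsilon> M \<rho> n e x
  for K :: "('k, 'w) ring_scheme" and A :: "('k, 'a) module" and C :: "('a, 'a, 'c) bimodule"
    and \<Delta> :: "'c \<Rightarrow> ('c, 'c) tensor" and \<epsilon> :: "'c \<Rightarrow> 'a"
    and M :: "('k, 'a, 'm) bimodule" and \<rho> :: "'m \<Rightarrow> ('m, 'c) tensor"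
    and n :: nat and e :: "nat \<Rightarrow> 'm" and x :: "nat \<Rightarrow> 'm \<Rightarrow> 'a" +
  fixes \<sigma> :: "'c \<Rightarrow> ('m \<Rightarrow> 'a, 'm) tensor"
  assumes iso: "left_module_iso B BM Z \<Phi>"
    and can: "lifted_can K A C M \<rho> \<in> left_comodule_hom A C DM DM_coaction C \<Delta>"
    and section_hom: "\<sigma> \<in> left_comodule_hom A C C \<Delta> DM DM_coaction"
    and can_section: "c \<in> carrier C \<Longrightarrow> lifted_can K A C M \<rho> (\<sigma> c) = c"
begin

text \<open>Colinearity of the map in (c) at \<xi> \<otimes> m, expanded by
  \<open>DM_coaction_tens\<close>. Read as a function of \<xi> it gives left colinearity of c(-, m),
  read as a function of m right colinearity of c(\<xi>, -).\<close>

lemma comult_coef: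
  assumes \<xi>: "\<xi> \<in> carrier D" and m: "m \<in> carrier M"
  shows "\<Delta> (coef \<xi> m) = (\<Oplus>\<^bsub>tensor_group A C C\<^esub>i\<in>{..<n}. tens A C C (coef \<xi> (e i)) (coef (x i) m))"
proof -
  interpret CC: abelian_group "tensor_group A C C" by (rule tensor_groups)
  note T = tensor_map_id_left[OF modules(2) left_module_DM modules(1) left_comodule_homD(1)[OF can]]
  have "\<Delta> (coef \<xi> m) = tensor_map A C DM C C (\<lambda>c. c) (lifted_can K A C M \<rho>) (DM_coaction (tens K D M \<xi> m))"
    using left_comodule_homD(2)[OF can] by (simp add: lifted_can_lift(3)[OF \<xi> m, symmetric] tens_DM(1)[OF \<xi> m])
  also have "\<dots> = (\<Oplus>\<^bsub>tensor_group A C C\<^esub>i\<in>{..<n}. tens A C C (coef \<xi> (e i)) (coef (x i) m))"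
    unfolding DM_coaction_tens[OF \<xi> m]
    by (rule trans[OF additive_on_finsum_eq[OF tensor_groups(2,4) T(1)] CC.finsum_cong'[OF refl]])
      (simp_all add: Pi_iff tens_CDM(1) tens_DM(1) tens_closed[OF modules(2,1)] T(2) coef_closed \<xi> m basisD lifted_can_lift(3))
  finally show ?thesis .
qed

lemma coef_left_comodule_hom:
  assumes m: "m \<in> carrier M"
  shows "(\<lambda>\<xi>\<in>carrier D. coef \<xi> m) \<in> left_comodule_hom A C D L C \<Delta>"
proof -
  interpret CC: abelian_group "tensor_group A C C" by (rule tensor_groups)
  have f: "(\<lambda>\<xi>\<in>carrier D. coef \<xi> m) \<in> left_hom A D C"
    by (rule restrict_left_hom[OF left_module_dual coef_additive_left[OF m]]) (rule coef_lact[OF _ _ m])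
  note T = tensor_map_id_left[OF modules(2) left_module_dual modules(1) f]
  have "\<Delta> (coef \<xi> m) = tensor_map A C D C C (\<lambda>c. c) (\<lambda>\<xi>\<in>carrier D. coef \<xi> m) (L \<xi>)" if \<xi>: "\<xi> \<in> carrier D" for \<xi>
    unfolding comult_coef[OF \<xi> m] L_eq[OF \<xi>]
    by (rule sym[OF trans[OF additive_on_finsum_eq[OF tensor_groups(1,4) T(1)] CC.finsum_cong'[OF refl]]])
      (simp_all add: Pi_iff tens_CD(1) tens_closed[OF modules(2,1)] T(2) coef_closed \<xi> m basisD)
  then show ?thesis using f by (simp add: left_comodule_hom_def)
qed

definition splitting :: "'m \<Rightarrow> ('m \<Rightarrow> 'm, 'm) tensor" where
  "splitting m = inv_into (carrier BM) \<Phi> (\<lambda>\<xi>\<in>carrier D. \<sigma> (coef \<xi> m))"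

text \<open>\<open>inv_into\<close> is a genuine preimage here: \<sigma> after c(-, m) is a
  composite of left comodule maps, hence in \<open>Z\<close>, and \<open>\<Phi>\<close> is onto
  \<open>Z\<close>.\<close>

lemma splitting:
  assumes m: "m \<in> carrier M"
  shows "splitting m \<in> carrier (tensor_group K BB M)"
    and "\<xi> \<in> carrier D \<Longrightarrow> \<Phi> (splitting m) \<xi> = \<sigma> (coef \<xi> m)"
    and "\<Phi> (splitting m) = (\<lambda>\<xi>\<in>carrier D. \<sigma> (coef \<xi> m))"
proof -
  let ?f = "\<lambda>\<xi>\<in>carrier D. \<sigma> (coef \<xi> m)"
  have "(\<lambda>\<xi>\<in>carrier D. \<sigma> ((\<lambda>\<xi>\<in>carrier D. coef \<xi> m) \<xi>)) \<in> left_comodule_hom A C D L DM DM_coaction"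
    by (rule left_comodule_hom_compose[OF modules(2) left_module_dual modules(1) left_module_DM L_closed
          coef_left_comodule_hom[OF m] section_hom])
  moreover have "(\<lambda>\<xi>\<in>carrier D. \<sigma> ((\<lambda>\<xi>\<in>carrier D. coef \<xi> m) \<xi>)) = ?f" by (rule restrict_ext) simp
  ultimately have "?f \<in> carrier Z" by (simp only: Z_simps)
  then have "?f \<in> \<Phi> ` carrier BM" using iso by (simp only: left_module_iso_def bij_betw_def)
  from inv_into_into[OF this] f_inv_into_f[OF this]
  show "splitting m \<in> carrier (tensor_group K BB M)" "\<Phi> (splitting m) = ?f"
    by (simp_all add: splitting_def)
  then show "\<Phi> (splitting m) \<xi> = \<sigma> (coef \<xi> m)" if "\<xi> \<in> carrier D" using that by simp
qed

lemma action_splitting: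
  assumes m: "m \<in> carrier M"
  shows "action (splitting m) = m"
proof (rule dual_separates[OF _ m])
  show am: "action (splitting m) \<in> carrier M"
    using action_lift(2) splitting(1)[OF m] by (rule additive_onD)
  fix \<xi> assume \<xi>: "\<xi> \<in> carrier D"
  \<comment> \<open>Evaluate the map of (c) on \<open>\<Phi> (splitting m) \<xi>\<close> twice: as
    \<sigma>(c(\<xi>, m)) it gives c(\<xi>, m), and by \<open>lifted_can_End_tensor_map\<close> it
    gives the left side. Applying \<epsilon> leaves values of \<xi>.\<close>
  have "coef \<xi> (action (splitting m)) = coef \<xi> m"
    using lifted_can_End_tensor_map[OF splitting(1)[OF m] \<xi>] by (simp add: splitting(2)[OF m \<xi>] can_section coef_closed[OF \<xi> m])
  then show "\<xi> (action (splitting m)) = \<xi> m"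
    using counit_coef[OF \<xi> m] counit_coef[OF \<xi> am] by simp
qed

lemma \<Phi>_inj: "\<lbrakk>u \<in> carrier BM; v \<in> carrier BM; \<Phi> u = \<Phi> v\<rbrakk> \<Longrightarrow> u = v"
  using iso by (auto simp: left_module_iso_def bij_betw_def dest: inj_onD)

lemma \<sigma>_additive: "additive_on C (tensor_group K D M) \<sigma>"
  using left_homD(2)[OF left_comodule_homD(1)[OF section_hom]] by simp

lemma splitting_hom: "(\<lambda>m\<in>carrier N. splitting m) \<in> left_hom B N BM"
proof (rule restrict_left_hom[OF left_module_eval], unfold additive_on_tensor eval_bimodule_simps)
  interpret BM: left_module B BM by (rule left_module_BM)
  have \<Phi>: "\<Phi> \<in> left_hom B BM Z" using iso by (simp add: left_module_iso_def)
  show "additive_on N (tensor_group K BB M) splitting"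
  proof (rule additive_onI, unfold eval_bimodule_simps)
    fix m m' assume m: "m \<in> carrier M" and m': "m' \<in> carrier M"
    then have mm': "m \<oplus>\<^bsub>M\<^esub> m' \<in> carrier M" by simp
    have s: "splitting m \<in> carrier BM" "splitting m' \<in> carrier BM" "splitting (m \<oplus>\<^bsub>M\<^esub> m') \<in> carrier BM"
      using splitting(1) m m' by simp_all
    have "\<Phi> (splitting m \<oplus>\<^bsub>BM\<^esub> splitting m') = \<Phi> (splitting m) \<oplus>\<^bsub>Z\<^esub> \<Phi> (splitting m')"
      by (rule additive_onD(2)[OF left_homD(2)[OF \<Phi>] s(1,2)])
    also have "\<dots> = \<Phi> (splitting (m \<oplus>\<^bsub>M\<^esub> m'))"
      unfolding splitting(3)[OF m] splitting(3)[OF m'] splitting(3)[OF mm'] Z_simps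
      by (rule restrict_ext) (simp add: additive_onD(2)[OF coef_additive_right] m m' additive_onD(2)[OF \<sigma>_additive] coef_closed)
    finally have "splitting m \<oplus>\<^bsub>BM\<^esub> splitting m' = splitting (m \<oplus>\<^bsub>M\<^esub> m')"
      by (rule \<Phi>_inj[OF BM.X.a_closed[OF s(1,2)] s(3)])
    then show "splitting (m \<oplus>\<^bsub>M\<^esub> m') = splitting m \<oplus>\<^bsub>tensor_group K BB M\<^esub> splitting m'" by simp
  qed (rule splitting(1))
  fix b m assume b: "b \<in> carrier B" and m: "m \<in> carrier M"
  have bm: "b m \<in> carrier M" by (rule EndD(3)[OF b m])
  have s: "splitting m \<in> carrier BM" "splitting (b m) \<in> carrier BM" using splitting(1) m bm by simp_all
  \<comment> \<open>B acts on \<open>Z\<close> by precomposition with \<xi> \<mapsto> \<xi> \<circ>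
    b, so at \<xi> the chain reads \<sigma>(c(\<xi> b, m)) = \<sigma>(c(\<xi>, b m)); injectivity of
    \<open>\<Phi>\<close> then removes \<open>\<Phi>\<close>.\<close>
  have "\<Phi> (b \<odot>\<^bsub>BM\<^esub> splitting m) = b \<odot>\<^bsub>Z\<^esub> \<Phi> (splitting m)" by (rule left_homD(4)[OF \<Phi> b s(1)])
  also have "\<dots> = \<Phi> (splitting (b m))"
    unfolding splitting(3)[OF m] splitting(3)[OF bm] Z_simps
    by (rule restrict_ext) (simp add: compose_dual[OF _ b] coef_End[OF _ b m])
  finally show "splitting (b m) = b \<odot>\<^bsub>BM\<^esub> splitting m"
    by (rule \<Phi>_inj[OF BM.lact_closed[OF b s(1)] s(2), symmetric])
qed

text \<open>A K-linear section t of p extends to the B-linear map b \<otimes> m \<mapsto> b t(m) on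
  B \<otimes> M, and p after it is the action map. Precomposing with \<open>splitting\<close>, which
  is B-linear, turns t into a B-linear section.\<close>

theorem relatively_projective: "relatively_projective_left_module TYPE('n) K B N"
  unfolding relatively_projective_left_module_def
proof (intro conjI allI impI, rule left_module_eval)
  fix P :: "('m \<Rightarrow> 'm, 'n) module" and p t
  assume "left_module B P \<and> p \<in> left_hom B P N \<and> p ` carrier P = carrier N \<and> t \<in> additive_maps N P \<and>
    (\<forall>k\<in>carrier K. \<forall>m\<in>carrier N. t ((k \<odot>\<^bsub>B\<^esub> \<one>\<^bsub>B\<^esub>) \<odot>\<^bsub>N\<^esub> m) = (k \<odot>\<^bsub>B\<^esub> \<one>\<^bsub>B\<^esub>) \<odot>\<^bsub>P\<^esub> t m) \<and>
    (\<forall>m\<in>carrier N. p (t m) = m)"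
  then have P: "left_module B P" and p: "p \<in> left_hom B P N" and t: "t \<in> additive_maps N P"
    and t_scalar: "\<And>k m. \<lbrakk>k \<in> carrier K; m \<in> carrier M\<rbrakk> \<Longrightarrow>
      t ((k \<odot>\<^bsub>B\<^esub> \<one>\<^bsub>B\<^esub>) m) = (k \<odot>\<^bsub>B\<^esub> \<one>\<^bsub>B\<^esub>) \<odot>\<^bsub>P\<^esub> t m"
    and pt: "\<And>m. m \<in> carrier M \<Longrightarrow> p (t m) = m"
    by simp_all
  interpret P: left_module B P by (rule P)
  have Pg: "abelian_group P" by unfold_locales
  have tM: "additive_on M P t" using additive_maps_additive_on[OF t] by (simp add: additive_on_def)
  note tcl = additive_onD(1)[OF tM]
  have bal: "balanced_map K BB M P (\<lambda>b m. b \<odot>\<^bsub>P\<^esub> t m)"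
  proof (rule balanced_mapI, unfold algebra_bimodule_simps)
    show "additive_on BB P (\<lambda>b. b \<odot>\<^bsub>P\<^esub> t m)" if "m \<in> carrier M" for m
      by (rule additive_onI, unfold algebra_bimodule_simps) (simp_all only: P.lact_closed P.lact_add_left tcl that)
    fix b assume b: "b \<in> carrier B"
    show "additive_on M P (\<lambda>m. b \<odot>\<^bsub>P\<^esub> t m)"
      by (rule additive_onI) (simp_all only: P.lact_closed P.lact_add_right additive_onD[OF tM] b)
    fix k m assume k: "k \<in> carrier K" and m: "m \<in> carrier M"
    \<comment> \<open>Here K-linearity of t enters: k b = b (k 1) moves the scalar next to t, which
      absorbs it.\<close>
    have "(k \<odot>\<^bsub>B\<^esub> \<one>\<^bsub>B\<^esub>) m = k \<odot>\<^bsub>M\<^esub> m" using m by simp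
    then show "(k \<odot>\<^bsub>B\<^esub> b) \<odot>\<^bsub>P\<^esub> t m = b \<odot>\<^bsub>P\<^esub> t (k \<odot>\<^bsub>M\<^esub> m)"
      using P.lact_mult[OF b End_ract(3)[OF k b] tcl[OF m]] t_scalar[OF k m] by (simp only: End_ract(1)[OF k b])
  qed
  \<comment> \<open>The B-linear extension of t from the generators 1 \<otimes> m.\<close>
  define \<tau> where "\<tau> = tensor_lift K BB M P (\<lambda>b m. b \<odot>\<^bsub>P\<^esub> t m)"
  note \<tau> = tensor_lift_balanced[OF right_module_End left_module_KM Pg bal, folded \<tau>_def]
  note s = left_homD[OF splitting_hom]
  have \<tau>_hom: "\<tau> (b \<odot>\<^bsub>BM\<^esub> u) = b \<odot>\<^bsub>P\<^esub> \<tau> u" if b: "b \<in> carrier B" and u: "u \<in> carrier (tensor_group K BB M)" for b u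
  proof -
    interpret BM: left_module B BM by (rule left_module_BM)
    interpret BB: left_module B BB by (rule left_module_End)
    have 1: "additive_on (tensor_group K BB M) (tensor_group K BB M) (\<lambda>u. b \<odot>\<^bsub>BM\<^esub> u)"
      using BM.lact_closed[OF b] BM.lact_add_right[OF b] by (intro additive_onI) simp_all
    have 2: "additive_on P P (\<lambda>u. b \<odot>\<^bsub>P\<^esub> u)"
      using P.lact_closed[OF b] P.lact_add_right[OF b] by (intro additive_onI) simp_all
    show ?thesis
    proof (rule tensor_eqI[OF right_module_End left_module_KM Pg additive_on_compose[OF 1 \<tau>(2)] additive_on_compose[OF \<tau>(2) 2] _ u])
      fix c m assume c: "c \<in> carrier BB" and m: "m \<in> carrier M"
      have bc: "b \<otimes>\<^bsub>B\<^esub> c \<in> carrier BB" and c': "c \<in> carrier B"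
        using BB.lact_closed[OF b c] c by (simp_all only: algebra_bimodule_simps)
      show "\<tau> (b \<odot>\<^bsub>BM\<^esub> tens K BB M c m) = b \<odot>\<^bsub>P\<^esub> \<tau> (tens K BB M c m)"
        unfolding lact_BM[OF b c m] \<tau>(3)[OF bc m] \<tau>(3)[OF c m] by (rule P.lact_mult[OF b c' tcl[OF m]])
    qed
  qed
  have pN: "additive_on P M p" using left_homD(2)[OF p] by (simp add: additive_on_def)
  have p\<tau>: "p (\<tau> u) = action u" if u: "u \<in> carrier (tensor_group K BB M)" for u
  proof (rule tensor_eqI[OF right_module_End left_module_KM groups(3) additive_on_compose[OF \<tau>(2) pN] action_lift(2) _ u])
    fix b m assume b: "b \<in> carrier BB" and m: "m \<in> carrier M"
    then have b': "b \<in> carrier B" by simp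
    show "p (\<tau> (tens K BB M b m)) = action (tens K BB M b m)"
      unfolding \<tau>(3)[OF b m] action_lift(3)[OF b m] left_homD(4)[OF p b' tcl[OF m]] by (simp add: pt[OF m])
  qed
  show "\<exists>t\<in>left_hom B N P. \<forall>m\<in>carrier N. p (t m) = m"
  proof (intro bexI ballI)
    show "(\<lambda>m\<in>carrier N. \<tau> (splitting m)) \<in> left_hom B N P"
    proof (rule restrict_left_hom[OF left_module_eval])
      have "additive_on N (tensor_group K BB M) splitting"
        using s(2) additive_on_cong[of N "\<lambda>m\<in>carrier N. splitting m" splitting "tensor_group K BB M"] left_module_eval
        by (simp add: left_module_def)
      from additive_on_compose[OF this \<tau>(2)] show "additive_on N P (\<lambda>m. \<tau> (splitting m))" .
      fix b m assume b: "b \<in> carrier B" and m: "m \<in> carrier N"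
      then have m': "m \<in> carrier M" by simp
      show "\<tau> (splitting (b \<odot>\<^bsub>N\<^esub> m)) = b \<odot>\<^bsub>P\<^esub> \<tau> (splitting m)"
        using s(4)[OF b m] \<tau>_hom[OF b splitting(1)[OF m']] EndD(3)[OF b m'] m' by (simp del: comodule_End_simps)
    qed
    fix m assume "m \<in> carrier N"
    then show "p ((\<lambda>m\<in>carrier N. \<tau> (splitting m)) m) = m"
      using p\<tau>[OF splitting(1)] action_splitting by simp
  qed
qed

section \<open>Galois comodules\<close>

text \<open>Start from \<Sum> c(\<xi>, e_i) \<otimes> c(x_i, m) in \<open>comult_coef\<close>. Each
  c(x_i, m) is a sum of elements x_i(n) c with n \<otimes> c running through
  \<open>\<rho> m\<close>; moving x_i(n) to the left factor, \<open>coef_expand\<close> collapses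
  the sum over i to c(\<xi>, n) \<otimes> c.\<close>

lemma coefs_closed:
  assumes \<xi>: "\<xi> \<in> carrier D"
  shows "coefs \<xi> \<in> carrier H"
proof -
  interpret CC: abelian_group "tensor_group A C C" by (rule tensor_groups)
  have f: "coefs \<xi> \<in> right_hom A M C"
    by (rule restrict_right_hom[OF modules(3) coef_additive_right[OF \<xi>]]) (rule coef_ract[OF _ \<xi>])
  note T = tensor_map_id_right[OF modules(3,2,1) f]
  have "\<Delta> (coef \<xi> m) = tensor_map A M C C C (coefs \<xi>) (\<lambda>c. c) (\<rho> m)" if m: "m \<in> carrier M" for m
  proof -
    \<comment> \<open>\<open>?p i\<close> at \<open>\<rho> m\<close> is \<open>coef (x i) m\<close>.
      Separating it from m gives a sum that is additive in an arbitrary element of M \<otimes> C, as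
      \<open>tensor_eqI\<close> requires.\<close>
    let ?p = "\<lambda>i. tensor_lift A M C C (\<lambda>m c. x i m \<odot>\<^bsub>C\<^esub> c)"
    have \<xi>e: "coef \<xi> (e i) \<in> carrier C" if "i < n" for i using that by (simp add: coef_closed \<xi> basisD)
    have p: "additive_on (tensor_group A M C) (tensor_group A C C) (\<lambda>u. tens A C C (coef \<xi> (e i)) (?p i u))" if "i < n" for i
      by (rule additive_on_compose[OF coefficient_lift(2)[OF basisD(2)[OF that]] tens_additive_right[OF modules(2,1) \<xi>e[OF that]]])
    have "(\<Oplus>\<^bsub>tensor_group A C C\<^esub>i\<in>{..<n}. tens A C C (coef \<xi> (e i)) (?p i (\<rho> m)))
        = tensor_map A M C C C (coefs \<xi>) (\<lambda>c. c) (\<rho> m)"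
    proof (rule tensor_eqI[OF modules(3,1) tensor_groups(4) additive_on_finsum[OF tensor_groups(4) p]
          additive_maps_additive_on[OF T(1)] _ rho_closed[OF m]])
      fix m c assume m: "m \<in> carrier M" and c: "c \<in> carrier C"
      have xm: "x i m \<in> carrier A" if "i < n" for i by (rule dualD(3)[OF basisD(2)[OF that] m])
      have "(\<Oplus>\<^bsub>tensor_group A C C\<^esub>i\<in>{..<n}. tens A C C (coef \<xi> (e i)) (?p i (tens A M C m c)))
          = (\<Oplus>\<^bsub>tensor_group A C C\<^esub>i\<in>{..<n}. tens A C C (coef \<xi> (e i) \<triangleleft>\<^bsub>C\<^esub> x i m) c)"
        by (rule CC.finsum_cong'[OF refl])
          (simp_all add: Pi_iff coefficient_lift(3)[OF basisD(2) m c] tens_balanced[OF modules(2,1) \<xi>e xm c]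
            tens_closed[OF modules(2,1)] \<xi>e xm c C.lact_closed)
      also have "\<dots> = tens A C C (coef \<xi> m) c"
        using additive_on_finsum_eq[OF groups(2) tensor_groups(4) tens_additive_left[OF modules(2,1) c], of "{..<n}" "\<lambda>i. coef \<xi> (e i) \<triangleleft>\<^bsub>C\<^esub> x i m"]
        by (simp add: Pi_iff \<xi>e xm C.ract_closed coef_expand[OF \<xi> m])
      also have "\<dots> = tensor_map A M C C C (coefs \<xi>) (\<lambda>c. c) (tens A M C m c)"
        using m by (simp add: T(2)[OF m c])
      finally show "(\<Oplus>\<^bsub>tensor_group A C C\<^esub>i\<in>{..<n}. tens A C C (coef \<xi> (e i)) (?p i (tens A M C m c)))
          = tensor_map A M C C C (coefs \<xi>) (\<lambda>c. c) (tens A M C m c)" .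
    qed simp
    then show ?thesis unfolding comult_coef[OF \<xi> m] coefficient_def[of _ _ _ _ "x _"] .
  qed
  then show ?thesis using f by (simp add: right_comodule_hom_def)
qed

text \<open>Scalars of K are elements of B, so they cross the tensor sign over B in the target. The
  resulting \<open>project\<close> passes from tensors over K to tensors over B, where the
  endomorphisms produced by \<open>splitting\<close> can be moved.\<close>

lemma project_balanced: "balanced_map K D M HNg (\<lambda>\<xi> m. tens B H N (coefs \<xi>) m)"
proof (rule balanced_mapI)
  have add: "additive_on D H coefs"
    by (rule additive_onI[OF coefs_closed], assumption, unfold H_simps, rule restrict_ext)
      (simp add: additive_onD(2)[OF coef_additive_left] del: dual_simps)
  show "additive_on D HNg (\<lambda>\<xi>. tens B H N (coefs \<xi>) m)" if "m \<in> carrier M" for m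
    using additive_on_compose[OF add tens_HN(2)] that by simp
  fix \<xi> assume \<xi>: "\<xi> \<in> carrier D"
  show "additive_on M HNg (tens B H N (coefs \<xi>))"
    using tens_HN(3)[OF coefs_closed[OF \<xi>]] by (simp add: additive_on_def)
  fix k m assume k: "k \<in> carrier K" and m: "m \<in> carrier M"
  then have "m \<in> carrier N" by simp
  from tens_HN(4)[OF coefs_closed[OF \<xi>] scalar_End[OF k] this]
  show "tens B H N (coefs (\<xi> \<triangleleft>\<^bsub>D\<^esub> k)) m = tens B H N (coefs \<xi>) (k \<odot>\<^bsub>M\<^esub> m)"
    unfolding dual_ract_K coefs_End[OF \<xi> scalar_End[OF k]] by (simp add: m)
qed

abbreviation "project \<equiv> tensor_lift K D M HNg (\<lambda>\<xi> m. tens B H N (coefs \<xi>) m)"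

lemmas project_lift = tensor_lift_balanced[OF right_module_dual left_module_KM HN_groups(1) project_balanced]

text \<open>On b \<otimes> m, \<open>coefs_End\<close> turns the coefficient of \<xi> b into
  c(\<xi>, -) b, and b crosses the tensor sign over B to m. The analogue of
  \<open>lifted_can_End_tensor_map\<close> before evaluation.\<close>

lemma project_End_tensor_map:
  assumes u: "u \<in> carrier (tensor_group K BB M)" and \<xi>: "\<xi> \<in> carrier D"
  shows "project (\<Phi> u \<xi>) = tens B H N (coefs \<xi>) (action u)"
proof -
  have "additive_on M HNg (tens B H N (coefs \<xi>))"
    using tens_HN(3)[OF coefs_closed[OF \<xi>]] by (simp add: additive_on_def)
  note add = additive_on_compose[OF action_lift(2) this]
  show ?thesis
  proof (rule tensor_eqI[OF right_module_End left_module_KM HN_groups(1)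
        additive_on_compose[OF additive_on_compose[OF End_tensor_map_lift(2) Z_evaluation[OF \<xi>]] project_lift(2)] add _ u])
    fix b m assume b: "b \<in> carrier BB" and m: "m \<in> carrier M"
    then have b': "b \<in> carrier B" and m': "m \<in> carrier N" by simp_all
    show "project (\<Phi> (tens K BB M b m) \<xi>) = tens B H N (coefs \<xi>) (action (tens K BB M b m))"
      using tens_HN(4)[OF coefs_closed[OF \<xi>] b' m']
      by (simp only: End_tensor_map_lift(3)[OF b m] action_lift(3)[OF b m] restrict_apply' \<xi>
          project_lift(3)[OF compose_dual[OF \<xi> b'] m] coefs_End[OF \<xi> b'] eval_bimodule_simps)
  qed
qed

lemma project_section_ev:
  assumes u: "u \<in> carrier HNg"
  shows "project (\<sigma> (ev u)) = u"
proof (rule tensor_eqI[OF right_module_H left_module_eval HN_groups(1)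
      additive_on_compose[OF additive_on_compose[OF ev_lift(2) \<sigma>_additive] project_lift(2)] additive_on_id _ u])
  fix f m assume f: "f \<in> carrier H" and m: "m \<in> carrier N"
  then have m': "m \<in> carrier M" by simp
  obtain \<xi> where \<xi>: "\<xi> \<in> carrier D" and f_eq: "f = coefs \<xi>" using f by (rule H_eq_coefs)
  have "f m = coef \<xi> m" using m' by (simp add: f_eq)
  then have "project (\<sigma> (ev (tens B H N f m))) = project (\<Phi> (splitting m) \<xi>)"
    by (simp only: ev_lift(3)[OF f m] splitting(2)[OF m' \<xi>])
  also have "\<dots> = tens B H N f m"
    by (simp only: project_End_tensor_map[OF splitting(1)[OF m'] \<xi>] action_splitting[OF m'] f_eq)
  finally show "project (\<sigma> (ev (tens B H N f m))) = tens B H N f m" .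
qed

text \<open>The map of (c) factors through evaluation, so a section \<sigma> of it yields the right
  inverse \<open>project\<close> after \<sigma>.\<close>

lemma ev_project:
  assumes u: "u \<in> carrier (tensor_group K D M)"
  shows "ev (project u) = lifted_can K A C M \<rho> u"
proof (rule tensor_eqI[OF right_module_dual left_module_KM groups(2)
      additive_on_compose[OF project_lift(2) ev_lift(2)] lifted_can_lift(2) _ u])
  fix \<xi> m assume \<xi>: "\<xi> \<in> carrier D" and m: "m \<in> carrier M"
  then have m': "m \<in> carrier N" by simp
  show "ev (project (tens K D M \<xi> m)) = lifted_can K A C M \<rho> (tens K D M \<xi> m)"
    unfolding project_lift(3)[OF \<xi> m] lifted_can_lift(3)[OF \<xi> m] ev_lift(3)[OF coefs_closed[OF \<xi>] m'] using m by simp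
qed

theorem ev_comodule_iso: "right_comodule_iso A C HN HN_coaction C \<Delta> ev"
  unfolding right_comodule_iso_def
proof (intro conjI ev_comodule_hom bij_betw_byWitness[where f' = "\<lambda>c. project (\<sigma> c)"] ballI)
  show "project (\<sigma> (ev u)) = u" if "u \<in> carrier HN" for u using project_section_ev that by simp
  show "ev (project (\<sigma> c)) = c" if "c \<in> carrier C" for c
    using ev_project[OF additive_onD(1)[OF \<sigma>_additive that]] can_section[OF that] by simp
  show "ev ` carrier HN \<subseteq> carrier C" using additive_onD(1)[OF ev_lift(2)] by auto
  show "(\<lambda>c. project (\<sigma> c)) ` carrier C \<subseteq> carrier HN"
    using additive_onD(1)[OF additive_on_compose[OF \<sigma>_additive project_lift(2)]] by auto
qed

end

theorem theorem2p1:
  fixes K :: "'k ring" and A :: "('k, 'a) module" and C :: "('a, 'a, 'c) bimodule"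
    and \<Delta> :: "'c \<Rightarrow> ('c, 'c) tensor" and \<epsilon> :: "'c \<Rightarrow> 'a"
    and M :: "('k, 'a, 'm) bimodule" and \<rho> :: "'m \<Rightarrow> ('m, 'c) tensor"
  assumes "coring K A C \<Delta> \<epsilon>"
    and "right_comodule K A C \<Delta> \<epsilon> M \<rho>"
    and "fgp_right_module A M"
    and a: "flat_left_module TYPE((nat \<Rightarrow> 'a) set) A C"
    and b: "left_module_iso (comodule_End A C M \<rho>)
              (tensor K (algebra_bimodule (comodule_End A C M \<rho>)) M)
              (comodule_Hom_dual K A C M \<rho>)
              (End_tensor_map K A C M \<rho>)"
    and c: "left_comodule_split_epi A C
              (tensor K (dual A M) M)
              (tensor_left_coaction A K C (dual A M) (dual_coaction A C M \<rho>) M)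
              C \<Delta>
              (lifted_can K A C M \<rho>)"
  shows "galois_comodule K A C \<Delta> \<epsilon> M \<rho> \<and>
         relatively_projective_left_module TYPE('n) K (comodule_End A C M \<rho>) (eval_bimodule M)"
proof -
  \<comment> \<open>\<open>P\<close> is the very predicate under \<open>SOME\<close> in
    \<open>dual_coaction\<close>, so the triple extracted from it is the basis that defines the
    coaction; an arbitrary dual basis would not match the locale assumption by definition.\<close>
  define P where "P = (\<lambda>(n, e, x). dual_basis A M n e x)"
  obtain n e x where nex: "Eps P = (n, e, x)" by (rule prod_cases3)
  have "\<exists>t. P t" using fgp_imp_dual_basis[OF assms(3)] by (auto simp: P_def)
  then have "P (n, e, x)" unfolding nex[symmetric] by (rule someI_ex)
  then have basis: "dual_basis A M n e x" by (simp add: P_def)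
  have coaction: "dual_coaction A C M \<rho> = (\<lambda>\<xi>\<in>carrier (dual A M).
      \<Oplus>\<^bsub>tensor A C (dual A M)\<^esub>i\<in>{..<n}. tens A C (dual A M) (coefficient A C M \<rho> \<xi> (e i)) (x i))"
    unfolding dual_coaction_def P_def[symmetric] nex by simp
  interpret comodule_with_dual_basis K A C \<Delta> \<epsilon> M \<rho> n e x
    by (rule comodule_with_dual_basis.intro) (rule assms(2) basis coaction)+
  from c obtain \<sigma> where can: "lifted_can K A C M \<rho> \<in> left_comodule_hom A C DM DM_coaction C \<Delta>"
    and \<sigma>: "\<sigma> \<in> left_comodule_hom A C C \<Delta> DM DM_coaction"
    "\<And>y. y \<in> carrier C \<Longrightarrow> lifted_can K A C M \<rho> (\<sigma> y) = y"
    by (auto simp: left_comodule_split_epi_def)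
  interpret galois_criterion K A C \<Delta> \<epsilon> M \<rho> n e x \<sigma>
    by unfold_locales (rule b can \<sigma>, assumption?)+
  show ?thesis
    using ev_comodule_iso relatively_projective assms(2,3) by (simp add: galois_comodule_def Let_def)
qed

end
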